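(* Let $\Omega\subset\mathbb{R}^d$ be a non-empty, bounded, open set and let $\Phi\colon\mathbb{R}^N_+\to[0,\infty)$ satisfy (Φ.3). Then $\Lambda^{\Phi,N}_{1,1}(\Omega)=H^{\Phi,N}(\Omega)$. If moreover $\Phi$ satisfies (Φ.3+), then a $(1,N)$-function $u$ of $\Omega$ is a $(1,\Phi)$-eigen-$N$-function of $\Omega$ if and only if, for a.e. $t_1,\dots,t_N>0$ such that $|\{u_i>t_i\}|>0$ for $i=1,\dots,N$, the $N$-tuple $(\{u_1>t_1\},\dots,\{u_N>t_N\})$ is a $1$-adjusted $\Phi$-Cheeger $N$-cluster of $\Omega$. In particular, under (Φ.3+), if $\mathcal E$ is a $\Phi$-Cheeger $N$-cluster of $\Omega$, then $u=(\chi_{\mathcal E_1}/|\mathcal E_1|,\dots,\chi_{\mathcal E_N}/|\mathcal E_N|)$ is a $(1,\Phi)$-eigen-$N$-function of $\Omega$.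
   Context: All sets are Lebesgue measurable; inclusions/disjointness up to null sets; $|E|$ Lebesgue measure, $P(E)$ perimeter. $h(F)=\inf\{P(E)/|E|: E\subset F,|E|>0\}$. An $N$-cluster of $F$ is $\mathcal E=(\mathcal E_1,\dots,\mathcal E_N)$ with $\mathcal E_i\subset F$, $|\mathcal E_i|>0$, $P(\mathcal E_i)<\infty$, $|\mathcal E_i\cap\mathcal E_j|=0$ for $i\ne j$. $F^{\mathcal E}_i=\bigcup_{j\ne i}\mathcal E_j$; the cluster is $1$-adjusted if $P(\mathcal E_i)/|\mathcal E_i|=h(F\setminus F^{\mathcal E}_i)$ for all $i$. $H^{\Phi,N}(F)=\inf\{\Phi(P(\mathcal E_1)/|\mathcal E_1|,\dots,P(\mathcal E_N)/|\mathcal E_N|)\}$ over $N$-clusters of $F$; minimizers: $\Phi$-Cheeger $N$-clusters. $BV_0(F)=\{u\in BV(\mathbb{R}^d): u=0\text{ a.e. on }\mathbb{R}^d\setminus F\}$. A $(1,N)$-function of $F$ is $u=(u_1,\dots,u_N)$ with $u_i\in BV_0(F)$, $u_i\ge0$, $\|u_i\|_{L^1}=1$, $u_iu_j=0$ a.e. for $i\ne j$; $[u]_1=(|Du_1|(\mathbb{R}^d),\dots,|Du_N|(\mathbb{R}^d))$; $\Lambda^{\Phi,N}_{1,1}(F)=\inf\Phi([u]_1)$ over $(1,N)$-functions; minimizers: $(1,\Phi)$-eigen-$N$-functions. $\mathbb{R}^N_+$ with componentwise order: $v\le w$ iff $v_i\le w_i\ \forall i$; $v<w$ iff $v\le w$,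 $v\ne w$. (Φ.3): $v\le w\Rightarrow\Phi(v)\le\Phi(w)$. (Φ.3+): $v<w\Rightarrow\Phi(v)<\Phi(w)$. *)

theory Defs
  imports "HOL-Analysis.Analysis"
begin

text \<open>Ambient space R^d is a euclidean_space type 'a; N-tuples are indexed by a finite type 'n
  (so N = CARD('n) >= 1), vectors in R^N are real^'n.\<close>

definition test_fields :: "('a::euclidean_space \<Rightarrow> 'a) set" where
  "test_fields = {\<phi>.
     (\<exists>\<phi>'. (\<forall>x. (\<phi> has_derivative \<phi>' x) (at x)) \<and> (\<forall>b\<in>Basis. continuous_on UNIV (\<lambda>x. \<phi>' x b)))
   \<and> (\<exists>K. compact K \<and> (\<forall>x. x \<notin> K \<longrightarrow> \<phi> x = 0))
   \<and> (\<forall>x. norm (\<phi> x) \<le> 1)}"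

definition divergence :: "('a::euclidean_space \<Rightarrow> 'a) \<Rightarrow> 'a \<Rightarrow> real" where
  "divergence \<phi> x = (\<Sum>b\<in>Basis. frechet_derivative \<phi> (at x) b \<bullet> b)"

definition total_variation :: "('a::euclidean_space \<Rightarrow> real) \<Rightarrow> ereal" where
  "total_variation u = (SUP \<phi>\<in>test_fields. ereal (LINT x|lebesgue. u x * divergence \<phi> x))"

definition perimeter :: "'a::euclidean_space set \<Rightarrow> ereal" where
  "perimeter E = total_variation (indicator E :: 'a \<Rightarrow> real)"

definition subset_ae :: "'a::euclidean_space set \<Rightarrow> 'a set \<Rightarrow> bool" where
  "subset_ae E F \<longleftrightarrow> E - F \<in> null_sets lebesgue"

definition cheeger_const :: "'a::euclidean_space set \<Rightarrow> ereal" where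
  "cheeger_const F = (INF E \<in> {E. E \<in> sets lebesgue \<and> subset_ae E F \<and> emeasure lebesgue E > 0}.
      perimeter E / enn2ereal (emeasure lebesgue E))"

definition is_cluster :: "'a::euclidean_space set \<Rightarrow> ('n \<Rightarrow> 'a set) \<Rightarrow> bool" where
  "is_cluster F E \<longleftrightarrow>
     (\<forall>i. E i \<in> sets lebesgue \<and> subset_ae (E i) F \<and> emeasure lebesgue (E i) > 0
          \<and> perimeter (E i) < \<infinity>)
   \<and> (\<forall>i j. i \<noteq> j \<longrightarrow> E i \<inter> E j \<in> null_sets lebesgue)"

definition ratio :: "'a::euclidean_space set \<Rightarrow> real" where
  "ratio E = real_of_ereal (perimeter E) / measure lebesgue E"

definition ratio_vec :: "('n::finite \<Rightarrow> 'a::euclidean_space set) \<Rightarrow> real^'n" where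
  "ratio_vec E = (\<chi> i. ratio (E i))"

definition cluster_compl :: "('n \<Rightarrow> 'a set) \<Rightarrow> 'n \<Rightarrow> 'a set" where
  "cluster_compl E i = (\<Union>j\<in>UNIV - {i}. E j)"

definition one_adjusted :: "'a::euclidean_space set \<Rightarrow> ('n \<Rightarrow> 'a set) \<Rightarrow> bool" where
  "one_adjusted F E \<longleftrightarrow> (\<forall>i. ereal (ratio (E i)) = cheeger_const (F - cluster_compl E i))"

definition H_Phi :: "(real^'n \<Rightarrow> real) \<Rightarrow> 'a::euclidean_space set \<Rightarrow> real" where
  "H_Phi \<Phi> F = Inf {\<Phi> (ratio_vec E) | E. is_cluster F E}"

definition cheeger_cluster :: "(real^'n::finite \<Rightarrow> real) \<Rightarrow> 'a::euclidean_space set \<Rightarrow> ('n \<Rightarrow> 'a set) \<Rightarrow> bool" where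
  "cheeger_cluster \<Phi> F E \<longleftrightarrow> is_cluster F E \<and> \<Phi> (ratio_vec E) = H_Phi \<Phi> F"

definition BV0 :: "'a::euclidean_space set \<Rightarrow> ('a \<Rightarrow> real) set" where
  "BV0 F = {u. integrable lebesgue u \<and> total_variation u < \<infinity> \<and> (AE x in lebesgue. x \<notin> F \<longrightarrow> u x = 0)}"

definition one_N_function :: "'a::euclidean_space set \<Rightarrow> ('n \<Rightarrow> 'a \<Rightarrow> real) \<Rightarrow> bool" where
  "one_N_function F u \<longleftrightarrow>
     (\<forall>i. u i \<in> BV0 F \<and> (AE x in lebesgue. u i x \<ge> 0) \<and> (LINT x|lebesgue. \<bar>u i x\<bar>) = 1)
   \<and> (\<forall>i j. i \<noteq> j \<longrightarrow> (AE x in lebesgue. u i x * u j x = 0))"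

definition tv_vec :: "('n::finite \<Rightarrow> 'a::euclidean_space \<Rightarrow> real) \<Rightarrow> real^'n" where
  "tv_vec u = (\<chi> i. real_of_ereal (total_variation (u i)))"

definition Lambda_Phi :: "(real^'n::finite \<Rightarrow> real) \<Rightarrow> 'a::euclidean_space set \<Rightarrow> real" where
  "Lambda_Phi \<Phi> F = Inf {\<Phi> (tv_vec u) | u. one_N_function F u}"

definition eigen_N_function :: "(real^'n::finite \<Rightarrow> real) \<Rightarrow> 'a::euclidean_space set \<Rightarrow> ('n \<Rightarrow> 'a \<Rightarrow> real) \<Rightarrow> bool" where
  "eigen_N_function \<Phi> F u \<longleftrightarrow> one_N_function F u \<and> \<Phi> (tv_vec u) = Lambda_Phi \<Phi> F"

definition nonneg_vec :: "real^'n \<Rightarrow> bool" where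
  "nonneg_vec v \<longleftrightarrow> (\<forall>i. v $ i \<ge> 0)"

definition vle :: "real^'n \<Rightarrow> real^'n \<Rightarrow> bool" where
  "vle v w \<longleftrightarrow> (\<forall>i. v $ i \<le> w $ i)"

definition vlt :: "real^'n \<Rightarrow> real^'n \<Rightarrow> bool" where
  "vlt v w \<longleftrightarrow> vle v w \<and> v \<noteq> w"

definition Phi3 :: "(real^'n \<Rightarrow> real) \<Rightarrow> bool" where
  "Phi3 \<Phi> \<longleftrightarrow> (\<forall>v w. nonneg_vec v \<and> nonneg_vec w \<and> vle v w \<longrightarrow> \<Phi> v \<le> \<Phi> w)"

definition Phi3plus :: "(real^'n \<Rightarrow> real) \<Rightarrow> bool" where
  "Phi3plus \<Phi> \<longleftrightarrow> (\<forall>v w. nonneg_vec v \<and> nonneg_vec w \<and> vlt v w \<longrightarrow> \<Phi> v < \<Phi> w)"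

end

theory Submission
  imports Defs
begin

text \<open>The functional statement reduces to the geometric one by slicing: the coarea formula
  \<open>TV u = \<integral> P({u > t}) dt\<close> and the layer cake formula \<open>1 = \<integral> |{u > t}| dt\<close> force some superlevel set of each
  component to have perimeter quotient at most \<open>TV (u i)\<close>, and monotonicity of \<open>\<Phi>\<close> then compares clusters
  with functions. If \<open>u\<close> is minimal and \<open>\<Phi>\<close> is strictly monotone, no superlevel set can have a smaller
  quotient, so almost all of them have quotient exactly \<open>TV (u i)\<close>.

  For the coarea inequality \<open>\<integral> P({u > t}) dt \<le> TV u\<close> the function \<open>m t = TV (min u t)\<close> is used. The inequality
  \<open>TV (min u t) + TV ((u - t)\<^sup>+) \<le> TV u\<close>, proved for C1 functions by an explicit competing field and in general
  by mollification, gives \<open>P({u > t}) \<le> liminf k (m (t + 1/k) - m t)\<close> by lower semicontinuity, and Fatou's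
  lemma bounds the integral of the right-hand side by \<open>sup m\<close>.\<close>

section \<open>Continuously differentiable fields and the divergence theorem\<close>

text \<open>Only C1 fields compete in the total variation, so the field that separates two
  truncations of \<open>u\<close> has to switch at the level \<open>t\<close> in a C1 way, and the
  truncation inequality is accessible at first only for C1 functions. That inequality sees
  \<open>u\<close> only through an upper bound for its total variation and is stable under L1
  convergence, so a mollifier of class C1 is smooth enough. The level perimeter is never shown to be
  measurable in the level. Both halves of the coarea formula are therefore phrased with measurable
  functions below and above it, and statements about single levels are extracted from the integrals
  of these bounds. Slicing treats each component alone, while minimality concerns the whole tuple.
  Two devices bridge the gap. A level with a strict gain in one component is completed by good
  levels of the others, so that strict monotonicity applies. In the space of level tuples,
  exceptional levels of one component lift to null cylinders, and sets of good levels of positive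
  measure multiply to a box of positive measure.\<close>

definition C1_map :: "('a::euclidean_space \<Rightarrow> 'b::real_normed_vector) \<Rightarrow> bool" where
  "C1_map f \<longleftrightarrow> (\<exists>f'. (\<forall>x. (f has_derivative f' x) (at x)) \<and> (\<forall>b\<in>Basis. continuous_on UNIV (\<lambda>x. f' x b)))"

text \<open>Compact support in terms of a radius: the dominating functions below are multiples of
  indicators of balls.\<close>

definition bounded_support :: "('a::real_normed_vector \<Rightarrow> 'b::zero) \<Rightarrow> bool" where
  "bounded_support f \<longleftrightarrow> (\<exists>R. \<forall>x. norm x > R \<longrightarrow> f x = 0)"

lemma C1_mapI:
  assumes "\<And>x. (f has_derivative f' x) (at x)" "\<And>b. b \<in> Basis \<Longrightarrow> continuous_on UNIV (\<lambda>x. f' x b)"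
  shows "C1_map f"
  using assms unfolding C1_map_def by blast

text \<open>Uniqueness of derivatives identifies the existential witness in \<open>C1_map\<close>
  with \<open>frechet_derivative\<close>, which is the form that \<open>divergence\<close>
  uses.\<close>

lemma C1_map_has_derivative:
  assumes "C1_map f"
  shows "(f has_derivative frechet_derivative f (at x)) (at x)"
  using assms unfolding C1_map_def
  by (metis frechet_derivative_at)

lemma C1_map_continuous_partial:
  assumes "C1_map f" "b \<in> Basis"
  shows "continuous_on UNIV (\<lambda>x. frechet_derivative f (at x) b)"
proof -
  obtain f' where f': "\<And>x. (f has_derivative f' x) (at x)" "continuous_on UNIV (\<lambda>x. f' x b)"
    using assms unfolding C1_map_def by blast
  then have "frechet_derivative f (at x) = f' x" for x
    using frechet_derivative_at by metis
  with f' show ?thesis by simp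
qed

lemma C1_map_continuous:
  assumes "C1_map f"
  shows "continuous_on UNIV f"
  using C1_map_has_derivative[OF assms]
  by (meson has_derivative_continuous continuous_at_imp_continuous_on)

lemma test_fields_iff:
  "\<phi> \<in> test_fields \<longleftrightarrow> C1_map \<phi> \<and> bounded_support \<phi> \<and> (\<forall>x. norm (\<phi> x) \<le> 1)"
proof -
  have "(\<exists>K. compact K \<and> (\<forall>x. x \<notin> K \<longrightarrow> \<phi> x = 0)) \<longleftrightarrow> bounded_support \<phi>"
  proof
    assume "\<exists>K. compact K \<and> (\<forall>x. x \<notin> K \<longrightarrow> \<phi> x = 0)"
    then obtain K where K: "compact K" "\<And>x. x \<notin> K \<Longrightarrow> \<phi> x = 0" by blast
    obtain R where "\<And>x. x \<in> K \<Longrightarrow> norm x \<le> R"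
      using compact_imp_bounded[OF K(1)] by (auto simp: bounded_iff)
    then show "bounded_support \<phi>"
      unfolding bounded_support_def using K(2) by (metis not_le)
  next
    assume "bounded_support \<phi>"
    then obtain R where "\<And>x. norm x > R \<Longrightarrow> \<phi> x = 0" unfolding bounded_support_def by blast
    then show "\<exists>K. compact K \<and> (\<forall>x. x \<notin> K \<longrightarrow> \<phi> x = 0)"
      by (intro exI[of _ "cball 0 R"]) auto
  qed
  then show ?thesis unfolding test_fields_def C1_map_def by auto
qed

section \<open>Calculus of C1 maps and of the divergence\<close>

lemma C1_map_const [simp]: "C1_map (\<lambda>x. c)"
  by (rule C1_mapI[where f' = "\<lambda>x h. 0"]) auto

lemma zero_test_field [simp]: "(\<lambda>x. 0) \<in> test_fields"
  by (simp add: test_fields_iff bounded_support_def)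

lemma C1_map_add:
  assumes "C1_map f" "C1_map g"
  shows "C1_map (\<lambda>x. f x + g x)"
  by (rule C1_mapI[where f' = "\<lambda>x h. frechet_derivative f (at x) h + frechet_derivative g (at x) h"])
    (auto intro!: derivative_intros continuous_intros C1_map_has_derivative C1_map_continuous_partial assms)

lemma C1_map_diff:
  assumes "C1_map f" "C1_map g"
  shows "C1_map (\<lambda>x. f x - g x)"
  by (rule C1_mapI[where f' = "\<lambda>x h. frechet_derivative f (at x) h - frechet_derivative g (at x) h"])
    (auto intro!: derivative_intros continuous_intros C1_map_has_derivative C1_map_continuous_partial assms)

lemma has_derivative_C1_scaleR:
  fixes g :: "'a::euclidean_space \<Rightarrow> real"
  assumes "C1_map g" "C1_map f"
  shows "((\<lambda>x. g x *\<^sub>R f x) has_derivative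
    (\<lambda>h. g x *\<^sub>R frechet_derivative f (at x) h + frechet_derivative g (at x) h *\<^sub>R f x)) (at x)"
  by (intro has_derivative_scaleR C1_map_has_derivative assms)

lemma C1_map_scaleR:
  fixes g :: "'a::euclidean_space \<Rightarrow> real"
  assumes "C1_map g" "C1_map f"
  shows "C1_map (\<lambda>x. g x *\<^sub>R f x)"
  by (rule C1_mapI[OF has_derivative_C1_scaleR[OF assms]])
    (auto intro!: continuous_intros C1_map_continuous_partial C1_map_continuous[OF assms(1)]
      C1_map_continuous[OF assms(2)] assms)

lemma has_derivative_C1_compose:
  fixes u :: "'a::euclidean_space \<Rightarrow> real"
  assumes "C1_map u" "\<And>s. (G has_real_derivative G' s) (at s)"
  shows "((\<lambda>x. G (u x)) has_derivative (\<lambda>h. G' (u x) * frechet_derivative u (at x) h)) (at x)"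
  using has_derivative_compose[OF C1_map_has_derivative[OF assms(1)]
      assms(2)[of "u x", unfolded has_field_derivative_def]] .

lemma C1_map_compose:
  fixes u :: "'a::euclidean_space \<Rightarrow> real"
  assumes "C1_map u" "\<And>s. (G has_real_derivative G' s) (at s)" "continuous_on UNIV G'"
  shows "C1_map (\<lambda>x. G (u x))"
proof (rule C1_mapI[OF has_derivative_C1_compose[OF assms(1,2)]])
  fix b :: 'a assume "b \<in> Basis"
  then show "continuous_on UNIV (\<lambda>x. G' (u x) * frechet_derivative u (at x) b)"
    by (intro continuous_intros C1_map_continuous_partial assms(1)
        continuous_on_compose2[OF assms(3) C1_map_continuous[OF assms(1)]]) auto
qed

lemma divergence_diff:
  assumes "C1_map f" "C1_map g"
  shows "divergence (\<lambda>x. f x - g x) x = divergence f x - divergence g x"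
proof -
  have "frechet_derivative (\<lambda>x. f x - g x) (at x) = (\<lambda>h. frechet_derivative f (at x) h - frechet_derivative g (at x) h)"
    by (rule frechet_derivative_at[symmetric]) (intro derivative_intros C1_map_has_derivative assms)
  then show ?thesis by (simp add: divergence_def inner_diff_left sum_subtractf)
qed

text \<open>Expanding \<open>f x\<close> in the basis collects the partial derivatives of
  \<open>g\<close> into one directional derivative. In this form the gradient terms of several
  products cancel by linearity alone.\<close>

lemma divergence_scaleR:
  fixes g :: "'a::euclidean_space \<Rightarrow> real" and f :: "'a \<Rightarrow> 'a"
  assumes "C1_map g" "C1_map f"
  shows "divergence (\<lambda>x. g x *\<^sub>R f x) x = g x * divergence f x + frechet_derivative g (at x) (f x)"
proof -
  have lin: "linear (frechet_derivative g (at x))"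
    using C1_map_has_derivative[OF assms(1)] has_derivative_linear by blast
  have "frechet_derivative (\<lambda>x. g x *\<^sub>R f x) (at x)
      = (\<lambda>h. g x *\<^sub>R frechet_derivative f (at x) h + frechet_derivative g (at x) h *\<^sub>R f x)"
    by (rule frechet_derivative_at[OF has_derivative_C1_scaleR[OF assms], symmetric])
  then have "divergence (\<lambda>x. g x *\<^sub>R f x) x
      = g x * divergence f x + (\<Sum>b\<in>Basis. (f x \<bullet> b) * frechet_derivative g (at x) b)"
    by (simp add: divergence_def inner_add_left sum.distrib sum_distrib_left mult.commute)
  also have "(\<Sum>b\<in>Basis. (f x \<bullet> b) * frechet_derivative g (at x) b)
      = frechet_derivative g (at x) (\<Sum>b\<in>Basis. (f x \<bullet> b) *\<^sub>R b)"
    by (simp add: linear_sum[OF lin] linear_scale[OF lin])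
  finally show ?thesis by (simp add: euclidean_representation)
qed

lemma continuous_on_divergence:
  fixes f :: "'a::euclidean_space \<Rightarrow> 'a"
  assumes "C1_map f"
  shows "continuous_on UNIV (divergence f)"
  unfolding divergence_def
  by (intro continuous_intros C1_map_continuous_partial assms)

text \<open>The strict inequality describes an open set, so \<open>f\<close> agrees with 0 in a
  whole neighbourhood of \<open>x\<close>.\<close>

lemma frechet_derivative_eq_0_off_support:
  fixes f :: "'a::euclidean_space \<Rightarrow> 'b::real_normed_vector"
  assumes "\<And>x. norm x > R \<Longrightarrow> f x = 0" "norm x > R"
  shows "frechet_derivative f (at x) = (\<lambda>h. 0)"
proof (rule frechet_derivative_at[symmetric])
  have "open {x::'a. norm x > R}" by (intro open_Collect_less continuous_intros)
  then show "(f has_derivative (\<lambda>h. 0)) (at x)"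
    by (rule has_derivative_transform_within_open[OF has_derivative_const[of 0]]) (use assms in auto)
qed

lemma bounded_support_divergence:
  fixes f :: "'a::euclidean_space \<Rightarrow> 'a"
  assumes "bounded_support f"
  shows "bounded_support (divergence f)"
proof -
  obtain R where "\<And>x. norm x > R \<Longrightarrow> f x = 0" using assms unfolding bounded_support_def by blast
  then have "divergence f x = 0" if "norm x > R" for x
    using frechet_derivative_eq_0_off_support[of R f x] that by (simp add: divergence_def)
  then show ?thesis unfolding bounded_support_def by blast
qed

lemma bounded_support_mono:
  assumes "bounded_support f" "\<And>x. f x = 0 \<Longrightarrow> g x = 0"
  shows "bounded_support g"
  using assms unfolding bounded_support_def by metis

lemma continuous_bounded_supportE:
  fixes f :: "'a::euclidean_space \<Rightarrow> 'b::real_normed_vector"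
  assumes "continuous_on UNIV f" "bounded_support f"
  obtains R C where "R > 0" "C > 0" "\<And>x. norm (f x) \<le> C * indicator (cball 0 R) x"
proof -
  obtain R' where R': "\<And>x. norm x > R' \<Longrightarrow> f x = 0" using assms unfolding bounded_support_def by blast
  define R where "R = max R' 1"
  have R: "R > 0" "\<And>x. norm x > R \<Longrightarrow> f x = 0" using R' by (auto simp: R_def)
  have "compact (f ` cball 0 R)"
    using assms(1) by (intro compact_continuous_image) (auto intro: continuous_on_subset)
  then obtain C where "C > 0" "\<And>y. y \<in> f ` cball 0 R \<Longrightarrow> norm y \<le> C"
    using bounded_pos compact_imp_bounded by metis
  then show ?thesis using R by (intro that[of R C]) (auto simp: indicator_def not_le)
qed

section \<open>Integrability of functions with bounded support\<close>

lemma integrable_indicator_cball: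
  "integrable lborel (\<lambda>x. C * indicator (cball (0::'a::euclidean_space) R) x :: real)"
  by (intro integrable_mult_right integrable_real_indicator emeasure_bounded_finite) auto

lemma integrable_continuous_bounded_support:
  fixes f :: "'a::euclidean_space \<Rightarrow> real"
  assumes "continuous_on UNIV f" "bounded_support f"
  shows "integrable lborel f"
proof -
  obtain R C where "R > 0" "C > 0" and b: "\<And>x. norm (f x) \<le> C * indicator (cball 0 R) x"
    using continuous_bounded_supportE[OF assms] by metis
  show ?thesis
    by (rule Bochner_Integration.integrable_bound[OF integrable_indicator_cball[of C R]])
      (use b assms(1) borel_measurable_continuous_onI in \<open>auto intro: order_trans[OF _ abs_ge_self]\<close>)
qed

lemma integrable_mult_continuous_bounded_support:
  fixes u :: "'a::euclidean_space \<Rightarrow> real"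
  assumes u: "integrable lborel u" and d: "continuous_on UNIV d" "bounded_support d"
  shows "integrable lborel (\<lambda>x. u x * d x)"
proof -
  obtain R C where "C > 0" and b: "\<And>x. norm (d x) \<le> C * indicator (cball 0 R) x"
    using continuous_bounded_supportE[OF d] by metis
  have b': "\<bar>d x\<bar> \<le> C" for x
    using b[of x] \<open>C > 0\<close> by (cases "norm x \<le> R") auto
  have [measurable]: "u \<in> borel_measurable borel" "d \<in> borel_measurable borel"
    using u d borel_measurable_continuous_onI by auto
  show ?thesis
    by (rule Bochner_Integration.integrable_bound[OF integrable_mult_right[OF u, of C]])
      (auto simp: abs_mult mult.commute intro!: mult_right_mono order_trans[OF b' abs_ge_self])
qed

section \<open>Translation invariance and the divergence theorem\<close>

lemma lborel_integral_translate:
  fixes f :: "'a::euclidean_space \<Rightarrow> real"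
  assumes [measurable]: "f \<in> borel_measurable borel"
  shows "(LINT x|lborel. f (c + x)) = (LINT x|lborel. f x)"
    and "integrable lborel f \<Longrightarrow> integrable lborel (\<lambda>x. f (c + x))"
proof -
  have "(LINT x|distr lborel borel ((+) c). f x) = (LINT x|lborel. f (c + x))"
    by (subst integral_distr) auto
  then show "(LINT x|lborel. f (c + x)) = (LINT x|lborel. f x)"
    by (simp add: lborel_distr_plus)
  assume "integrable lborel f"
  then have "integrable (distr lborel borel ((+) c)) f" by (simp add: lborel_distr_plus)
  then show "integrable lborel (\<lambda>x. f (c + x))"
    by (subst (asm) integrable_distr_eq) auto
qed

text \<open>Translation invariance makes the integral of every difference quotient vanish, and dominated
  convergence passes to the limit; this replaces Fubini and the fundamental theorem of calculus.\<close>
lemma integral_partial_eq_0: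
  fixes f :: "'a::euclidean_space \<Rightarrow> real"
  assumes f: "C1_map f" "bounded_support f" and b: "b \<in> Basis"
  shows "integrable lborel (\<lambda>x. frechet_derivative f (at x) b)"
    and "(LINT x|lborel. frechet_derivative f (at x) b) = 0"
proof -
  define D where "D = (\<lambda>x. frechet_derivative f (at x) b)"
  have contD: "continuous_on UNIV D" unfolding D_def by (rule C1_map_continuous_partial[OF f(1) b])
  obtain R where R: "\<And>x. norm x > R \<Longrightarrow> f x = 0" using f(2) unfolding bounded_support_def by blast
  then have D0: "\<And>x. norm x > R \<Longrightarrow> D x = 0"
    using frechet_derivative_eq_0_off_support[of R f] by (simp add: D_def)
  then have bsD: "bounded_support D" unfolding bounded_support_def by blast
  show int: "integrable lborel (\<lambda>x. frechet_derivative f (at x) b)"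
    using integrable_continuous_bounded_support[OF contD bsD] by (simp add: D_def)
  have intf: "integrable lborel f"
    by (rule integrable_continuous_bounded_support[OF C1_map_continuous[OF f(1)] f(2)])
  have mf[measurable]: "f \<in> borel_measurable borel" and [measurable]: "D \<in> borel_measurable borel"
    using C1_map_continuous[OF f(1)] contD by (auto intro: borel_measurable_continuous_onI)
  obtain R' C where C: "C > 0" "\<And>x. norm (D x) \<le> C * indicator (cball 0 R') x"
    using continuous_bounded_supportE[OF contD bsD] by metis
  then have DC: "\<bar>D x\<bar> \<le> C" for x
    using C(2)[of x] C(1) by (cases "norm x \<le> R'") auto
  define s where "s = (\<lambda>n x. (f (inverse (Suc n) *\<^sub>R b + x) - f x) * real (Suc n))"
  have nb: "norm b = 1" using b by simp
  have line: "((\<lambda>t. f (t *\<^sub>R b + x)) has_real_derivative D (t *\<^sub>R b + x)) (at t)" for t x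
  proof -
    have "((\<lambda>t. f (t *\<^sub>R b + x)) has_derivative (\<lambda>h. frechet_derivative f (at (t *\<^sub>R b + x)) (h *\<^sub>R b))) (at t)"
      by (rule has_derivative_compose[OF _ C1_map_has_derivative[OF f(1)]]) (auto intro!: derivative_eq_intros)
    moreover have "frechet_derivative f (at (t *\<^sub>R b + x)) (h *\<^sub>R b) = D (t *\<^sub>R b + x) * h" for h
      using has_derivative_linear[OF C1_map_has_derivative[OF f(1)], of "t *\<^sub>R b + x"]
      by (simp add: linear_scale D_def)
    ultimately show ?thesis by (simp add: has_field_derivative_def)
  qed
  have lim: "(\<lambda>n. s n x) \<longlonglongrightarrow> D x" for x
  proof -
    have "((\<lambda>h. (f (h *\<^sub>R b + x) - f x) / h) \<longlongrightarrow> D x) (at 0)"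
      using line[of x 0] by (simp add: has_field_derivative_iff)
    moreover have "filterlim (\<lambda>n. inverse (real (Suc n))) (at 0) sequentially"
      unfolding filterlim_at using LIMSEQ_inverse_real_of_nat by (auto intro!: always_eventually)
    ultimately have "(\<lambda>n. (f (inverse (real (Suc n)) *\<^sub>R b + x) - f x) / inverse (real (Suc n))) \<longlonglongrightarrow> D x"
      by (rule filterlim_compose)
    then show ?thesis by (simp add: s_def divide_inverse)
  qed
  \<comment> \<open>Inside the larger ball the mean value theorem turns the quotient into a value of
    \<open>D\<close>. Outside it both evaluation points lie off the support, because the increment
    has length at most 1.\<close>
  have bound: "norm (s n x) \<le> C * indicator (cball 0 (R + 1)) x" for n x
  proof (cases "norm x \<le> R + 1")
    case True
    have "\<exists>z::real. z > 0 \<and> z < inverse (Suc n) \<and> f (inverse (Suc n) *\<^sub>R b + x) - f (0 *\<^sub>R b + x) = (inverse (Suc n) - 0) * D (z *\<^sub>R b + x)"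
      by (rule MVT2) (use line in auto)
    then obtain z where "f (inverse (Suc n) *\<^sub>R b + x) - f x = inverse (Suc n) * D (z *\<^sub>R b + x)"
      by auto
    then have "s n x = D (z *\<^sub>R b + x)" by (simp add: s_def)
    then show ?thesis using DC True by simp
  next
    case False
    have "norm x - norm (inverse (real (Suc n)) *\<^sub>R b) \<le> norm (inverse (real (Suc n)) *\<^sub>R b + x)"
      by (metis add.commute norm_diff_ineq)
    moreover have "norm (inverse (real (Suc n)) *\<^sub>R b) \<le> 1" using nb by (simp add: field_simps)
    ultimately have "norm (inverse (real (Suc n)) *\<^sub>R b + x) > R" using False by linarith
    then show ?thesis using False R[of x] R by (simp add: s_def)
  qed
  have "(\<lambda>n. LINT x|lborel. s n x) \<longlonglongrightarrow> (LINT x|lborel. D x)"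
  proof (rule integral_dominated_convergence[where w="\<lambda>x. C * indicator (cball 0 (R + 1)) x"])
    show "s n \<in> borel_measurable lborel" for n unfolding s_def by measurable
    show "integrable lborel (\<lambda>x. C * indicator (cball 0 (R + 1)) x :: real)"
      by (rule integrable_indicator_cball)
  qed (use lim bound in \<open>auto simp del: norm_conv_dist\<close>)
  moreover have "(LINT x|lborel. s n x) = 0" for n
  proof -
    have "(LINT x|lborel. s n x) = ((LINT x|lborel. f (inverse (Suc n) *\<^sub>R b + x)) - (LINT x|lborel. f x)) * Suc n"
      unfolding s_def using intf lborel_integral_translate(2)[OF mf intf] by simp
    then show ?thesis by (simp add: lborel_integral_translate(1))
  qed
  ultimately have "(LINT x|lborel. D x) = 0"
    by (simp add: LIMSEQ_const_iff)
  then show "(LINT x|lborel. frechet_derivative f (at x) b) = 0" by (simp add: D_def)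
qed

lemma integral_divergence_eq_0:
  fixes f :: "'a::euclidean_space \<Rightarrow> 'a"
  assumes f: "C1_map f" "bounded_support f"
  shows "(LINT x|lborel. divergence f x) = 0"
proof -
  have der: "((\<lambda>x. f x \<bullet> b) has_derivative (\<lambda>h. frechet_derivative f (at x) h \<bullet> b)) (at x)" for b x
    by (intro has_derivative_inner_left C1_map_has_derivative f)
  have C1: "C1_map (\<lambda>x. f x \<bullet> b)" for b
    by (rule C1_mapI[OF der]) (intro continuous_intros C1_map_continuous_partial f)
  have bs: "bounded_support (\<lambda>x. f x \<bullet> b)" for b
    by (rule bounded_support_mono[OF f(2)]) auto
  have eq: "frechet_derivative f (at x) h \<bullet> b = frechet_derivative (\<lambda>x. f x \<bullet> b) (at x) h" for x h b
    using frechet_derivative_at[OF der[of b x]] by (rule fun_cong)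
  show ?thesis
    unfolding divergence_def eq
    by (subst Bochner_Integration.integral_sum) (auto simp: integral_partial_eq_0[OF C1 bs])
qed

section \<open>Total variation and truncation of C1 functions\<close>

lemma test_fieldD:
  assumes "\<phi> \<in> test_fields"
  shows "C1_map \<phi>" "bounded_support \<phi>" "norm (\<phi> x) \<le> 1"
    "continuous_on UNIV (divergence \<phi>)" "bounded_support (divergence \<phi>)"
    "divergence \<phi> \<in> borel_measurable borel" "integrable lborel (divergence \<phi>)"
  using assms continuous_on_divergence bounded_support_divergence borel_measurable_continuous_onI
    integrable_continuous_bounded_support[OF continuous_on_divergence bounded_support_divergence]
  by (auto simp: test_fields_iff)

lemma test_field_divergence_bound:
  assumes "\<phi> \<in> test_fields"
  obtains C where "C > 0" "\<And>x. \<bar>divergence \<phi> x\<bar> \<le> C"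
proof -
  obtain R C where C: "C > 0" "\<And>x. norm (divergence \<phi> x) \<le> C * indicator (cball 0 R) x"
    using continuous_bounded_supportE[OF test_fieldD(4,5)[OF assms]] by metis
  have "\<bar>divergence \<phi> x\<bar> \<le> C" for x
    using C(2)[of x] C(1) by (cases "norm x \<le> R") auto
  with C(1) show ?thesis by (rule that)
qed

lemma integrable_mult_divergence:
  fixes u :: "'a::euclidean_space \<Rightarrow> real"
  assumes "integrable lborel u" "\<phi> \<in> test_fields"
  shows "integrable lborel (\<lambda>x. u x * divergence \<phi> x)"
  by (rule integrable_mult_continuous_bounded_support[OF assms(1) test_fieldD(4,5)[OF assms(2)]])

lemma integrable_continuous_mult_divergence:
  fixes H :: "'a::euclidean_space \<Rightarrow> real"
  assumes "continuous_on UNIV H" "\<phi> \<in> test_fields"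
  shows "integrable lborel (\<lambda>x. H x * divergence \<phi> x)"
proof (rule integrable_continuous_bounded_support)
  show "continuous_on UNIV (\<lambda>x. H x * divergence \<phi> x)"
    by (rule continuous_on_mult[OF assms(1) test_fieldD(4)[OF assms(2)]])
  show "bounded_support (\<lambda>x. H x * divergence \<phi> x)"
    by (rule bounded_support_mono[OF test_fieldD(5)[OF assms(2)]]) simp
qed

text \<open>The definitions integrate over \<open>lebesgue\<close>, whereas translations and Fubini
  are applied over \<open>lborel\<close>. With this lemma a function can be exchanged for a Borel
  representative.\<close>

lemma total_variation_cong_AE:
  assumes "u \<in> borel_measurable lebesgue" "v \<in> borel_measurable lebesgue" "AE x in lebesgue. u x = v x"
  shows "total_variation u = total_variation v"
  unfolding total_variation_def
proof (rule SUP_cong[OF refl])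
  fix \<phi> :: "'a \<Rightarrow> 'a" assume "\<phi> \<in> test_fields"
  then have [measurable]: "divergence \<phi> \<in> borel_measurable lebesgue"
    using measurable_completion[of "divergence \<phi>" lborel borel] test_fieldD(6)[of \<phi>] by simp
  note [measurable] = assms(1,2)
  show "ereal (LINT x|lebesgue. u x * divergence \<phi> x) = ereal (LINT x|lebesgue. v x * divergence \<phi> x)"
    unfolding ereal.inject by (rule integral_cong_AE) (use assms(3) in auto)
qed

lemma total_variation_borel:
  assumes [measurable]: "u \<in> borel_measurable borel"
  shows "total_variation u = (SUP \<phi>\<in>test_fields. ereal (LINT x|lborel. u x * divergence \<phi> x))"
  unfolding total_variation_def
proof (rule SUP_cong[OF refl])
  fix \<phi> :: "'a \<Rightarrow> 'a" assume "\<phi> \<in> test_fields"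
  then have [measurable]: "divergence \<phi> \<in> borel_measurable borel" by (rule test_fieldD)
  show "ereal (LINT x|lebesgue. u x * divergence \<phi> x) = ereal (LINT x|lborel. u x * divergence \<phi> x)"
    by (simp add: integral_completion)
qed

lemma total_variation_nonneg: "0 \<le> total_variation u"
  unfolding total_variation_def
  by (rule SUP_upper2[OF zero_test_field]) (simp add: divergence_def frechet_derivative_const)

lemma total_variation_le_iff:
  assumes "u \<in> borel_measurable borel"
  shows "total_variation u \<le> ereal c \<longleftrightarrow> (\<forall>\<phi>\<in>test_fields. (LINT x|lborel. u x * divergence \<phi> x) \<le> c)"
  by (simp add: total_variation_borel[OF assms] SUP_le_iff)

lemma total_variation_upper:
  assumes "u \<in> borel_measurable borel" "\<phi> \<in> test_fields"
  shows "ereal (LINT x|lborel. u x * divergence \<phi> x) \<le> total_variation u"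
  unfolding total_variation_borel[OF assms(1)] by (rule SUP_upper[OF assms(2)])

lemma total_variation_scale_le:
  assumes "c > 0"
  shows "total_variation (\<lambda>x. c * u x) \<le> ereal c * total_variation u"
  unfolding total_variation_def[of "\<lambda>x. c * u x"]
proof (rule SUP_least)
  fix \<phi> :: "'a \<Rightarrow> 'a" assume "\<phi> \<in> test_fields"
  then have "ereal (LINT x|lebesgue. u x * divergence \<phi> x) \<le> total_variation u"
    unfolding total_variation_def by (rule SUP_upper)
  then have "ereal c * ereal (LINT x|lebesgue. u x * divergence \<phi> x) \<le> ereal c * total_variation u"
    by (rule ereal_mult_left_mono) (use assms in auto)
  then show "ereal (LINT x|lebesgue. c * u x * divergence \<phi> x) \<le> ereal c * total_variation u"
    by (simp add: mult.assoc)
qed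

lemma total_variation_scale:
  assumes "c > 0"
  shows "total_variation (\<lambda>x. c * u x) = ereal c * total_variation u"
proof (rule antisym[OF total_variation_scale_le[OF assms]])
  \<comment> \<open>The reverse inequality is the same estimate for the scaling by
    \<open>inverse c\<close>, which undoes the first one.\<close>
  have "total_variation (\<lambda>x. inverse c * (c * u x)) \<le> ereal (inverse c) * total_variation (\<lambda>x. c * u x)"
    by (rule total_variation_scale_le) (use assms in auto)
  then have "ereal c * total_variation u \<le> ereal c * (ereal (inverse c) * total_variation (\<lambda>x. c * u x))"
    using assms by (intro ereal_mult_left_mono) (auto simp: mult.assoc[symmetric])
  then show "ereal c * total_variation u \<le> total_variation (\<lambda>x. c * u x)"
    using assms by (simp add: mult.assoc[symmetric])
qed

text \<open>The vanishing slope of \<open>g\<close> at 0 flattens the kink of the positive part: at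
  \<open>s = t\<close> the difference quotient is either 0 or a quotient of \<open>g\<close> itself,
  which tends to 0.\<close>

lemma has_real_derivative_max_0:
  fixes g :: "real \<Rightarrow> real"
  assumes g: "\<And>s. (g has_real_derivative g' s) (at s)" "g 0 = 0" "g' 0 = 0"
  shows "((\<lambda>s. g (max 0 (s - t))) has_real_derivative g' (max 0 (s - t))) (at s)"
proof -
  consider "s < t" | "s > t" | "s = t" by linarith
  then show ?thesis
  proof cases
    case 1
    have "((\<lambda>s. 0::real) has_real_derivative g' (max 0 (s - t))) (at s)"
      using 1 g(3) by (simp add: max_def)
    then show ?thesis
      by (rule has_field_derivative_transform_within_open[where S="{..<t}"]) (use 1 g(2) in \<open>auto simp: max_def\<close>)
  next
    case 2
    have "((\<lambda>s. g (s - t)) has_real_derivative g' (max 0 (s - t)) * 1) (at s)"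
      by (rule DERIV_chain2[where g="\<lambda>s. s - t"])
        (use 2 g(1)[of "s - t"] in \<open>auto intro!: derivative_eq_intros simp: max_def\<close>)
    then have "((\<lambda>s. g (s - t)) has_real_derivative g' (max 0 (s - t))) (at s)" by simp
    then show ?thesis
      by (rule has_field_derivative_transform_within_open[where S="{t<..}"]) (use 2 in \<open>auto simp: max_def\<close>)
  next
    case 3
    have "((\<lambda>h. (g (0 + h) - g 0) / h) \<longlongrightarrow> g' 0) (at 0)"
      using g(1)[of 0] unfolding DERIV_def .
    then have "((\<lambda>h. g h / h) \<longlongrightarrow> 0) (at 0)" using g by simp
    then have "((\<lambda>h. g (max 0 h) / h) \<longlongrightarrow> 0) (at 0)"
      by (rule tendsto_0_le[where K=1]) (intro always_eventually allI, simp add: max_def g divide_le_0_iff)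
    then show ?thesis using 3 by (simp add: DERIV_def g)
  qed
qed

text \<open>A convex combination of two competing fields, switching from \<open>\<phi>\<close> to \<open>\<psi>\<close> as \<open>u\<close> crosses the
  level \<open>t\<close>, is again a test field; testing \<open>u\<close> against it separates the two truncations of \<open>u\<close>.
  The switch is \<open>\<kappa> r = 1 - 1 / (1 + (r/\<delta>)\<^sup>2)\<close> at \<open>r = (u - t)\<^sup>+\<close>, with primitive \<open>r - \<delta> arctan (r/\<delta>)\<close>.\<close>
lemma truncation_inequality_C1:
  fixes u :: "'a::euclidean_space \<Rightarrow> real"
  assumes u: "C1_map u" and TV: "total_variation u \<le> ereal T"
    and \<phi>: "\<phi> \<in> test_fields" and \<psi>: "\<psi> \<in> test_fields"
  shows "(LINT x|lborel. (u x - max 0 (u x - t)) * divergence \<phi> x)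
       + (LINT x|lborel. max 0 (u x - t) * divergence \<psi> x) \<le> T"
proof -
  note cont = C1_map_continuous[OF u]
  note C1 = test_fieldD(1)[OF \<phi>] test_fieldD(1)[OF \<psi>]
  note intp = integrable_continuous_mult_divergence[OF _ \<phi>] integrable_continuous_mult_divergence[OF _ \<psi>]
  have key: "(LINT x|lborel. (u x - max 0 (u x - t)) * divergence \<phi> x)
       + (LINT x|lborel. max 0 (u x - t) * divergence \<psi> x)
       \<le> T + 2 * \<delta> * ((LINT x|lborel. \<bar>divergence \<phi> x\<bar>) + (LINT x|lborel. \<bar>divergence \<psi> x\<bar>))"
    if \<delta>: "\<delta> > 0" for \<delta> :: real
  proof -
    define c where "c = (\<lambda>r::real. 1 - 1 / (1 + (r/\<delta>)^2))"
    define g where "g = (\<lambda>r::real. r - \<delta> * arctan (r/\<delta>))"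
    define c' where "c' = (\<lambda>r::real. (2 * (r/\<delta>) / \<delta>) / (1 + (r/\<delta>)^2)^2)"
    define \<kappa> where "\<kappa> = (\<lambda>s. c (max 0 (s - t)))"
    define G where "G = (\<lambda>s. g (max 0 (s - t)))"
    \<comment> \<open>\<open>F\<close> and \<open>G\<close> are primitives of
      \<open>1 - \<kappa>\<close> and \<open>\<kappa>\<close> that add up to the identity. For small
      \<open>\<delta>\<close> they approximate min s t and the positive part of s - t.\<close>
    define F where "F = (\<lambda>s. s - G s)"
    have pos: "1 + (r/\<delta>)^2 > 0" for r :: real by (rule add_pos_nonneg) auto
    have c01: "0 \<le> c r" "c r \<le> 1" for r using pos[of r] by (auto simp: c_def divide_simps)
    have dc: "(c has_real_derivative c' s) (at s)" for s
      unfolding c_def c'_def using pos[of s] \<delta>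
      by (auto intro!: derivative_eq_intros simp: power2_eq_square)
    have dg: "(g has_real_derivative c s) (at s)" for s
      unfolding g_def c_def using \<delta> by (auto intro!: derivative_eq_intros simp: inverse_eq_divide)
    have d\<kappa>: "(\<kappa> has_real_derivative c' (max 0 (s - t))) (at s)" for s
      unfolding \<kappa>_def by (rule has_real_derivative_max_0[OF dc]) (auto simp: c_def c'_def)
    have dG: "(G has_real_derivative \<kappa> s) (at s)" for s
      unfolding G_def \<kappa>_def by (rule has_real_derivative_max_0[OF dg]) (auto simp: c_def g_def)
    have dF: "(F has_real_derivative 1 - \<kappa> s) (at s)" for s
      unfolding F_def by (auto intro!: derivative_eq_intros dG)
    have c\<kappa>: "continuous_on UNIV \<kappa>"
      using d\<kappa> by (meson DERIV_isCont continuous_at_imp_continuous_on)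
    have cc': "continuous_on UNIV (\<lambda>s. c' (max 0 (s - t)))"
      unfolding c'_def using pos \<delta> by (intro continuous_intros) (auto simp: power_eq_0_iff less_imp_neq[OF pos, symmetric])
    have C1\<kappa>: "C1_map (\<lambda>x. \<kappa> (u x))" by (rule C1_map_compose[OF u d\<kappa> cc'])
    have C1G: "C1_map (\<lambda>x. G (u x))" by (rule C1_map_compose[OF u dG c\<kappa>])
    have C1F: "C1_map (\<lambda>x. F (u x))" by (rule C1_map_compose[OF u dF]) (intro continuous_intros c\<kappa>)
    define \<theta> where "\<theta> = (\<lambda>x. \<phi> x + \<kappa> (u x) *\<^sub>R (\<psi> x - \<phi> x))"
    have C1\<theta>: "C1_map \<theta>" unfolding \<theta>_def by (intro C1_map_add C1_map_scaleR C1_map_diff C1\<kappa> C1)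
    \<comment> \<open>This auxiliary function vanishes exactly where both fields do, so every field
      built from them inherits a bounded support by \<open>bounded_support_mono\<close>.\<close>
    have bs: "bounded_support (\<lambda>x. if \<phi> x = 0 \<and> \<psi> x = 0 then 0 else (1::real))"
    proof -
      obtain R1 R2 where "\<And>x. norm x > R1 \<Longrightarrow> \<phi> x = 0" "\<And>x. norm x > R2 \<Longrightarrow> \<psi> x = 0"
        using \<phi> \<psi> unfolding test_fields_iff bounded_support_def by metis
      then show ?thesis unfolding bounded_support_def by (intro exI[of _ "max R1 R2"]) auto
    qed
    have bs\<theta>: "bounded_support \<theta>"
      by (rule bounded_support_mono[OF bs]) (auto simp: \<theta>_def split: if_splits)
    have "norm (\<theta> x) \<le> 1" for x
    proof -
      have "\<theta> x = (1 - \<kappa> (u x)) *\<^sub>R \<phi> x + \<kappa> (u x) *\<^sub>R \<psi> x"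
        by (simp add: \<theta>_def algebra_simps)
      then have "norm (\<theta> x) \<le> (1 - \<kappa> (u x)) * norm (\<phi> x) + \<kappa> (u x) * norm (\<psi> x)"
        using c01 norm_triangle_ineq[of "(1 - \<kappa> (u x)) *\<^sub>R \<phi> x" "\<kappa> (u x) *\<^sub>R \<psi> x"] by (simp add: \<kappa>_def)
      also have "\<dots> \<le> (1 - \<kappa> (u x)) * 1 + \<kappa> (u x) * 1"
        using c01 test_fieldD(3)[OF \<phi>] test_fieldD(3)[OF \<psi>]
        by (intro add_mono mult_left_mono) (auto simp: \<kappa>_def)
      finally show ?thesis by simp
    qed
    then have \<theta>: "\<theta> \<in> test_fields" using C1\<theta> bs\<theta> by (simp add: test_fields_iff)
    \<comment> \<open>Chosen so that the derivatives of \<open>u\<close> cancel in the divergence.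
      Its vanishing integral then says that \<open>u\<close> tested with \<open>\<theta>\<close>
      equals \<open>F (u x)\<close> tested with \<open>\<phi>\<close> plus \<open>G (u x)\<close>
      tested with \<open>\<psi>\<close>.\<close>
    define \<Theta> where "\<Theta> = (\<lambda>x. u x *\<^sub>R \<theta> x - F (u x) *\<^sub>R \<phi> x - G (u x) *\<^sub>R \<psi> x)"
    have C1\<Theta>: "C1_map \<Theta>" unfolding \<Theta>_def by (intro C1_map_scaleR C1_map_diff C1F C1G C1\<theta> u C1)
    have bs\<Theta>: "bounded_support \<Theta>"
      by (rule bounded_support_mono[OF bs]) (auto simp: \<theta>_def \<Theta>_def split: if_splits)
    have "divergence \<Theta> x = u x * divergence \<theta> x - F (u x) * divergence \<phi> x - G (u x) * divergence \<psi> x" for x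
    proof -
      let ?D = "frechet_derivative u (at x)"
      have lin: "linear ?D" using C1_map_has_derivative[OF u] has_derivative_linear by blast
      have DF: "frechet_derivative (\<lambda>x. F (u x)) (at x) h = (1 - \<kappa> (u x)) * ?D h" for h
        by (simp add: frechet_derivative_at[OF has_derivative_C1_compose[OF u dF, of x], symmetric])
      have DG: "frechet_derivative (\<lambda>x. G (u x)) (at x) h = \<kappa> (u x) * ?D h" for h
        by (simp add: frechet_derivative_at[OF has_derivative_C1_compose[OF u dG, of x], symmetric])
      have "divergence \<Theta> x = (u x * divergence \<theta> x + ?D (\<theta> x))
          - (F (u x) * divergence \<phi> x + (1 - \<kappa> (u x)) * ?D (\<phi> x))
          - (G (u x) * divergence \<psi> x + \<kappa> (u x) * ?D (\<psi> x))"
        unfolding \<Theta>_def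
        by (simp add: divergence_diff divergence_scaleR C1_map_scaleR C1_map_diff C1F C1G C1\<theta> u C1 DF DG)
      moreover have "?D (\<theta> x) = ?D (\<phi> x) + \<kappa> (u x) * (?D (\<psi> x) - ?D (\<phi> x))"
        unfolding \<theta>_def by (simp add: linear_add[OF lin] linear_scale[OF lin] linear_diff[OF lin])
      ultimately show ?thesis by (simp add: algebra_simps)
    qed
    then have "(LINT x|lborel. u x * divergence \<theta> x - F (u x) * divergence \<phi> x - G (u x) * divergence \<psi> x) = 0"
      using integral_divergence_eq_0[OF C1\<Theta> bs\<Theta>] by simp
    moreover have int\<theta>: "integrable lborel (\<lambda>x. u x * divergence \<theta> x)"
      by (rule integrable_continuous_mult_divergence[OF cont \<theta>])
    moreover note intF = intp(1)[OF C1_map_continuous[OF C1F]] and intG = intp(2)[OF C1_map_continuous[OF C1G]]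
    ultimately have "(LINT x|lborel. F (u x) * divergence \<phi> x) + (LINT x|lborel. G (u x) * divergence \<psi> x)
        = (LINT x|lborel. u x * divergence \<theta> x)" by simp
    also have "\<dots> \<le> T"
      using TV \<theta> by (simp add: total_variation_le_iff borel_measurable_continuous_onI[OF cont])
    finally have 1: "(LINT x|lborel. F (u x) * divergence \<phi> x) + (LINT x|lborel. G (u x) * divergence \<psi> x) \<le> T" .
    \<comment> \<open>The difference is \<open>\<delta>\<close> times an arctangent, hence below
      \<open>\<delta>\<close> pi/2; the constant 2 is a round bound for pi/2.\<close>
    have Gm: "\<bar>G s - max 0 (s - t)\<bar> \<le> 2 * \<delta>" for s
    proof -
      have "\<bar>arctan (max 0 (s - t) / \<delta>)\<bar> \<le> 2"
        using arctan_bounded[of "max 0 (s - t) / \<delta>"] pi_less_4 by linarith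
      then have "\<delta> * \<bar>arctan (max 0 (s - t) / \<delta>)\<bar> \<le> \<delta> * 2"
        using \<delta> by (intro mult_left_mono) (assumption, simp)
      then show ?thesis using \<delta> by (simp add: G_def g_def abs_mult)
    qed
    have dabs: "integrable lborel (\<lambda>x. 2 * \<delta> * \<bar>divergence \<phi> x\<bar>)" "integrable lborel (\<lambda>x. 2 * \<delta> * \<bar>divergence \<psi> x\<bar>)"
      by (intro integrable_mult_right integrable_abs test_fieldD(7) \<phi> \<psi>)+
    have ci: "continuous_on UNIV (\<lambda>x. max 0 (u x - t))" "continuous_on UNIV (\<lambda>x. u x - max 0 (u x - t))"
      by (intro continuous_intros cont)+
    have "(LINT x|lborel. (u x - max 0 (u x - t)) * divergence \<phi> x)
        \<le> (LINT x|lborel. F (u x) * divergence \<phi> x + 2 * \<delta> * \<bar>divergence \<phi> x\<bar>)"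
    proof (rule integral_mono)
      fix x
      have "(u x - max 0 (u x - t) - F (u x)) * divergence \<phi> x \<le> \<bar>G (u x) - max 0 (u x - t)\<bar> * \<bar>divergence \<phi> x\<bar>"
        using abs_ge_self[of "(u x - max 0 (u x - t) - F (u x)) * divergence \<phi> x"] by (simp add: F_def abs_mult)
      also have "\<dots> \<le> 2 * \<delta> * \<bar>divergence \<phi> x\<bar>" by (rule mult_right_mono[OF Gm]) auto
      finally show "(u x - max 0 (u x - t)) * divergence \<phi> x \<le> F (u x) * divergence \<phi> x + 2 * \<delta> * \<bar>divergence \<phi> x\<bar>"
        by (simp add: algebra_simps)
    qed (intro Bochner_Integration.integrable_add intp(1)[OF ci(2)] intF dabs)+
    moreover have "(LINT x|lborel. max 0 (u x - t) * divergence \<psi> x)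
        \<le> (LINT x|lborel. G (u x) * divergence \<psi> x + 2 * \<delta> * \<bar>divergence \<psi> x\<bar>)"
    proof (rule integral_mono)
      fix x
      have "(max 0 (u x - t) - G (u x)) * divergence \<psi> x \<le> \<bar>G (u x) - max 0 (u x - t)\<bar> * \<bar>divergence \<psi> x\<bar>"
        using abs_ge_self[of "(max 0 (u x - t) - G (u x)) * divergence \<psi> x"] by (simp add: abs_mult abs_minus_commute)
      also have "\<dots> \<le> 2 * \<delta> * \<bar>divergence \<psi> x\<bar>" by (rule mult_right_mono[OF Gm]) auto
      finally show "max 0 (u x - t) * divergence \<psi> x \<le> G (u x) * divergence \<psi> x + 2 * \<delta> * \<bar>divergence \<psi> x\<bar>"
        by (simp add: algebra_simps)
    qed (intro Bochner_Integration.integrable_add intp(2)[OF ci(1)] intG dabs)+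
    ultimately show ?thesis
      using 1 unfolding Bochner_Integration.integral_add[OF intF dabs(1)]
        Bochner_Integration.integral_add[OF intG dabs(2)] integral_mult_right_zero distrib_left
      by linarith
  qed
  define K where "K = 2 * ((LINT x|lborel. \<bar>divergence \<phi> x\<bar>) + (LINT x|lborel. \<bar>divergence \<psi> x\<bar>))"
  have "K \<ge> 0" unfolding K_def by (simp add: integral_nonneg_AE)
  show ?thesis
  proof (rule field_le_epsilon)
    fix e :: real assume "e > 0"
    \<comment> \<open>This is the value of \<open>\<delta>\<close>; the added 1 keeps the
      denominator positive when \<open>K\<close> is 0.\<close>
    have "e / (K + 1) > 0" using \<open>e > 0\<close> \<open>K \<ge> 0\<close> by simp
    from key[OF this] have "(LINT x|lborel. (u x - max 0 (u x - t)) * divergence \<phi> x)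
       + (LINT x|lborel. max 0 (u x - t) * divergence \<psi> x) \<le> T + e * (K / (K + 1))"
      by (simp add: K_def mult.assoc mult.left_commute)
    also have "e * (K / (K + 1)) \<le> e * 1"
      using \<open>e > 0\<close> \<open>K \<ge> 0\<close> by (intro mult_left_mono) auto
    finally show "(LINT x|lborel. (u x - max 0 (u x - t)) * divergence \<phi> x)
       + (LINT x|lborel. max 0 (u x - t) * divergence \<psi> x) \<le> T + e" by simp
  qed
qed

section \<open>Continuity of translations and convolution\<close>

lemma clip_tendsto:
  fixes u :: "'a::euclidean_space \<Rightarrow> real"
  shows "(\<lambda>n. max (- real n) (min (real n) (u x)) * indicator (cball 0 (real n)) x) \<longlonglongrightarrow> u x"
proof (rule tendsto_eventually)
  obtain m :: nat where m: "max \<bar>u x\<bar> (norm x) \<le> real m" using real_arch_simple by blast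
  show "\<forall>\<^sub>F n in sequentially. max (- real n) (min (real n) (u x)) * indicator (cball 0 (real n)) x = u x"
    unfolding eventually_sequentially
  proof (intro exI[of _ m] allI impI)
    fix n assume "m \<le> n"
    then have "max \<bar>u x\<bar> (norm x) \<le> real n" using m by linarith
    then show "max (- real n) (min (real n) (u x)) * indicator (cball 0 (real n)) x = u x"
      by (auto simp: max_def min_def abs_if split: if_splits)
  qed
qed

lemma L1_dense_clipped:
  fixes u :: "'a::euclidean_space \<Rightarrow> real"
  assumes u: "integrable lborel u" and "e > 0"
  obtains n :: nat where
    "(LINT x|lborel. \<bar>u x - max (- real n) (min (real n) (u x)) * indicator (cball 0 (real n)) x\<bar>) < e"
proof -
  have [measurable]: "u \<in> borel_measurable borel" using borel_measurable_integrable[OF u] by simp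
  have [measurable]: "cball (0::'a) r \<in> sets borel" for r by simp
  let ?v = "\<lambda>n x. max (- real n) (min (real n) (u x)) * indicator (cball 0 (real n)) x"
  have "(\<lambda>n. LINT x|lborel. \<bar>u x - ?v n x\<bar>) \<longlonglongrightarrow> (LINT x|(lborel::'a measure). 0)"
  proof (rule integral_dominated_convergence[where w="\<lambda>x. \<bar>u x\<bar>"])
    show "AE x in lborel. (\<lambda>n. \<bar>u x - ?v n x\<bar>) \<longlonglongrightarrow> 0"
    proof (rule AE_I2)
      fix x
      have "(\<lambda>n. \<bar>u x - ?v n x\<bar>) \<longlonglongrightarrow> \<bar>u x - u x\<bar>"
        by (intro tendsto_intros clip_tendsto)
      then show "(\<lambda>n. \<bar>u x - ?v n x\<bar>) \<longlonglongrightarrow> 0" by simp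
    qed
    show "AE x in lborel. norm \<bar>u x - ?v n x\<bar> \<le> \<bar>u x\<bar>" for n
      by (auto simp: indicator_def max_def min_def abs_if split: if_splits)
  qed (use u in auto)
  then have "\<forall>\<^sub>F n in sequentially. (LINT x|lborel. \<bar>u x - ?v n x\<bar>) < e"
    using \<open>e > 0\<close> by (intro order_tendstoD(2)[where y=0]) simp
  then show ?thesis using that by (auto simp: eventually_sequentially)
qed

text \<open>A measurable function is an a.e. limit of continuous ones, but without an integrable
  majorant. Clipping \<open>u\<close> first to bounded values on a ball allows the approximants to
  be clipped and cut off in the same way, and dominated convergence applies.\<close>

lemma L1_dense_continuous:
  fixes u :: "'a::euclidean_space \<Rightarrow> real"
  assumes u: "integrable lborel u" and e: "e > 0"
  obtains g where "continuous_on UNIV g" "bounded_support g" "(LINT x|lborel. \<bar>u x - g x\<bar>) < e"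
proof -
  have mu[measurable]: "u \<in> borel_measurable borel" using borel_measurable_integrable[OF u] by simp
  obtain n where n: "(LINT x|lborel. \<bar>u x - max (- real n) (min (real n) (u x)) * indicator (cball 0 (real n)) x\<bar>) < e / 2"
    using L1_dense_clipped[OF u, of "e/2"] e by auto
  define v where "v = (\<lambda>x. max (- real n) (min (real n) (u x)) * indicator (cball 0 (real n)) x)"
  have [measurable]: "cball (0::'a) r \<in> sets borel" for r by simp
  have [measurable]: "v \<in> borel_measurable borel" unfolding v_def by measurable
  have "v \<in> borel_measurable lebesgue"
    using measurable_completion[of v lborel borel] by simp
  then have "v measurable_on UNIV" by (rule lebesgue_measurable_imp_measurable_on) simp
  then obtain N g where N: "negligible N" and g: "\<And>k. continuous_on UNIV (g k)"
    and lim: "\<And>x. x \<notin> N \<Longrightarrow> (\<lambda>k. g k x) \<longlonglongrightarrow> v x"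
    unfolding measurable_on_def by auto
  have AElim: "AE x in lborel. (\<lambda>k. g k x) \<longlonglongrightarrow> v x"
  proof -
    have "AE x in lebesgue. (\<lambda>k. g k x) \<longlonglongrightarrow> v x"
      by (rule AE_I'[of N]) (use N lim in \<open>auto simp: negligible_iff_null_sets\<close>)
    then show ?thesis by (simp add: AE_completion_iff)
  qed
  \<comment> \<open>A continuous cutoff, 1 on the ball that carries \<open>v\<close> and 0 beyond
    radius \<open>n + 1\<close>. Clipping followed by multiplication with \<open>c\<close> leaves
    \<open>v\<close> unchanged, so the modified approximants still converge to
    \<open>v\<close>.\<close>
  define c where "c = (\<lambda>x::'a. max 0 (min 1 (real n + 1 - norm x)))"
  define h where "h = (\<lambda>k x. max (- real n) (min (real n) (g k x)) * c x)"
  have conth: "continuous_on UNIV (h k)" for k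
    unfolding h_def c_def by (intro continuous_intros g)
  have bsh: "bounded_support (h k)" for k
    unfolding bounded_support_def h_def c_def by (intro exI[of _ "real n + 1"]) auto
  note [measurable] = borel_measurable_continuous_onI[OF conth]
  have "(\<lambda>k. LINT x|lborel. \<bar>v x - h k x\<bar>) \<longlonglongrightarrow> (LINT x|(lborel::'a measure). 0)"
  proof (rule integral_dominated_convergence[where w="\<lambda>x. (2 * real n) * indicator (cball (0::'a) (real n + 1)) x"])
    show "integrable lborel (\<lambda>x. 2 * real n * indicator (cball (0::'a) (real n + 1)) x)"
      by (rule integrable_indicator_cball)
    show "AE x in lborel. (\<lambda>k. \<bar>v x - h k x\<bar>) \<longlonglongrightarrow> 0"
      using AElim
    proof eventually_elim
      case (elim x)
      have "(\<lambda>k. \<bar>v x - h k x\<bar>) \<longlonglongrightarrow> \<bar>v x - max (- real n) (min (real n) (v x)) * c x\<bar>"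
        unfolding h_def by (intro tendsto_intros elim)
      moreover have "max (- real n) (min (real n) (v x)) * c x = v x"
        by (auto simp: v_def c_def indicator_def)
      ultimately show ?case by simp
    qed
    show "AE x in lborel. norm \<bar>v x - h k x\<bar> \<le> 2 * real n * indicator (cball 0 (real n + 1)) x" for k
    proof (rule AE_I2)
      fix x
      show "norm \<bar>v x - h k x\<bar> \<le> 2 * real n * indicator (cball 0 (real n + 1)) x"
      proof (cases "norm x \<le> real n + 1")
        case True
        have "0 \<le> c x" "c x \<le> 1" by (auto simp: c_def)
        moreover have "\<bar>max (- real n) (min (real n) (g k x))\<bar> \<le> real n" by auto
        ultimately have "\<bar>h k x\<bar> \<le> real n * 1" unfolding h_def abs_mult by (intro mult_mono) auto
        moreover have "\<bar>v x\<bar> \<le> real n" by (auto simp: v_def indicator_def)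
        ultimately show ?thesis using True by auto
      next
        case False
        then show ?thesis by (simp add: v_def h_def c_def)
      qed
    qed
  qed auto
  then have "\<forall>\<^sub>F k in sequentially. (LINT x|lborel. \<bar>v x - h k x\<bar>) < e / 2"
    using e by (intro order_tendstoD(2)[where y=0]) simp_all
  then obtain k where k: "(LINT x|lborel. \<bar>v x - h k x\<bar>) < e / 2"
    by (auto simp: eventually_sequentially)
  have intv: "integrable lborel v"
    by (rule Bochner_Integration.integrable_bound[OF u]) (auto simp: v_def indicator_def)
  have inth: "integrable lborel (h k)" by (rule integrable_continuous_bounded_support[OF conth bsh])
  have "(LINT x|lborel. \<bar>u x - h k x\<bar>) \<le> (LINT x|lborel. \<bar>u x - v x\<bar> + \<bar>v x - h k x\<bar>)"
    by (rule integral_mono) (use u intv inth in auto)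
  also have "\<dots> = (LINT x|lborel. \<bar>u x - v x\<bar>) + (LINT x|lborel. \<bar>v x - h k x\<bar>)"
    by (rule Bochner_Integration.integral_add) (use u intv inth in auto)
  also have "\<dots> < e" using n k by (simp add: v_def)
  finally show ?thesis using that conth bsh by blast
qed

text \<open>A three-epsilon argument: translation invariance makes the error of approximating
  \<open>u\<close> by \<open>g\<close> the same before and after the shift, and \<open>g\<close> is
  uniformly continuous on a compact set.\<close>

lemma L1_translation_continuous:
  fixes u :: "'a::euclidean_space \<Rightarrow> real"
  assumes u: "integrable lborel u" and e: "e > 0"
  obtains d where "d > 0" "\<And>z. norm z \<le> d \<Longrightarrow> (LINT x|lborel. \<bar>u (z + x) - u x\<bar>) \<le> e"
proof -
  have mu[measurable]: "u \<in> borel_measurable borel" using borel_measurable_integrable[OF u] by simp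
  obtain g where g: "continuous_on UNIV g" "bounded_support g" "(LINT x|lborel. \<bar>u x - g x\<bar>) < e / 3"
    using L1_dense_continuous[OF u, of "e/3"] e by auto
  have mg[measurable]: "g \<in> borel_measurable borel" by (rule borel_measurable_continuous_onI[OF g(1)])
  have ig: "integrable lborel g" by (rule integrable_continuous_bounded_support[OF g(1,2)])
  obtain R where R: "\<And>x. norm x > R \<Longrightarrow> g x = 0" using g(2) unfolding bounded_support_def by blast
  define V where "V = measure lborel (cball (0::'a) (R + 1))"
  have V: "V \<ge> 0" by (simp add: V_def)
  \<comment> \<open>For shifts of length at most 1 the difference of \<open>g\<close> and its
    translate lives on the ball of volume \<open>V\<close>, so a pointwise bound
    \<open>\<eta>\<close> integrates to at most \<open>e / 3\<close>.\<close>
  define \<eta> where "\<eta> = e / (3 * (V + 1))"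
  have \<eta>: "\<eta> > 0" using e V by (simp add: \<eta>_def)
  \<comment> \<open>The radius \<open>R + 2\<close> accommodates both \<open>x\<close> with norm at
    most \<open>R + 1\<close> and its translate by a vector of norm at most 1.\<close>
  have "uniformly_continuous_on (cball 0 (R + 2)) g"
    by (rule compact_uniformly_continuous) (use g(1) continuous_on_subset in auto)
  then obtain d' where d': "d' > 0" "\<And>x y. x \<in> cball 0 (R+2) \<Longrightarrow> y \<in> cball 0 (R+2) \<Longrightarrow> dist y x < d' \<Longrightarrow> dist (g y) (g x) < \<eta>"
    unfolding uniformly_continuous_on_def using \<eta> by metis
  define d where "d = min 1 (d'/2)"
  have "(LINT x|lborel. \<bar>u (z + x) - u x\<bar>) \<le> e" if z: "norm z \<le> d" for z
  proof -
    have gz: "\<bar>g (z + x) - g x\<bar> \<le> \<eta> * indicator (cball 0 (R + 1)) x" for x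
    proof (cases "norm x \<le> R + 1")
      case True
      have "norm (z + x) \<le> R + 2" using norm_triangle_ineq[of z x] z True by (auto simp: d_def)
      moreover have "dist (z + x) x < d'" using z d'(1) by (auto simp: d_def dist_norm)
      ultimately have "dist (g (z + x)) (g x) < \<eta>" using True by (intro d'(2)) auto
      then show ?thesis using True by (simp add: dist_real_def)
    next
      case False
      have "norm (z + x) > R" using norm_diff_ineq[of x z] z False by (auto simp: d_def add.commute)
      then show ?thesis using False R[of x] R[of "z + x"] by simp
    qed
    have tu: "integrable lborel (\<lambda>x. u (z + x))" and tg: "integrable lborel (\<lambda>x. g (z + x))"
      by (rule lborel_integral_translate(2)[OF mu u], rule lborel_integral_translate(2)[OF mg ig])
    have tr: "(LINT x|lborel. \<bar>u (z + x) - g (z + x)\<bar>) = (LINT x|lborel. \<bar>u x - g x\<bar>)"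
      by (rule lborel_integral_translate(1)[of "\<lambda>x. \<bar>u x - g x\<bar>"]) measurable
    have "(LINT x|lborel. \<bar>u (z + x) - u x\<bar>)
        \<le> (LINT x|lborel. (\<bar>u (z + x) - g (z + x)\<bar> + \<bar>u x - g x\<bar>) + \<eta> * indicator (cball 0 (R + 1)) x)"
    proof (rule integral_mono)
      show "\<bar>u (z + x) - u x\<bar> \<le> (\<bar>u (z + x) - g (z + x)\<bar> + \<bar>u x - g x\<bar>) + \<eta> * indicator (cball 0 (R + 1)) x" for x
        using gz[of x] by linarith
      show "integrable lborel (\<lambda>x. (\<bar>u (z + x) - g (z + x)\<bar> + \<bar>u x - g x\<bar>) + \<eta> * indicator (cball 0 (R + 1)) x)"
        by (intro Bochner_Integration.integrable_add integrable_abs Bochner_Integration.integrable_diff tu tg u ig integrable_indicator_cball)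
    qed (use tu u in auto)
    also have "\<dots> = (LINT x|lborel. \<bar>u (z + x) - g (z + x)\<bar>) + (LINT x|lborel. \<bar>u x - g x\<bar>) + (LINT x|lborel. \<eta> * indicator (cball 0 (R + 1)) (x::'a))"
      by (subst Bochner_Integration.integral_add;
          (intro Bochner_Integration.integrable_add integrable_abs Bochner_Integration.integrable_diff tu tg u ig integrable_indicator_cball)?)
        (simp add: tu tg u ig)
    also have "(LINT x|lborel. \<eta> * indicator (cball 0 (R + 1)) (x::'a)) = \<eta> * V" by (simp add: V_def)
    also have "\<eta> * V \<le> e / 3"
      using e V by (simp add: \<eta>_def field_simps)
    finally show ?thesis using g(3) tr by linarith
  qed
  moreover have "d > 0" using d'(1) by (simp add: d_def)
  ultimately show ?thesis using that by blast
qed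

text \<open>An unnormalized mollifying kernel supported in the ball of radius
  \<open>1 / sqrt a\<close>. Squaring the positive part gives a Lipschitz derivative and thus a
  quadratic Taylor remainder.\<close>

definition bump :: "real \<Rightarrow> 'a::euclidean_space \<Rightarrow> real" where
  "bump a w = (max 0 (1 - a * (w \<bullet> w)))\<^sup>2"

text \<open>The derivative of \<open>bump a\<close> at \<open>w\<close> in direction
  \<open>h\<close>, written out so that its continuity and support can be read off.\<close>

definition bump_deriv :: "real \<Rightarrow> 'a::euclidean_space \<Rightarrow> 'a \<Rightarrow> real" where
  "bump_deriv a w h = - 4 * a * max 0 (1 - a * (w \<bullet> w)) * (w \<bullet> h)"

lemma bump_nonneg: "bump a w \<ge> 0"
  by (simp add: bump_def)

lemma continuous_on_bump [continuous_intros]: "continuous_on S (bump a)"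
  unfolding bump_def by (intro continuous_intros)

text \<open>Stated for the factor common to \<open>bump\<close> and \<open>bump_deriv\<close>, so
  that it settles the support of both.\<close>

lemma bump_eq_0:
  assumes "a > 0" "norm w \<ge> 1 / sqrt a"
  shows "max 0 (1 - a * (w \<bullet> w)) = 0"
proof -
  have "(1 / sqrt a)\<^sup>2 \<le> (norm w)\<^sup>2" by (rule power_mono) (use assms in auto)
  then have "1 \<le> a * (w \<bullet> w)" using assms(1) by (simp add: power_divide dot_square_norm field_simps)
  then show ?thesis by simp
qed

lemma bounded_support_bump: "a > 0 \<Longrightarrow> bounded_support (bump a)"
  unfolding bounded_support_def bump_def by (intro exI[of _ "1 / sqrt a"]) (simp add: bump_eq_0)

lemma bounded_support_bump_deriv: "a > 0 \<Longrightarrow> bounded_support (\<lambda>w. bump_deriv a w h)"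
  unfolding bounded_support_def bump_deriv_def by (intro exI[of _ "1 / sqrt a"]) (simp add: bump_eq_0)

lemma continuous_on_bump_deriv: "continuous_on S (\<lambda>w. bump_deriv a w h)"
  unfolding bump_deriv_def by (intro continuous_intros)

text \<open>The squared positive part has derivative \<open>2 * max 0 r\<close>, which is Lipschitz
  with constant 2; its first order Taylor remainder is therefore at most the square of the
  increment.\<close>

lemma square_max_0_quadratic:
  fixes r k :: real
  shows "\<bar>(max 0 (r + k))\<^sup>2 - (max 0 r)\<^sup>2 - 2 * max 0 r * k\<bar> \<le> k\<^sup>2"
proof -
  consider "r \<ge> 0" "r + k \<ge> 0" | "r \<ge> 0" "r + k < 0" | "r < 0" "r + k \<ge> 0" | "r < 0" "r + k < 0" by linarith
  then show ?thesis
  proof cases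
    case 1
    have "(r + k)\<^sup>2 - r\<^sup>2 - 2 * r * k = k\<^sup>2" by (simp add: power2_eq_square algebra_simps)
    then show ?thesis using 1 by simp
  next
    case 2
    have "\<bar>- r\<^sup>2 - 2 * r * k\<bar> \<le> k\<^sup>2"
    proof (rule abs_leI)
      show "- r\<^sup>2 - 2 * r * k \<le> k\<^sup>2" using zero_le_power2[of "r + k"] by (simp add: power2_eq_square algebra_simps)
      have "r * (r + 2 * k) \<le> 0" using 2 by (intro mult_nonneg_nonpos) auto
      then have "- (- r\<^sup>2 - 2 * r * k) \<le> 0" by (simp add: power2_eq_square algebra_simps)
      then show "- (- r\<^sup>2 - 2 * r * k) \<le> k\<^sup>2" using zero_le_power2[of k] by linarith
    qed
    then show ?thesis using 2 by simp
  next
    case 3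
    have "\<bar>r + k\<bar> \<le> \<bar>k\<bar>" using 3 by auto
    then have "(r + k)\<^sup>2 \<le> k\<^sup>2" by (simp only: abs_le_square_iff)
    then show ?thesis using 3 by simp
  next
    case 4
    then show ?thesis by simp
  qed
qed

text \<open>The point is that \<open>C\<close> is independent of \<open>w\<close>: this uniformity
  permits differentiation under the integral against a merely integrable function.\<close>

lemma bump_quadratic:
  assumes a: "a > 0"
  obtains C where "C \<ge> 0"
    "\<And>w h::'a::euclidean_space. norm h \<le> 1 \<Longrightarrow> \<bar>bump a (w + h) - bump a w - bump_deriv a w h\<bar> \<le> C * (norm h)\<^sup>2"
proof -
  \<comment> \<open>Beyond this radius both \<open>w\<close> and \<open>w + h\<close> are off the
    support of the kernel when \<open>norm h\<close> is at most 1.\<close>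
  define R where "R = 1 / sqrt a + 1"
  have R: "R \<ge> 0" using a by (simp add: R_def)
  \<comment> \<open>The first summand bounds the square of the increment \<open>k\<close> of
    \<open>1 - a * (w \<bullet> w)\<close>. The second accounts for the quadratic part of
    \<open>k\<close>, which the linear map \<open>bump_deriv a w\<close> omits.\<close>
  define C where "C = (a * (2 * R + 1))\<^sup>2 + 2 * a"
  have "\<bar>bump a (w + h) - bump a w - bump_deriv a w h\<bar> \<le> C * (norm h)\<^sup>2" if h: "norm h \<le> 1" for w h :: 'a
  proof (cases "norm w \<le> R")
    case True
    define k where "k = - (a * (2 * (w \<bullet> h) + h \<bullet> h))"
    define r where "r = 1 - a * (w \<bullet> w)"
    have rk: "1 - a * ((w + h) \<bullet> (w + h)) = r + k"
      by (simp add: r_def k_def inner_add_left inner_add_right inner_commute algebra_simps)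
    have "\<bar>w \<bullet> h\<bar> \<le> norm w * norm h" by (rule Cauchy_Schwarz_ineq2)
    also have "\<dots> \<le> R * norm h" using True by (intro mult_right_mono) auto
    finally have wh: "\<bar>w \<bullet> h\<bar> \<le> R * norm h" .
    have "\<bar>k\<bar> = a * \<bar>2 * (w \<bullet> h) + h \<bullet> h\<bar>" using a by (simp add: k_def abs_mult)
    also have "h \<bullet> h = norm h * norm h" by (simp add: dot_square_norm power2_eq_square)
    also have "\<bar>2 * (w \<bullet> h) + norm h * norm h\<bar> \<le> 2 * (R * norm h) + norm h * 1"
    proof -
      have "norm h * norm h \<le> norm h * 1" by (rule mult_left_mono) (use h in auto)
      moreover have "0 \<le> norm h * norm h" by simp
      ultimately show ?thesis using wh by linarith
    qed
    finally have "\<bar>k\<bar> \<le> a * (2 * R + 1) * norm h" using a by (simp add: algebra_simps)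
    then have "\<bar>k\<bar>\<^sup>2 \<le> (a * (2 * R + 1) * norm h)\<^sup>2" by (intro power_mono) auto
    then have k2: "k\<^sup>2 \<le> (a * (2 * R + 1))\<^sup>2 * (norm h)\<^sup>2" by (simp only: power2_abs power_mult_distrib)
    have r01: "0 \<le> max 0 r" "max 0 r \<le> 1" using a by (auto simp: r_def)
    have D: "2 * max 0 r * k = bump_deriv a w h - 2 * a * (norm h)\<^sup>2 * max 0 r"
      by (simp add: bump_deriv_def r_def k_def dot_square_norm algebra_simps)
    have "\<bar>(max 0 (r + k))\<^sup>2 - (max 0 r)\<^sup>2 - 2 * max 0 r * k\<bar> \<le> k\<^sup>2"
      by (rule square_max_0_quadratic)
    moreover have "2 * a * (norm h)\<^sup>2 * max 0 r \<le> 2 * a * (norm h)\<^sup>2 * 1"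
      using r01 a by (intro mult_left_mono) auto
    moreover have "0 \<le> 2 * a * (norm h)\<^sup>2 * max 0 r" using r01 a by simp
    moreover have "C * (norm h)\<^sup>2 = (a * (2 * R + 1))\<^sup>2 * (norm h)\<^sup>2 + 2 * a * (norm h)\<^sup>2 * 1"
      by (simp add: C_def algebra_simps)
    ultimately show ?thesis
      using k2 D unfolding bump_def rk r_def[symmetric] by linarith
  next
    case False
    have "norm (w + h) \<ge> 1 / sqrt a" using norm_diff_ineq[of w h] h False by (simp add: R_def)
    then show ?thesis
      using False bump_eq_0[OF a, of w] bump_eq_0[OF a, of "w + h"] a
      by (simp add: bump_def bump_deriv_def R_def C_def)
  qed
  moreover have "C \<ge> 0" using a by (simp add: C_def)
  ultimately show ?thesis using that by blast
qed

lemma bump_integral_pos: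
  assumes a: "a > 0"
  shows "(LINT z|lborel. bump a (z::'a::euclidean_space)) > 0"
proof -
  \<comment> \<open>On this ball \<open>a * (z \<bullet> z)\<close> is at most 1/2, so the kernel is
    at least 1/4 there.\<close>
  define r where "r = sqrt (1 / (2 * a))"
  have r: "r > 0" using a by (simp add: r_def)
  have "(LINT z|lborel. (1/4) * indicator (ball (0::'a) r) z :: real) \<le> (LINT z|lborel. bump a (z::'a))"
  proof (rule integral_mono)
    show "integrable lborel (bump a :: 'a \<Rightarrow> real)"
      by (intro integrable_continuous_bounded_support continuous_on_bump bounded_support_bump a)
    show "integrable lborel (\<lambda>z. (1/4) * indicator (ball (0::'a) r) z :: real)"
      by (intro integrable_mult_right integrable_real_indicator emeasure_bounded_finite) auto
    fix z :: 'a
    show "(1/4) * indicator (ball 0 r) z \<le> bump a z"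
    proof (cases "norm z < r")
      case True
      have "(norm z)\<^sup>2 \<le> r\<^sup>2" by (rule power_mono) (use True in auto)
      then have "1/2 \<le> 1 - a * (z \<bullet> z)" using a by (simp add: r_def dot_square_norm field_simps)
      then have "(1/2)\<^sup>2 \<le> bump a z" unfolding bump_def by (intro power_mono) auto
      then show ?thesis using True by (simp add: power2_eq_square)
    qed (simp add: bump_nonneg)
  qed
  moreover have "(LINT z|lborel. (1/4) * indicator (ball (0::'a) r) z :: real) > 0"
    using content_ball_pos[OF r, of "0::'a"] by simp
  ultimately show ?thesis by linarith
qed

lemma continuous_on_convolution:
  fixes u E :: "'a::euclidean_space \<Rightarrow> real"
  assumes u: "integrable lborel u" and E: "continuous_on UNIV E" "bounded_support E"
  shows "continuous_on UNIV (\<lambda>x. LINT y|lborel. u y * E (y - x))"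
proof -
  obtain R C where C: "C > 0" "\<And>x. norm (E x) \<le> C * indicator (cball 0 R) x"
    using continuous_bounded_supportE[OF E] by metis
  have EC: "\<bar>E x\<bar> \<le> C" for x
    using C(2)[of x] C(1) by (cases "norm x \<le> R") auto
  have [measurable]: "u \<in> borel_measurable borel" "E \<in> borel_measurable borel"
    using borel_measurable_integrable[OF u] borel_measurable_continuous_onI[OF E(1)] by auto
  show ?thesis
    unfolding continuous_on_sequentially
  proof (intro allI ballI impI)
    fix X :: "nat \<Rightarrow> 'a" and x assume "(\<forall>n. X n \<in> UNIV) \<and> X \<longlonglongrightarrow> x"
    then have X: "X \<longlonglongrightarrow> x" by simp
    have "(\<lambda>n. LINT y|lborel. u y * E (y - X n)) \<longlonglongrightarrow> (LINT y|lborel. u y * E (y - x))"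
    proof (rule integral_dominated_convergence[where w="\<lambda>y. \<bar>u y\<bar> * C"])
      show "AE y in lborel. (\<lambda>n. u y * E (y - X n)) \<longlonglongrightarrow> u y * E (y - x)"
        by (intro AE_I2 tendsto_intros continuous_on_tendsto_compose[OF E(1)] X) auto
      show "AE y in lborel. norm (u y * E (y - X n)) \<le> \<bar>u y\<bar> * C" for n
        by (intro AE_I2) (simp add: abs_mult mult_left_mono EC)
    qed (use u in auto)
    then show "((\<lambda>x. LINT y|lborel. u y * E (y - x)) \<circ> X) \<longlonglongrightarrow> (LINT y|lborel. u y * E (y - x))"
      by (simp add: o_def)
  qed
qed

lemma bounded_support_shift:
  assumes "bounded_support f"
  shows "bounded_support (\<lambda>y. f (y - x))"
proof -
  obtain R where R: "\<And>x. norm x > R \<Longrightarrow> f x = 0" using assms unfolding bounded_support_def by blast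
  have "f (y - x) = 0" if "norm y > R + norm x" for y
    by (rule R) (use norm_triangle_ineq2[of y x] that in linarith)
  then show ?thesis unfolding bounded_support_def by blast
qed

text \<open>Integrating the uniform quadratic remainder of the kernel against \<open>u\<close>
  leaves an error of order \<open>(norm h)\<^sup>2\<close>, with a constant proportional to the L1
  norm of \<open>u\<close>.\<close>

lemma C1_map_bump_convolution:
  fixes u :: "'a::euclidean_space \<Rightarrow> real"
  assumes u: "integrable lborel u" and a: "a > 0"
  shows "C1_map (\<lambda>x. LINT y|lborel. u y * bump a (y - x))"
proof -
  obtain C where C: "C \<ge> 0"
    "\<And>w h::'a. norm h \<le> 1 \<Longrightarrow> \<bar>bump a (w + h) - bump a w - bump_deriv a w h\<bar> \<le> C * (norm h)\<^sup>2"
    using bump_quadratic[OF a] by metis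
  define v where "v = (\<lambda>x. LINT y|lborel. u y * bump a (y - x))"
  \<comment> \<open>The minus sign arises because \<open>x\<close> enters the kernel through
    \<open>y - x\<close>.\<close>
  define v' where "v' = (\<lambda>x h. LINT y|lborel. u y * bump_deriv a (y - x) (- h))"
  have int1: "integrable lborel (\<lambda>y. u y * bump a (y - x))" for x
    by (intro integrable_mult_continuous_bounded_support u bounded_support_shift bounded_support_bump a
        continuous_on_compose2[OF continuous_on_bump[of UNIV]] continuous_intros) auto
  have int2: "integrable lborel (\<lambda>y. u y * bump_deriv a (y - x) h)" for x h
    by (intro integrable_mult_continuous_bounded_support u bounded_support_shift[of "\<lambda>w. bump_deriv a w h"]
        bounded_support_bump_deriv a
        continuous_on_compose2[OF continuous_on_bump_deriv[of UNIV]] continuous_intros) auto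
  define K where "K = C * (LINT y|lborel. \<bar>u y\<bar>)"
  have bound: "\<bar>v (x + h) - v x - v' x h\<bar> \<le> K * (norm h)\<^sup>2" if h: "norm h \<le> 1" for x h
  proof -
    let ?q = "\<lambda>y. u y * (bump a ((y - x) + (- h)) - bump a (y - x) - bump_deriv a (y - x) (- h))"
    have q: "?q = (\<lambda>y. u y * bump a (y - (x + h)) - u y * bump a (y - x) - u y * bump_deriv a (y - x) (- h))"
    proof
      fix y
      have sh: "(y - x) + (- h) = y - (x + h)" by simp
      show "?q y = u y * bump a (y - (x + h)) - u y * bump a (y - x) - u y * bump_deriv a (y - x) (- h)"
        unfolding sh by (simp only: right_diff_distrib)
    qed
    note ints = int1[of "x + h"] int1[of x] int2[of x "- h"]
    have eq: "v (x + h) - v x - v' x h = integral\<^sup>L lborel ?q"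
      unfolding q v_def v'_def
      by (subst Bochner_Integration.integral_diff Bochner_Integration.integral_diff[OF ints(1,2)];
          (intro Bochner_Integration.integrable_diff ints)?)+ simp
    have I: "integrable lborel ?q"
      unfolding q by (intro Bochner_Integration.integrable_diff ints)
    have "\<bar>v (x + h) - v x - v' x h\<bar> \<le> (LINT y|lborel. \<bar>u y * (bump a ((y - x) + (- h)) - bump a (y - x) - bump_deriv a (y - x) (- h))\<bar>)"
      unfolding eq by (rule integral_abs_bound)
    also have "\<dots> \<le> (LINT y|lborel. \<bar>u y\<bar> * (C * (norm h)\<^sup>2))"
    proof (rule integral_mono)
      show "\<bar>u y * (bump a ((y - x) + (- h)) - bump a (y - x) - bump_deriv a (y - x) (- h))\<bar> \<le> \<bar>u y\<bar> * (C * (norm h)\<^sup>2)" for y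
        unfolding abs_mult using C(2)[of "- h" "y - x"] h by (intro mult_left_mono) auto
    qed (use I u in auto)
    finally show ?thesis by (simp add: K_def mult.commute mult.left_commute)
  qed
  have "(v has_derivative v' x) (at x)" for x
  proof -
    have "linear (v' x)"
    proof (rule linearI)
      fix h k :: 'a and c :: real
      show "v' x (h + k) = v' x h + v' x k"
        using int2[of x "-h"] int2[of x "-k"]
        by (simp add: v'_def bump_deriv_def inner_add_right inner_diff_right algebra_simps flip: Bochner_Integration.integral_add)
      show "v' x (c *\<^sub>R h) = c *\<^sub>R v' x h"
        by (simp add: v'_def bump_deriv_def mult.left_commute flip: integral_mult_right_zero)
    qed
    then have bl: "bounded_linear (v' x)" by (simp add: linear_conv_bounded_linear)
    have "(\<lambda>h. norm (v (x + h) - v x - v' x h) / norm h) \<midarrow>0\<rightarrow> 0"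
    proof (rule Lim_null_comparison)
      show "((\<lambda>h::'a. K * norm h) \<longlongrightarrow> 0) (at 0)"
        by (auto intro!: tendsto_eq_intros)
      have "\<forall>\<^sub>F h::'a in at 0. dist h 0 < 1" by (auto simp: eventually_at intro!: exI[of _ 1])
      then show "\<forall>\<^sub>F h in at 0. norm (norm (v (x + h) - v x - v' x h) / norm h) \<le> K * norm h"
      proof eventually_elim
        case (elim h)
        have "norm (v (x + h) - v x - v' x h) \<le> K * norm h * norm h"
          using bound[of h x] elim by (simp add: power2_eq_square mult.assoc)
        then show ?case
          by (cases "h = 0") (auto simp: divide_le_eq)
      qed
    qed
    then show ?thesis using bl by (simp add: has_derivative_at)
  qed
  moreover have "continuous_on UNIV (\<lambda>x. v' x b)" for b
    unfolding v'_def
    by (intro continuous_on_convolution u continuous_on_bump_deriv bounded_support_bump_deriv a)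
  ultimately show ?thesis unfolding v_def by (rule C1_mapI)
qed

section \<open>Truncation of integrable functions\<close>

text \<open>Prepares Fubini for averages of translates. By translation invariance the inner integral
  of the absolute value is \<open>\<bar>k z\<bar>\<close> times the L1 norm of
  \<open>u\<close>.\<close>

lemma integrable_pair_translate:
  fixes u k :: "'a::euclidean_space \<Rightarrow> real"
  assumes u: "integrable lborel u" and k: "integrable lborel k"
  shows "integrable (lborel \<Otimes>\<^sub>M lborel) (\<lambda>(z, x). k z * u (z + x))"
    and "integrable (lborel \<Otimes>\<^sub>M lborel) (\<lambda>(z, x). k z * u x)"
proof -
  have mu[measurable]: "u \<in> borel_measurable borel" and [measurable]: "k \<in> borel_measurable borel"
    using borel_measurable_integrable[OF u] borel_measurable_integrable[OF k] by auto
  have tr: "(LINT x|lborel. \<bar>u (z + x)\<bar>) = (LINT x|lborel. \<bar>u x\<bar>)" for z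
    by (rule lborel_integral_translate(1)) measurable
  show "integrable (lborel \<Otimes>\<^sub>M lborel) (\<lambda>(z, x). k z * u (z + x))"
  proof (rule lborel_pair.Fubini_integrable)
    show "integrable lborel (\<lambda>z. LINT x|lborel. norm (case (z, x) of (z, x) \<Rightarrow> k z * u (z + x)))"
      using k by (simp add: abs_mult tr)
    show "AE z in lborel. integrable lborel (\<lambda>x. case (z, x) of (z, x) \<Rightarrow> k z * u (z + x))"
      using lborel_integral_translate(2)[OF mu u] by simp
  qed measurable
  show "integrable (lborel \<Otimes>\<^sub>M lborel) (\<lambda>(z, x). k z * u x)"
  proof (rule lborel_pair.Fubini_integrable)
    show "integrable lborel (\<lambda>z. LINT x|lborel. norm (case (z, x) of (z, x) \<Rightarrow> k z * u x))"
      using k by (simp add: abs_mult)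
    show "AE z in lborel. integrable lborel (\<lambda>x. case (z, x) of (z, x) \<Rightarrow> k z * u x)"
      using u by simp
  qed measurable
qed

lemma divergence_translate:
  fixes \<phi> :: "'a::euclidean_space \<Rightarrow> 'a"
  assumes "C1_map \<phi>"
  shows "C1_map (\<lambda>y. \<phi> (y - z))" "divergence (\<lambda>y. \<phi> (y - z)) x = divergence \<phi> (x - z)"
proof -
  have der: "((\<lambda>y. \<phi> (y - z)) has_derivative frechet_derivative \<phi> (at (x - z))) (at x)" for x
    by (rule has_derivative_compose[OF _ C1_map_has_derivative[OF assms], where f="\<lambda>y. y - z"])
      (auto intro!: derivative_eq_intros)
  show "C1_map (\<lambda>y. \<phi> (y - z))"
    by (rule C1_mapI[OF der], rule continuous_on_compose2[OF C1_map_continuous_partial[OF assms]])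
      (auto intro!: continuous_intros)
  show "divergence (\<lambda>y. \<phi> (y - z)) x = divergence \<phi> (x - z)"
    by (simp add: divergence_def frechet_derivative_at[OF der, symmetric])
qed

lemma translate_test_field:
  assumes "\<phi> \<in> test_fields"
  shows "(\<lambda>y. \<phi> (y - z)) \<in> test_fields"
  using assms divergence_translate(1) bounded_support_shift by (auto simp: test_fields_iff)

text \<open>A change of variables moves the shift from \<open>u\<close> to the field, and a shifted
  test field is again a test field.\<close>

lemma integral_translate_divergence_le:
  fixes u :: "'a::euclidean_space \<Rightarrow> real"
  assumes mu[measurable]: "u \<in> borel_measurable borel" and TV: "total_variation u \<le> ereal T"
    and \<phi>: "\<phi> \<in> test_fields"
  shows "(LINT x|lborel. u (z + x) * divergence \<phi> x) \<le> T"
proof -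
  have [measurable]: "divergence \<phi> \<in> borel_measurable borel" by (rule test_fieldD[OF \<phi>])
  have "(LINT x|lborel. u (z + x) * divergence \<phi> (z + x - z)) = (LINT x|lborel. u x * divergence \<phi> (x - z))"
    by (rule lborel_integral_translate(1)[of "\<lambda>x. u x * divergence \<phi> (x - z)"]) measurable
  also have "\<dots> = (LINT x|lborel. u x * divergence (\<lambda>y. \<phi> (y - z)) x)"
    by (simp add: divergence_translate(2)[OF test_fieldD(1)[OF \<phi>]])
  also have "\<dots> \<le> T"
    using TV translate_test_field[OF \<phi>] by (auto simp: total_variation_le_iff[OF mu])
  finally show ?thesis by simp
qed

text \<open>Every translate of \<open>u\<close> has the same total variation, so averaging translates cannot increase it.\<close>
lemma mollification:
  fixes u :: "'a::euclidean_space \<Rightarrow> real"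
  assumes u: "integrable lborel u" and TV: "total_variation u \<le> ereal T" and e: "e > 0"
  obtains v where "C1_map v" "integrable lborel v" "total_variation v \<le> ereal T"
    "(LINT x|lborel. \<bar>v x - u x\<bar>) \<le> e"
proof -
  have mu[measurable]: "u \<in> borel_measurable borel" using borel_measurable_integrable[OF u] by simp
  obtain d where d: "d > 0" "\<And>z. norm z \<le> d \<Longrightarrow> (LINT x|lborel. \<bar>u (z + x) - u x\<bar>) \<le> e"
    using L1_translation_continuous[OF u e] by metis
  \<comment> \<open>Makes \<open>d\<close> the radius of the kernel, so that only translations with
    L1 error at most \<open>e\<close> enter the average.\<close>
  define a where "a = 1 / d\<^sup>2"
  have a: "a > 0" and sa: "1 / sqrt a = d" using d(1) by (auto simp: a_def real_sqrt_divide)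
  define Z where "Z = (LINT z|lborel. bump a (z::'a))"
  have Z: "Z > 0" unfolding Z_def by (rule bump_integral_pos[OF a])
  define k where "k = (\<lambda>z::'a. bump a z / Z)"
  have kint: "integrable lborel k"
    unfolding k_def
    by (intro integrable_divide integrable_continuous_bounded_support continuous_on_bump bounded_support_bump a)
  have k0: "k z \<ge> 0" for z using Z by (simp add: k_def bump_nonneg)
  have k1: "(LINT z|lborel. k z) = 1" using Z by (simp add: k_def Z_def)
  have [measurable]: "k \<in> borel_measurable borel" using borel_measurable_integrable[OF kint] by simp
  define v where "v = (\<lambda>x. LINT z|lborel. k z * u (z + x))"
  \<comment> \<open>The average of translates is suited to the variation and L1 estimates; the
    convolution form puts the dependence on \<open>x\<close> into the kernel, which gives
    differentiability.\<close>
  have v_eq: "v x = inverse Z * (LINT y|lborel. u y * bump a (y - x))" for x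
  proof -
    have "(LINT z|lborel. k (x + z - x) * u (x + z)) = (LINT y|lborel. k (y - x) * u y)"
      by (rule lborel_integral_translate(1)[of "\<lambda>y. k (y - x) * u y"]) measurable
    then have "v x = (LINT y|lborel. inverse Z * (u y * bump a (y - x)))"
      by (simp add: v_def k_def add.commute divide_inverse mult_ac)
    then show ?thesis by simp
  qed
  have C1v: "C1_map v"
  proof -
    have "C1_map (\<lambda>x. inverse Z *\<^sub>R (LINT y|lborel. u y * bump a (y - x)))"
      by (intro C1_map_scaleR C1_map_bump_convolution u a C1_map_const)
    then show ?thesis by (simp add: v_eq[abs_def])
  qed
  note pi = integrable_pair_translate[OF u kint]
  have intv: "integrable lborel v"
    unfolding v_def using lborel_pair.integrable_snd[OF pi(1)] .
  have mv: "v \<in> borel_measurable borel" using borel_measurable_integrable[OF intv] by simp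
  have "(LINT x|lborel. v x * divergence \<phi> x) \<le> T" if \<phi>: "\<phi> \<in> test_fields" for \<phi>
  proof -
    obtain C where C: "C > 0" "\<And>x. \<bar>divergence \<phi> x\<bar> \<le> C"
      using test_field_divergence_bound[OF \<phi>] by metis
    have [measurable]: "divergence \<phi> \<in> borel_measurable borel" by (rule test_fieldD[OF \<phi>])
    have P: "integrable (lborel \<Otimes>\<^sub>M lborel) (\<lambda>(z, x). k z * u (z + x) * divergence \<phi> x)"
    proof (rule Bochner_Integration.integrable_bound[OF integrable_mult_right[OF pi(1), of C]])
      show "AE p in lborel \<Otimes>\<^sub>M lborel. norm (case p of (z, x) \<Rightarrow> k z * u (z + x) * divergence \<phi> x)
          \<le> norm (C * (case p of (z, x) \<Rightarrow> k z * u (z + x)))"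
        using C by (intro AE_I2) (auto simp: abs_mult mult.commute intro!: mult_right_mono mult_nonneg_nonneg)
    qed measurable
    have "(LINT x|lborel. v x * divergence \<phi> x) = (LINT x|lborel. LINT z|lborel. k z * u (z + x) * divergence \<phi> x)"
      by (simp add: v_def)
    also have "\<dots> = (LINT z|lborel. LINT x|lborel. k z * u (z + x) * divergence \<phi> x)"
      by (rule lborel_pair.Fubini_integral[OF P])
    also have "\<dots> \<le> (LINT z|lborel. k z * T)"
    proof (rule integral_mono)
      show "integrable lborel (\<lambda>z. LINT x|lborel. k z * u (z + x) * divergence \<phi> x)"
        using lborel_pair.integrable_fst[OF P] .
      show "(LINT x|lborel. k z * u (z + x) * divergence \<phi> x) \<le> k z * T" for z
        using mult_left_mono[OF integral_translate_divergence_le[OF mu TV \<phi>] k0]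
        by (simp add: mult.assoc)
    qed (use kint in simp)
    also have "\<dots> = T" using k1 by simp
    finally show ?thesis .
  qed
  then have TVv: "total_variation v \<le> ereal T" by (simp add: total_variation_le_iff[OF mv])
  have Q: "integrable (lborel \<Otimes>\<^sub>M lborel) (\<lambda>(z, x). k z * (u (z + x) - u x))"
    using Bochner_Integration.integrable_diff[OF pi] by (simp add: case_prod_unfold right_diff_distrib)
  then have Q': "integrable (lborel \<Otimes>\<^sub>M lborel) (\<lambda>(z, x). k z * \<bar>u (z + x) - u x\<bar>)"
    using integrable_abs[OF Q] k0 by (simp add: case_prod_unfold abs_mult)
  have "(LINT x|lborel. \<bar>v x - u x\<bar>) \<le> (LINT x|lborel. LINT z|lborel. k z * \<bar>u (z + x) - u x\<bar>)"
  proof (rule integral_mono_AE)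
    show "integrable lborel (\<lambda>x. LINT z|lborel. k z * \<bar>u (z + x) - u x\<bar>)"
      using lborel_pair.integrable_snd[OF Q'] .
    \<comment> \<open>Fubini provides integrable slices only for almost every \<open>x\<close>,
      hence the comparison of integrands almost everywhere.\<close>
    show "AE x in lborel. \<bar>v x - u x\<bar> \<le> (LINT z|lborel. k z * \<bar>u (z + x) - u x\<bar>)"
      using lborel_pair.AE_integrable_snd[OF pi(1)] lborel_pair.AE_integrable_snd[OF Q']
    proof eventually_elim
      case (elim x)
      have "v x - u x = (LINT z|lborel. k z * u (z + x)) - (LINT z|lborel. k z * u x)"
        using k1 by (simp add: v_def)
      also have "\<dots> = (LINT z|lborel. k z * (u (z + x) - u x))"
        using elim(1) kint by (simp add: right_diff_distrib)
      also have "\<bar>\<dots>\<bar> \<le> (LINT z|lborel. \<bar>k z * (u (z + x) - u x)\<bar>)"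
        by (rule integral_abs_bound)
      finally show ?case using k0 by (simp add: abs_mult)
    qed
  qed (use intv u in auto)
  also have "\<dots> = (LINT z|lborel. LINT x|lborel. k z * \<bar>u (z + x) - u x\<bar>)"
    by (rule lborel_pair.Fubini_integral[OF Q'])
  also have "\<dots> \<le> (LINT z|lborel. k z * e)"
  proof (rule integral_mono)
    show "integrable lborel (\<lambda>z. LINT x|lborel. k z * \<bar>u (z + x) - u x\<bar>)"
      using lborel_pair.integrable_fst[OF Q'] .
    show "(LINT x|lborel. k z * \<bar>u (z + x) - u x\<bar>) \<le> k z * e" for z
    proof (cases "norm z \<le> d")
      case True
      then show ?thesis using mult_left_mono[OF d(2) k0] by simp
    next
      case False
      then have "k z = 0" using bump_eq_0[OF a, of z] by (simp add: sa k_def bump_def)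
      then show ?thesis by simp
    qed
  qed (use kint in simp)
  also have "\<dots> = e" using k1 by simp
  finally show ?thesis using that C1v intv TVv by blast
qed

text \<open>Both truncations depend on the value of the function in a 1-Lipschitz way. Replacing
  \<open>u\<close> by a mollification therefore costs at most the L1 distance times the bounds of
  the two divergences.\<close>

lemma truncation_inequality:
  fixes u :: "'a::euclidean_space \<Rightarrow> real"
  assumes u: "integrable lborel u" and TV: "total_variation u \<le> ereal T" and t: "t \<ge> 0"
    and \<phi>: "\<phi> \<in> test_fields" and \<psi>: "\<psi> \<in> test_fields"
  shows "(LINT x|lborel. (u x - max 0 (u x - t)) * divergence \<phi> x)
       + (LINT x|lborel. max 0 (u x - t) * divergence \<psi> x) \<le> T"
proof -
  obtain C1 C2 where C1: "C1 > 0" "\<And>x. \<bar>divergence \<phi> x\<bar> \<le> C1" and C2: "C2 > 0" "\<And>x. \<bar>divergence \<psi> x\<bar> \<le> C2"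
    using test_field_divergence_bound[OF \<phi>] test_field_divergence_bound[OF \<psi>] by metis
  \<comment> \<open>For a nonnegative level the excess \<open>max 0 (w x - t)\<close> is bounded by
    \<open>\<bar>w x\<bar>\<close>.\<close>
  have pos: "integrable lborel (\<lambda>x. max 0 (w x - t))" if w: "integrable lborel w" for w :: "'a \<Rightarrow> real"
  proof (rule Bochner_Integration.integrable_bound[OF w])
    have [measurable]: "w \<in> borel_measurable borel" using borel_measurable_integrable[OF w] by simp
    show "(\<lambda>x. max 0 (w x - t)) \<in> borel_measurable lborel" by measurable
  qed (use t in auto)
  show ?thesis
  proof (rule field_le_epsilon)
    fix e :: real assume e: "e > 0"
    define e' where "e' = e / (C1 + C2)"
    have e': "e' > 0" using e C1(1) C2(1) by (simp add: e'_def)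
    obtain v where v: "C1_map v" "integrable lborel v" "total_variation v \<le> ereal T"
      and d: "(LINT x|lborel. \<bar>v x - u x\<bar>) \<le> e'"
      using mollification[OF u TV e'] by metis
    have absd: "integrable lborel (\<lambda>x. \<bar>v x - u x\<bar> * C)" for C using u v(2) by auto
    have "(LINT x|lborel. (u x - max 0 (u x - t)) * divergence \<phi> x)
        \<le> (LINT x|lborel. (v x - max 0 (v x - t)) * divergence \<phi> x + \<bar>v x - u x\<bar> * C1)"
    proof (rule integral_mono)
      show "integrable lborel (\<lambda>x. (u x - max 0 (u x - t)) * divergence \<phi> x)"
        by (intro integrable_mult_divergence \<phi> Bochner_Integration.integrable_diff u pos)
      show "integrable lborel (\<lambda>x. (v x - max 0 (v x - t)) * divergence \<phi> x + \<bar>v x - u x\<bar> * C1)"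
        by (intro Bochner_Integration.integrable_add integrable_mult_divergence \<phi> Bochner_Integration.integrable_diff v(2) pos absd)
      fix x
      have "((u x - max 0 (u x - t)) - (v x - max 0 (v x - t))) * divergence \<phi> x
          \<le> \<bar>(u x - max 0 (u x - t)) - (v x - max 0 (v x - t))\<bar> * \<bar>divergence \<phi> x\<bar>"
        unfolding abs_mult[symmetric] by (rule abs_ge_self)
      also have "\<dots> \<le> \<bar>v x - u x\<bar> * C1"
        by (rule mult_mono[OF _ C1(2)]) auto
      finally show "(u x - max 0 (u x - t)) * divergence \<phi> x \<le> (v x - max 0 (v x - t)) * divergence \<phi> x + \<bar>v x - u x\<bar> * C1"
        by (simp add: algebra_simps)
    qed
    also have "\<dots> = (LINT x|lborel. (v x - max 0 (v x - t)) * divergence \<phi> x) + (LINT x|lborel. \<bar>v x - u x\<bar>) * C1"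
      by (subst Bochner_Integration.integral_add)
        (intro integrable_mult_divergence \<phi> Bochner_Integration.integrable_diff v(2) pos absd | simp only: integral_mult_left_zero)+
    finally have 1: "(LINT x|lborel. (u x - max 0 (u x - t)) * divergence \<phi> x)
      \<le> (LINT x|lborel. (v x - max 0 (v x - t)) * divergence \<phi> x) + (LINT x|lborel. \<bar>v x - u x\<bar>) * C1" .
    have "(LINT x|lborel. max 0 (u x - t) * divergence \<psi> x)
        \<le> (LINT x|lborel. max 0 (v x - t) * divergence \<psi> x + \<bar>v x - u x\<bar> * C2)"
    proof (rule integral_mono)
      show "integrable lborel (\<lambda>x. max 0 (u x - t) * divergence \<psi> x)"
        by (intro integrable_mult_divergence \<psi> u pos)
      show "integrable lborel (\<lambda>x. max 0 (v x - t) * divergence \<psi> x + \<bar>v x - u x\<bar> * C2)"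
        by (intro Bochner_Integration.integrable_add integrable_mult_divergence \<psi> v(2) pos absd)
      fix x
      have "(max 0 (u x - t) - max 0 (v x - t)) * divergence \<psi> x
          \<le> \<bar>max 0 (u x - t) - max 0 (v x - t)\<bar> * \<bar>divergence \<psi> x\<bar>"
        unfolding abs_mult[symmetric] by (rule abs_ge_self)
      also have "\<dots> \<le> \<bar>v x - u x\<bar> * C2"
        by (rule mult_mono[OF _ C2(2)]) auto
      finally show "max 0 (u x - t) * divergence \<psi> x \<le> max 0 (v x - t) * divergence \<psi> x + \<bar>v x - u x\<bar> * C2"
        by (simp add: algebra_simps)
    qed
    also have "\<dots> = (LINT x|lborel. max 0 (v x - t) * divergence \<psi> x) + (LINT x|lborel. \<bar>v x - u x\<bar>) * C2"
      by (subst Bochner_Integration.integral_add)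
        (intro integrable_mult_divergence \<psi> v(2) pos absd | simp only: integral_mult_left_zero)+
    finally have 2: "(LINT x|lborel. max 0 (u x - t) * divergence \<psi> x)
      \<le> (LINT x|lborel. max 0 (v x - t) * divergence \<psi> x) + (LINT x|lborel. \<bar>v x - u x\<bar>) * C2" .
    have "(LINT x|lborel. \<bar>v x - u x\<bar>) * (C1 + C2) \<le> e' * (C1 + C2)"
      using d C1(1) C2(1) by (intro mult_right_mono) auto
    also have "\<dots> = e" using C1(1) C2(1) by (simp add: e'_def)
    finally show "(LINT x|lborel. (u x - max 0 (u x - t)) * divergence \<phi> x)
       + (LINT x|lborel. max 0 (u x - t) * divergence \<psi> x) \<le> T + e"
      using 1 2 truncation_inequality_C1[OF v(1,3) \<phi> \<psi>, of t] by (simp add: distrib_left)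
  qed
qed

text \<open>The two fields in \<open>truncation_inequality\<close> are independent, so the suprema
  can be taken one after the other. The zero field shows first that the variation of the upper part
  is finite, which allows it to be subtracted.\<close>

lemma total_variation_truncation:
  fixes u :: "'a::euclidean_space \<Rightarrow> real"
  assumes u: "integrable lborel u" and t: "t \<ge> 0"
  shows "total_variation (\<lambda>x. u x - max 0 (u x - t)) + total_variation (\<lambda>x. max 0 (u x - t)) \<le> total_variation u"
proof (cases "total_variation u = \<infinity>")
  case False
  have [measurable]: "u \<in> borel_measurable borel" using borel_measurable_integrable[OF u] by simp
  obtain T where T: "total_variation u = ereal T"
    using False total_variation_nonneg[of u] by (cases "total_variation u") auto
  let ?a = "\<lambda>x. u x - max 0 (u x - t)" and ?b = "\<lambda>x. max 0 (u x - t)"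
  note ineq = truncation_inequality[OF u eq_refl[OF T] t]
  have ma: "?a \<in> borel_measurable borel" and mb: "?b \<in> borel_measurable borel" by measurable
  have "total_variation ?b \<le> ereal (T - (LINT x|lborel. ?a x * divergence \<phi> x))" if "\<phi> \<in> test_fields" for \<phi>
    using ineq[OF that] by (auto simp: total_variation_le_iff[OF mb] algebra_simps)
  then have b: "total_variation ?b \<le> ereal (T - (LINT x|lborel. ?a x * divergence \<phi> x))" if "\<phi> \<in> test_fields" for \<phi>
    using that by blast
  obtain B where B: "total_variation ?b = ereal B"
    using b[OF zero_test_field] total_variation_nonneg[of ?b] by (cases "total_variation ?b") auto
  have "total_variation ?a \<le> ereal (T - B)"
    using b by (auto simp: total_variation_le_iff[OF ma] B algebra_simps)
  then have "total_variation ?a + ereal B \<le> ereal (T - B) + ereal B" by (rule add_right_mono)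
  then show ?thesis by (simp add: T B)
qed simp

section \<open>The coarea formula\<close>

lemma nn_integral_lborel_translate:
  fixes f :: "'a::euclidean_space \<Rightarrow> ennreal"
  assumes [measurable]: "f \<in> borel_measurable borel"
  shows "(\<integral>\<^sup>+x. f (c + x) \<partial>lborel) = (\<integral>\<^sup>+x. f x \<partial>lborel)"
proof -
  have "(\<integral>\<^sup>+x. f x \<partial>distr lborel borel ((+) c)) = (\<integral>\<^sup>+x. f (c + x) \<partial>lborel)"
    by (subst nn_integral_distr) auto
  then show ?thesis by (simp add: lborel_distr_plus)
qed

text \<open>Telescoping: over a window of length \<open>n\<close> the shifted and unshifted
  integrals of \<open>M\<close> agree except near the ends, and the surplus at the right end, of
  length \<open>h\<close>, contributes at most \<open>T * h\<close>.\<close>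

lemma nn_integral_increment_le:
  fixes M :: "real \<Rightarrow> real"
  assumes M: "mono M" "\<And>t. 0 \<le> M t" "\<And>t. M t \<le> T" and h: "h > 0"
  shows "(\<integral>\<^sup>+t. ennreal (M (h + t) - M t) * indicator {0<..} t \<partial>lborel) \<le> ennreal (T * h)"
proof -
  have [measurable]: "M \<in> borel_measurable borel" by (rule borel_measurable_mono[OF M(1)])
  have T0: "T \<ge> 0" using M(2,3)[of 0] by linarith
  have bound: "(\<integral>\<^sup>+t. ennreal (M (h + t) - M t) * indicator {0<..real n} t \<partial>lborel) \<le> ennreal (T * h)" for n
  proof -
    let ?D = "\<integral>\<^sup>+t. ennreal (M (h + t) - M t) * indicator {0<..real n} t \<partial>lborel"
    define A where "A = (\<integral>\<^sup>+t. ennreal (M t) * indicator {0<..real n} t \<partial>lborel)"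
    have "A \<le> (\<integral>\<^sup>+t. ennreal T * indicator {0<..real n} t \<partial>lborel)"
      unfolding A_def by (intro nn_integral_mono mult_right_mono ennreal_leI M) auto
    also have "\<dots> = ennreal T * ennreal n" by (simp add: nn_integral_cmult)
    \<comment> \<open>Finiteness of the integral over the window is what permits cancelling
      \<open>A\<close> in \<open>ennreal\<close>.\<close>
    finally have "A < top" by (metis ennreal_less_top ennreal_mult_less_top order_le_less_trans)
    have "A + ?D = (\<integral>\<^sup>+t. ennreal (M t) * indicator {0<..real n} t + ennreal (M (h + t) - M t) * indicator {0<..real n} t \<partial>lborel)"
      unfolding A_def by (rule nn_integral_add[symmetric]) measurable
    also have "\<dots> = (\<integral>\<^sup>+t. ennreal (M (h + t)) * indicator {h<..h + real n} (h + t) \<partial>lborel)"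
    proof (rule nn_integral_cong)
      fix t
      have "M t \<le> M (h + t)" using h by (intro monoD[OF M(1)]) auto
      then have "ennreal (M t) + ennreal (M (h + t) - M t) = ennreal (M (h + t))"
        using M(2)[of t] by (simp flip: ennreal_plus)
      then show "ennreal (M t) * indicator {0<..real n} t + ennreal (M (h + t) - M t) * indicator {0<..real n} t
          = ennreal (M (h + t)) * indicator {h<..h + real n} (h + t)"
        by (auto simp: indicator_def)
    qed
    also have "\<dots> = (\<integral>\<^sup>+t. ennreal (M t) * indicator {h<..h + real n} t \<partial>lborel)"
      by (rule nn_integral_lborel_translate) measurable
    also have "\<dots> \<le> (\<integral>\<^sup>+t. ennreal (M t) * indicator {0<..real n} t + ennreal T * indicator {real n<..h + real n} t \<partial>lborel)"
    proof (rule nn_integral_mono)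
      fix t
      show "ennreal (M t) * indicator {h<..h + real n} t \<le> ennreal (M t) * indicator {0<..real n} t + ennreal T * indicator {real n<..h + real n} t"
        using h ennreal_leI[OF M(3)[of t]] by (auto simp: indicator_def)
    qed
    also have "\<dots> = A + ennreal T * ennreal h"
      using h unfolding A_def by (subst nn_integral_add) (auto simp: nn_integral_cmult)
    finally have "A + ?D \<le> A + ennreal (T * h)" using T0 h by (simp add: ennreal_mult)
    then show ?thesis using \<open>A < top\<close> by (auto simp: ennreal_add_left_cancel_le)
  qed
  have eq: "ennreal (M (h + t) - M t) * indicator {0<..} t
      = (SUP n. ennreal (M (h + t) - M t) * indicator {0<..real n} t)" for t
  proof (rule antisym)
    obtain n where "t \<le> real n" using real_arch_simple by blast
    then show "ennreal (M (h + t) - M t) * indicator {0<..} t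
      \<le> (SUP n. ennreal (M (h + t) - M t) * indicator {0<..real n} t)"
      by (intro SUP_upper2[of n]) (auto simp: indicator_def)
  qed (auto intro!: SUP_least simp: indicator_def)
  have "(\<integral>\<^sup>+t. ennreal (M (h + t) - M t) * indicator {0<..} t \<partial>lborel)
      = (SUP n. \<integral>\<^sup>+t. ennreal (M (h + t) - M t) * indicator {0<..real n} t \<partial>lborel)"
    unfolding eq
    by (rule nn_integral_monotone_convergence_SUP) (auto simp: incseq_def le_fun_def indicator_def)
  also have "\<dots> \<le> ennreal (T * h)" by (intro SUP_least bound)
  finally show ?thesis .
qed

lemma ereal_le_enn2ereal_ennreal: "ereal r \<le> enn2ereal (ennreal r)"
  by (cases "r \<ge> 0") (simp_all add: ennreal_neg zero_ennreal.rep_eq)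

text \<open>Here \<open>a - max 0 (a - t)\<close> is min a t. Inserted into
  \<open>total_variation_truncation\<close>, the identities compare min u t with min u s and the
  slice of \<open>u\<close> between the two levels.\<close>

lemma truncation_minus_truncation:
  fixes a :: real
  assumes "s \<le> t"
  shows "(a - max 0 (a - t)) - max 0 ((a - max 0 (a - t)) - s) = a - max 0 (a - s)"
    and "max 0 ((a - max 0 (a - t)) - s) = min (t - s) (max 0 (a - s))"
  using assms by (auto simp: max_def min_def)

text \<open>The increments of \<open>t \<mapsto> TV (min u t)\<close> dominate the total variation of the slices
  \<open>min h (u - t)\<^sup>+\<close>, whose rescalings approach the indicator of the superlevel set.\<close>
lemma coarea_upper:
  fixes u :: "'a::euclidean_space \<Rightarrow> real"
  assumes u: "integrable lborel u" and TV: "total_variation u = ereal T"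
  obtains q :: "real \<Rightarrow> ennreal" where "q \<in> borel_measurable borel"
    "\<And>t. t > 0 \<Longrightarrow> e2ennreal (perimeter {x. u x > t}) \<le> q t"
    "(\<integral>\<^sup>+t. q t * indicator {0<..} t \<partial>lborel) \<le> ennreal T"
proof -
  have mu[measurable]: "u \<in> borel_measurable borel" using borel_measurable_integrable[OF u] by simp
  have T0: "T \<ge> 0" using TV total_variation_nonneg[of u] by simp
  define w where "w = (\<lambda>t x. u x - max 0 (u x - t))"
  have mw[measurable]: "w t \<in> borel_measurable borel" for t unfolding w_def by measurable
  have intw: "integrable lborel (w t)" if "t \<ge> 0" for t
    by (rule Bochner_Integration.integrable_bound[OF u]) (use that in \<open>auto simp: w_def\<close>)
  have slice: "total_variation (w s) + total_variation (\<lambda>x. min (t - s) (max 0 (u x - s))) \<le> total_variation (w t)"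
    if "0 \<le> s" "s \<le> t" for s t
  proof -
    have "(\<lambda>x. w t x - max 0 (w t x - s)) = w s" "(\<lambda>x. max 0 (w t x - s)) = (\<lambda>x. min (t - s) (max 0 (u x - s)))"
      unfolding w_def using truncation_minus_truncation[OF that(2)] by blast+
    then show ?thesis using total_variation_truncation[OF intw, of t s] that by simp
  qed
  have le: "total_variation (w t) \<le> ereal T" if "t \<ge> 0" for t
  proof -
    have "total_variation (w t) + 0 \<le> total_variation (w t) + total_variation (\<lambda>x. max 0 (u x - t))"
      by (intro add_left_mono total_variation_nonneg)
    also have "\<dots> \<le> ereal T" using total_variation_truncation[OF u that] by (simp add: w_def TV)
    finally show ?thesis by simp
  qed
  \<comment> \<open>Extended by a constant to negative levels, \<open>M\<close> is monotone on the
    whole line, and its measurability follows from that.\<close>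
  define M where "M = (\<lambda>t. real_of_ereal (total_variation (w (max 0 t))))"
  have Meq: "total_variation (w t) = ereal (M t)" if "t \<ge> 0" for t
    using le[OF that] total_variation_nonneg[of "w t"] that unfolding M_def
    by (cases "total_variation (w t)") auto
  have sliceM: "total_variation (\<lambda>x. min (t - s) (max 0 (u x - s))) \<le> ereal (M t - M s)" if "0 \<le> s" "s \<le> t" for s t
    using slice[OF that] that Meq[of s] Meq[of t]
    by (cases "total_variation (\<lambda>x. min (t - s) (max 0 (u x - s)))") auto
  have Mmono: "mono M"
  proof (rule monoI)
    fix s t :: real assume "s \<le> t"
    have "ereal 0 \<le> ereal (M (max 0 t) - M (max 0 s))"
      using order_trans[OF total_variation_nonneg sliceM[of "max 0 s" "max 0 t"]] \<open>s \<le> t\<close> by auto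
    then show "M s \<le> M t" by (simp add: M_def)
  qed
  have M0: "0 \<le> M t" for t using total_variation_nonneg by (auto simp: M_def intro: real_of_ereal_pos)
  have MT: "M t \<le> T" for t
  proof -
    have "M (max 0 t) = M t" by (simp add: M_def)
    then show ?thesis using le[of "max 0 t"] Meq[of "max 0 t"] by simp
  qed
  have [measurable]: "M \<in> borel_measurable borel" by (rule borel_measurable_mono[OF Mmono])
  define a where "a = (\<lambda>k t. (M (inverse (real (Suc k)) + t) - M t) * real (Suc k))"
  have [measurable]: "a k \<in> borel_measurable borel" for k unfolding a_def by measurable
  define q where "q = (\<lambda>t. liminf (\<lambda>k. ennreal (a k t)))"
  have "e2ennreal (perimeter {x. u x > t}) \<le> q t" if t: "t > 0" for t
  proof -
    \<comment> \<open>Slices of height \<open>1 / (k + 1)\<close> rescaled to height 1. They equal 1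
      at a point of the superlevel set as soon as \<open>1 / (k + 1)\<close> is at most
      \<open>u x - t\<close>.\<close>
    define f where "f = (\<lambda>k x. real (Suc k) * min (inverse (real (Suc k))) (max 0 (u x - t)))"
    have [measurable]: "f k \<in> borel_measurable borel" for k unfolding f_def by measurable
    have f01: "0 \<le> f k x" "f k x \<le> 1" for k x
    proof -
      show "0 \<le> f k x" by (simp add: f_def)
      have "f k x \<le> real (Suc k) * inverse (real (Suc k))"
        unfolding f_def by (intro mult_left_mono) auto
      then show "f k x \<le> 1" by simp
    qed
    have flim: "(\<lambda>k. f k x) \<longlonglongrightarrow> indicator {x. u x > t} x" for x
    proof (cases "u x > t")
      case True
      then obtain n where n: "inverse (real (Suc n)) < u x - t" using reals_Archimedean[of "u x - t"] by auto
      have "f k x = 1" if "k \<ge> n" for k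
      proof -
        have "inverse (real (Suc k)) \<le> inverse (real (Suc n))" using that by (simp add: field_simps)
        then have "inverse (real (Suc k)) \<le> u x - t" using n by linarith
        then have "min (inverse (real (Suc k))) (max 0 (u x - t)) = inverse (real (Suc k))"
          by (intro min_absorb1 order_trans[OF _ max.cobounded2])
        then show ?thesis by (simp add: f_def)
      qed
      then show ?thesis using True by (intro tendsto_eventually) (auto simp: eventually_sequentially)
    next
      case False
      then show ?thesis by (simp add: f_def)
    qed
    have fTV: "total_variation (f k) \<le> ereal (a k t)" for k
    proof -
      have "total_variation (f k) = ereal (real (Suc k)) * total_variation (\<lambda>x. min (inverse (real (Suc k))) (max 0 (u x - t)))"
        unfolding f_def by (rule total_variation_scale) simp
      also have "\<dots> \<le> ereal (real (Suc k)) * ereal (M (inverse (real (Suc k)) + t) - M t)"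
        using sliceM[of t "inverse (real (Suc k)) + t"] t by (intro ereal_mult_left_mono) auto
      finally show ?thesis by (simp add: a_def mult.commute)
    qed
    have "ereal (LINT x|lborel. indicator {x. u x > t} x * divergence \<phi> x) \<le> enn2ereal (q t)"
      if \<phi>: "\<phi> \<in> test_fields" for \<phi>
    proof -
      have [measurable]: "divergence \<phi> \<in> borel_measurable borel" by (rule test_fieldD[OF \<phi>])
      have "(\<lambda>k. LINT x|lborel. f k x * divergence \<phi> x) \<longlonglongrightarrow> (LINT x|lborel. indicator {x. u x > t} x * divergence \<phi> x)"
      proof (rule integral_dominated_convergence[where w="\<lambda>x. \<bar>divergence \<phi> x\<bar>"])
        show "integrable lborel (\<lambda>x. \<bar>divergence \<phi> x\<bar>)" using test_fieldD(7)[OF \<phi>] by simp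
        show "AE x in lborel. (\<lambda>k. f k x * divergence \<phi> x) \<longlonglongrightarrow> indicator {x. u x > t} x * divergence \<phi> x"
          by (intro AE_I2 tendsto_intros flim)
        show "AE x in lborel. norm (f k x * divergence \<phi> x) \<le> \<bar>divergence \<phi> x\<bar>" for k
          using f01 by (intro AE_I2) (simp add: abs_mult mult_left_le_one_le)
      qed measurable
      then have "(\<lambda>k. ennreal (LINT x|lborel. f k x * divergence \<phi> x)) \<longlonglongrightarrow> ennreal (LINT x|lborel. indicator {x. u x > t} x * divergence \<phi> x)"
        by (rule tendsto_ennrealI)
      then have "ennreal (LINT x|lborel. indicator {x. u x > t} x * divergence \<phi> x)
          = liminf (\<lambda>k. ennreal (LINT x|lborel. f k x * divergence \<phi> x))"
        by (intro lim_imp_Liminf[symmetric]) auto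
      also have "\<dots> \<le> q t"
        unfolding q_def
        by (intro Liminf_mono always_eventually allI ennreal_leI) (use fTV \<phi> in \<open>auto simp: total_variation_le_iff\<close>)
      finally have "enn2ereal (ennreal (LINT x|lborel. indicator {x. u x > t} x * divergence \<phi> x)) \<le> enn2ereal (q t)"
        by (simp add: less_eq_ennreal.rep_eq)
      then show ?thesis using ereal_le_enn2ereal_ennreal order_trans by blast
    qed
    then have "perimeter {x. u x > t} \<le> enn2ereal (q t)"
      unfolding perimeter_def by (subst total_variation_borel) (auto intro: SUP_least)
    then show ?thesis using e2ennreal_mono[of "perimeter {x. u x > t}" "enn2ereal (q t)"] by simp
  qed
  moreover have mq: "q \<in> borel_measurable borel" unfolding q_def by measurable
  moreover have "(\<integral>\<^sup>+t. q t * indicator {0<..} t \<partial>lborel) \<le> ennreal T"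
  proof -
    have "(\<integral>\<^sup>+t. q t * indicator {0<..} t \<partial>lborel) = (\<integral>\<^sup>+t. liminf (\<lambda>k. ennreal (a k t) * indicator {0<..} t) \<partial>lborel)"
      by (rule nn_integral_cong) (auto simp: q_def indicator_def Liminf_const)
    also have "\<dots> \<le> liminf (\<lambda>k. \<integral>\<^sup>+t. ennreal (a k t) * indicator {0<..} t \<partial>lborel)"
      by (rule nn_integral_liminf) measurable
    also have "\<dots> \<le> liminf (\<lambda>k::nat. ennreal T)"
    proof (intro Liminf_mono always_eventually allI)
      fix k
      have inc: "(\<integral>\<^sup>+t. ennreal (M (inverse (real (Suc k)) + t) - M t) * indicator {0<..} t \<partial>lborel) \<le> ennreal (T * inverse (real (Suc k)))"
        by (rule nn_integral_increment_le[OF Mmono M0 MT]) simp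
      have "(\<integral>\<^sup>+t. ennreal (a k t) * indicator {0<..} t \<partial>lborel)
          = (\<integral>\<^sup>+t. ennreal (real (Suc k)) * (ennreal (M (inverse (real (Suc k)) + t) - M t) * indicator {0<..} t) \<partial>lborel)"
      proof (rule nn_integral_cong)
        fix t
        have "ennreal (a k t) = ennreal (real (Suc k)) * ennreal (M (inverse (real (Suc k)) + t) - M t)"
          unfolding a_def by (subst mult.commute, rule ennreal_mult') simp
        then show "ennreal (a k t) * indicator {0<..} t
            = ennreal (real (Suc k)) * (ennreal (M (inverse (real (Suc k)) + t) - M t) * indicator {0<..} t)"
          by (simp only: mult.assoc)
      qed
      also have "\<dots> = ennreal (real (Suc k)) * (\<integral>\<^sup>+t. ennreal (M (inverse (real (Suc k)) + t) - M t) * indicator {0<..} t \<partial>lborel)"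
        by (rule nn_integral_cmult) measurable
      also have "\<dots> \<le> ennreal (real (Suc k)) * ennreal (T * inverse (real (Suc k)))"
        by (rule mult_left_mono[OF inc]) simp
      also have "\<dots> = ennreal (real (Suc k) * (T * inverse (real (Suc k))))"
        by (rule ennreal_mult'[symmetric]) simp
      also have "real (Suc k) * (T * inverse (real (Suc k))) = T" by (simp add: field_simps)
      finally show "(\<integral>\<^sup>+t. ennreal (a k t) * indicator {0<..} t \<partial>lborel) \<le> ennreal T" .
    qed
    finally show ?thesis by (simp add: Liminf_const)
  qed
  ultimately show ?thesis using that by blast
qed

section \<open>Layer cake formulas and the lower half of the coarea formula\<close>

lemma layer_cake_integral:
  fixes u d :: "'a::euclidean_space \<Rightarrow> real"
  assumes u: "integrable lborel u" "\<And>x. u x \<ge> 0"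
    and d[measurable]: "d \<in> borel_measurable borel" and C: "\<And>x. \<bar>d x\<bar> \<le> C"
  shows "integrable lborel (\<lambda>t. (LINT x|lborel. indicator {x. u x > t} x * d x) * indicator {0<..} t)"
    and "(LINT x|lborel. u x * d x) = (LINT t|lborel. (LINT x|lborel. indicator {x. u x > t} x * d x) * indicator {0<..} t)"
proof -
  have [measurable]: "u \<in> borel_measurable borel" using borel_measurable_integrable[OF u(1)] by simp
  \<comment> \<open>The weight \<open>d\<close> on the region under the graph of \<open>u\<close>:
    integrating over \<open>t\<close> first gives \<open>u x * d x\<close>, integrating over
    \<open>x\<close> first gives the integrals over superlevel sets.\<close>
  define F where "F = (\<lambda>x t. (if 0 < t \<and> t < u x then d x else 0))"
  have ind: "(if 0 < t \<and> t < u x then c else 0) = indicator {0<..<u x} t * c" for t x and c :: real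
    by (simp add: indicator_def)
  have i1: "(LINT t|lborel. (if 0 < t \<and> t < u x then c else 0)) = u x * c" for x and c :: real
    unfolding ind using u(2)[of x] by simp
  have P: "integrable (lborel \<Otimes>\<^sub>M lborel) (case_prod F)"
  proof (rule lborel_pair.Fubini_integrable)
    show "case_prod F \<in> borel_measurable (lborel \<Otimes>\<^sub>M lborel)" unfolding F_def by measurable
    have "(LINT t|lborel. norm (case_prod F (x, t))) = u x * \<bar>d x\<bar>" for x
      using i1[of x "\<bar>d x\<bar>"] by (simp add: F_def if_distrib cong: if_cong)
    moreover have "integrable lborel (\<lambda>x. u x * \<bar>d x\<bar>)"
    proof (rule Bochner_Integration.integrable_bound[OF integrable_mult_right[OF u(1), of C]])
      show "AE x in lborel. norm (u x * \<bar>d x\<bar>) \<le> norm (C * u x)"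
      proof (rule AE_I2)
        fix x
        have "\<bar>u x\<bar> * \<bar>d x\<bar> \<le> \<bar>u x\<bar> * \<bar>C\<bar>"
          using C[of x] by (intro mult_left_mono) auto
        then show "norm (u x * \<bar>d x\<bar>) \<le> norm (C * u x)"
          by (simp add: abs_mult mult.commute)
      qed
    qed measurable
    ultimately show "integrable lborel (\<lambda>x. LINT t|lborel. norm (case_prod F (x, t)))" by simp
    show "AE x in lborel. integrable lborel (\<lambda>t. case_prod F (x, t))"
      unfolding F_def case_prod_conv ind
      by (intro AE_I2 integrable_mult_left integrable_real_indicator) (simp_all add: u(2))
  qed
  have inner: "(LINT x|lborel. F x t) = (LINT x|lborel. indicator {x. u x > t} x * d x) * indicator {0<..} t" for t
  proof (cases "t > 0")
    case True
    then show ?thesis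
      by (auto simp: F_def indicator_def intro!: Bochner_Integration.integral_cong)
  qed (simp add: F_def)
  show "integrable lborel (\<lambda>t. (LINT x|lborel. indicator {x. u x > t} x * d x) * indicator {0<..} t)"
    using lborel_pair.integrable_snd[OF P] by (simp add: inner)
  have "(LINT x|lborel. u x * d x) = (LINT x|lborel. LINT t|lborel. F x t)"
    using i1 by (simp add: F_def)
  also have "\<dots> = (LINT t|lborel. LINT x|lborel. F x t)"
    by (rule lborel_pair.Fubini_integral[OF P, symmetric])
  finally show "(LINT x|lborel. u x * d x) = (LINT t|lborel. (LINT x|lborel. indicator {x. u x > t} x * d x) * indicator {0<..} t)"
    by (simp add: inner)
qed

lemma layer_cake_measure:
  fixes u :: "'a::euclidean_space \<Rightarrow> real"
  assumes [measurable]: "u \<in> borel_measurable borel" and u: "\<And>x. u x \<ge> 0"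
  shows "(\<lambda>t. emeasure lborel {x. u x > t}) \<in> borel_measurable borel"
    and "(\<integral>\<^sup>+t. emeasure lborel {x. u x > t} * indicator {0<..} t \<partial>lborel) = (\<integral>\<^sup>+x. ennreal (u x) \<partial>lborel)"
proof -
  \<comment> \<open>As an integral of a jointly measurable function of level and point, the measure
    becomes measurable in the level.\<close>
  have em: "emeasure lborel {x. u x > t} = (\<integral>\<^sup>+x. (if t < u x then 1 else 0) \<partial>lborel)" for t
  proof -
    have "(\<integral>\<^sup>+x. (if t < u x then 1 else 0) \<partial>lborel) = (\<integral>\<^sup>+x. indicator {x. u x > t} x \<partial>lborel)"
      by (rule nn_integral_cong) (auto simp: indicator_def)
    also have "\<dots> = emeasure lborel {x. u x > t}"
      by (rule nn_integral_indicator) measurable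
    finally show ?thesis by simp
  qed
  show "(\<lambda>t. emeasure lborel {x. u x > t}) \<in> borel_measurable borel"
    unfolding em by measurable
  have "(\<integral>\<^sup>+t. emeasure lborel {x. u x > t} * indicator {0<..} t \<partial>lborel)
      = (\<integral>\<^sup>+t. \<integral>\<^sup>+x. (if 0 < t \<and> t < u x then 1 else 0) \<partial>lborel \<partial>lborel)"
  proof (rule nn_integral_cong)
    fix t :: real
    show "emeasure lborel {x. u x > t} * indicator {0<..} t = (\<integral>\<^sup>+x. (if 0 < t \<and> t < u x then 1 else 0) \<partial>lborel)"
      by (cases "t > 0") (simp_all add: em)
  qed
  also have "\<dots> = (\<integral>\<^sup>+x. \<integral>\<^sup>+t. (if 0 < t \<and> t < u x then 1 else 0) \<partial>lborel \<partial>lborel)"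
    by (rule lborel_pair.Fubini') measurable
  also have "\<dots> = (\<integral>\<^sup>+x. ennreal (u x) \<partial>lborel)"
  proof (rule nn_integral_cong)
    fix x
    have "(\<integral>\<^sup>+t. (if 0 < t \<and> t < u x then 1 else 0) \<partial>lborel) = (\<integral>\<^sup>+t. indicator {0<..<u x} t \<partial>lborel)"
      by (rule nn_integral_cong) (auto simp: indicator_def)
    then show "(\<integral>\<^sup>+t. (if 0 < t \<and> t < u x then 1 else 0) \<partial>lborel) = ennreal (u x)"
      using u[of x] by simp
  qed
  finally show "(\<integral>\<^sup>+t. emeasure lborel {x. u x > t} * indicator {0<..} t \<partial>lborel) = (\<integral>\<^sup>+x. ennreal (u x) \<partial>lborel)" .
qed

lemma ennreal_integral_le_nn_integral:
  fixes f :: "'a \<Rightarrow> real"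
  assumes "integrable M f"
  shows "ennreal (integral\<^sup>L M f) \<le> (\<integral>\<^sup>+x. ennreal (f x) \<partial>M)"
proof -
  have i: "integrable M (\<lambda>x. max 0 (f x))" using assms by simp
  have "integral\<^sup>L M f \<le> (LINT x|M. max 0 (f x))" by (rule integral_mono[OF assms i]) simp
  then have "ennreal (integral\<^sup>L M f) \<le> ennreal (LINT x|M. max 0 (f x))" by (rule ennreal_leI)
  also have "\<dots> = (\<integral>\<^sup>+x. ennreal (max 0 (f x)) \<partial>M)"
    by (rule nn_integral_eq_integral[symmetric, OF i]) simp
  also have "\<dots> = (\<integral>\<^sup>+x. ennreal (f x) \<partial>M)"
    by (rule nn_integral_cong) (simp add: max_def ennreal_neg)
  finally show ?thesis .
qed

text \<open>Only countably many test fields are needed to reach the total variation, which makes the lower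
  bound of the perimeter measurable in the level.\<close>
lemma coarea_lower:
  fixes u :: "'a::euclidean_space \<Rightarrow> real"
  assumes u: "integrable lborel u" "\<And>x. u x \<ge> 0" and TV: "total_variation u = ereal T"
  obtains p :: "real \<Rightarrow> ennreal" where "p \<in> borel_measurable borel"
    "\<And>t. p t \<le> e2ennreal (perimeter {x. u x > t})"
    "ennreal T \<le> (\<integral>\<^sup>+t. p t * indicator {0<..} t \<partial>lborel)"
proof -
  have mu[measurable]: "u \<in> borel_measurable borel" using borel_measurable_integrable[OF u(1)] by simp
  let ?I = "\<lambda>\<phi>. LINT x|lborel. u x * divergence \<phi> x"
  have "(\<lambda>\<phi>. ereal (?I \<phi>)) ` test_fields \<noteq> {}" using zero_test_field by blast
  from Sup_countable_SUP[OF this] obtain f :: "nat \<Rightarrow> ereal"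
    where f: "range f \<subseteq> (\<lambda>\<phi>. ereal (?I \<phi>)) ` test_fields"
      and Sup: "Sup ((\<lambda>\<phi>. ereal (?I \<phi>)) ` test_fields) = (SUP n. f n)"
    by metis
  have "\<forall>n. \<exists>\<phi>\<in>test_fields. f n = ereal (?I \<phi>)" using f by blast
  then obtain \<phi> where \<phi>: "\<And>n. \<phi> n \<in> test_fields" "\<And>n. f n = ereal (?I (\<phi> n))" by metis
  have TS: "ereal T = (SUP n. ereal (?I (\<phi> n)))"
    using TV Sup \<phi>(2) by (simp add: total_variation_borel)
  have [measurable]: "divergence (\<phi> n) \<in> borel_measurable borel" for n by (rule test_fieldD[OF \<phi>(1)])
  define g where "g = (\<lambda>n t. LINT x|lborel. indicator {x. u x > t} x * divergence (\<phi> n) x)"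
  have mg[measurable]: "g n \<in> borel_measurable borel" for n
  proof -
    \<comment> \<open>The conditional form exhibits joint measurability in \<open>t\<close> and
      \<open>x\<close>, from which measurability of the parameter integral follows.\<close>
    have "(\<lambda>t. LINT x|lborel. (if t < u x then divergence (\<phi> n) x else 0)) \<in> borel_measurable borel" by measurable
    moreover have "(LINT x|lborel. (if t < u x then divergence (\<phi> n) x else 0)) = g n t" for t
      unfolding g_def by (rule Bochner_Integration.integral_cong) (auto simp: indicator_def)
    ultimately show ?thesis by simp
  qed
  define p where "p = (\<lambda>t. SUP n. ennreal (g n t))"
  have mp: "p \<in> borel_measurable borel" unfolding p_def by measurable
  have pP: "p t \<le> e2ennreal (perimeter {x. u x > t})" for t
    unfolding p_def
  proof (rule SUP_least)
    fix n
    have "ereal (g n t) \<le> perimeter {x. u x > t}"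
      unfolding perimeter_def g_def by (rule total_variation_upper[OF _ \<phi>(1)]) measurable
    then show "ennreal (g n t) \<le> e2ennreal (perimeter {x. u x > t})"
      unfolding e2ennreal_ereal[symmetric] by (rule e2ennreal_mono)
  qed
  \<comment> \<open>The layer cake formula writes the integral of \<open>u\<close> against the n-th
    divergence as an integral of \<open>g n\<close> over positive levels, and \<open>p\<close>
    dominates every \<open>g n\<close>.\<close>
  have "ereal (?I (\<phi> n)) \<le> enn2ereal (\<integral>\<^sup>+t. p t * indicator {0<..} t \<partial>lborel)" for n
  proof -
    obtain C where C: "\<And>x. \<bar>divergence (\<phi> n) x\<bar> \<le> C"
      using test_field_divergence_bound[OF \<phi>(1)[of n]] by metis
    have lc: "integrable lborel (\<lambda>t. g n t * indicator {0<..} t)" "?I (\<phi> n) = (LINT t|lborel. g n t * indicator {0<..} t)"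
      using layer_cake_integral[OF u test_fieldD(6)[OF \<phi>(1)] C] by (simp_all add: g_def)
    have "ennreal (?I (\<phi> n)) = ennreal (LINT t|lborel. g n t * indicator {0<..} t)"
      using lc(2) by simp
    also have "\<dots> \<le> (\<integral>\<^sup>+t. ennreal (g n t * indicator {0<..} t) \<partial>lborel)"
      by (rule ennreal_integral_le_nn_integral) (use lc(1) in simp)
    also have "\<dots> \<le> (\<integral>\<^sup>+t. p t * indicator {0<..} t \<partial>lborel)"
    proof (rule nn_integral_mono)
      fix t :: real
      have "ennreal (g n t) \<le> p t" unfolding p_def by (rule SUP_upper) simp
      then show "ennreal (g n t * indicator {0<..} t) \<le> p t * indicator {0<..} t"
        by (simp add: indicator_def)
    qed
    finally have "enn2ereal (ennreal (?I (\<phi> n))) \<le> enn2ereal (\<integral>\<^sup>+t. p t * indicator {0<..} t \<partial>lborel)"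
      by (simp add: less_eq_ennreal.rep_eq)
    then show ?thesis using ereal_le_enn2ereal_ennreal order_trans by blast
  qed
  then have "ereal T \<le> enn2ereal (\<integral>\<^sup>+t. p t * indicator {0<..} t \<partial>lborel)"
    unfolding TS by (rule SUP_least)
  then have "ennreal T \<le> (\<integral>\<^sup>+t. p t * indicator {0<..} t \<partial>lborel)"
    using e2ennreal_mono by fastforce
  then show ?thesis using that mp pP by blast
qed

section \<open>Levels and their perimeters\<close>

text \<open>\<open>p\<close> and \<open>q\<close> have the same integral as \<open>T * M\<close> and enclose \<open>P\<close>, so any one-sided comparison of
  \<open>P\<close> with \<open>T * M\<close> is an equality almost everywhere; \<open>P\<close> itself need not be measurable.\<close>
locale level_sandwich =
  fixes p q P M :: "real \<Rightarrow> ennreal" and T :: ennreal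
  assumes p_meas[measurable]: "p \<in> borel_measurable borel"
    and q_meas[measurable]: "q \<in> borel_measurable borel"
    and M_meas[measurable]: "M \<in> borel_measurable borel"
    and p_le: "p t \<le> P t"
    and q_ge: "t > 0 \<Longrightarrow> P t \<le> q t"
    and q_int: "(\<integral>\<^sup>+t. q t * indicator {0<..} t \<partial>lborel) \<le> T"
    and p_int: "T \<le> (\<integral>\<^sup>+t. p t * indicator {0<..} t \<partial>lborel)"
    and M_int: "(\<integral>\<^sup>+t. M t * indicator {0<..} t \<partial>lborel) = 1"
    and P_0: "M t = 0 \<Longrightarrow> P t = 0"
    and T_finite: "T \<noteq> \<infinity>"
begin

lemma TM_int: "(\<integral>\<^sup>+t. T * M t * indicator {0<..} t \<partial>lborel) = T"
  using M_int by (simp add: mult.assoc nn_integral_cmult)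

lemma not_AE_M_eq_0: "\<not> (AE t in lborel. t > 0 \<longrightarrow> M t = 0)"
proof
  assume "AE t in lborel. t > 0 \<longrightarrow> M t = 0"
  then have "(\<integral>\<^sup>+t. M t * indicator {0<..} t \<partial>lborel) = (\<integral>\<^sup>+t. 0 \<partial>(lborel :: real measure))"
    by (intro nn_integral_cong_AE) (auto elim!: eventually_mono simp: indicator_def)
  with M_int show False by simp
qed

text \<open>On positive levels \<open>P\<close> is squeezed between \<open>T * M\<close> and
  \<open>q\<close>. The integral of \<open>q\<close> does not exceed that of \<open>T * M\<close>,
  which is finite, so the two bounds coincide almost everywhere.\<close>

lemma AE_eq_if_ge:
  assumes "\<And>t. t > 0 \<Longrightarrow> M t > 0 \<Longrightarrow> T * M t \<le> P t"
  shows "AE t in lborel. t > 0 \<longrightarrow> P t = T * M t"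
proof -
  \<comment> \<open>Where \<open>M t\<close> is 0 the bound is trivial, so it holds at all positive
    levels.\<close>
  have ge: "T * M t \<le> P t" if "t > 0" for t
    using assms[OF that] by (cases "M t = 0") (auto simp: zero_less_iff_neq_zero)
  have "AE t in lborel. q t * indicator {0<..} t \<le> T * M t * indicator {0<..} t"
  proof (rule ccontr)
    assume "\<not> ?thesis"
    moreover have "(\<integral>\<^sup>+t. T * M t * indicator {0<..} t \<partial>lborel) \<noteq> \<infinity>" using T_finite by (simp add: TM_int)
    moreover have "T * M t * indicator {0<..} t \<le> q t * indicator {0<..} t" for t
      using order_trans[OF ge q_ge, of t] by (auto simp: indicator_def)
    ultimately have "(\<integral>\<^sup>+t. T * M t * indicator {0<..} t \<partial>lborel) < (\<integral>\<^sup>+t. q t * indicator {0<..} t \<partial>lborel)"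
      by (intro nn_integral_less AE_I2) auto
    then show False using q_int by (simp add: TM_int)
  qed
  then show ?thesis
  proof eventually_elim
    case (elim t)
    show ?case
    proof
      assume t: "t > 0"
      then have "q t \<le> T * M t" using elim by simp
      then show "P t = T * M t" using q_ge[OF t] ge[OF t] by (meson antisym order_trans)
    qed
  qed
qed

text \<open>Were every level of positive measure strictly worse than \<open>T * M\<close>, the
  almost everywhere equality of \<open>AE_eq_if_ge\<close> would leave almost no such level,
  contrary to the integral of \<open>M\<close> being 1.\<close>

lemma ex_level_le: "\<exists>t>0. M t > 0 \<and> P t \<le> T * M t"
proof (rule ccontr)
  assume "\<not> ?thesis"
  then have gt: "T * M t < P t" if "t > 0" "M t > 0" for t
    using that by (meson not_le)
  then have "AE t in lborel. t > 0 \<longrightarrow> P t = T * M t" by (intro AE_eq_if_ge less_imp_le gt)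
  then have "AE t in lborel. t > 0 \<longrightarrow> M t = 0"
  proof eventually_elim
    case (elim t)
    show ?case
    proof
      assume "t > 0"
      then show "M t = 0" using elim gt[of t] by (auto simp: zero_less_iff_neq_zero)
    qed
  qed
  then show False using not_AE_M_eq_0 by blast
qed

text \<open>\<open>A\<close> is cut out by \<open>p\<close>, which makes it Borel. If it were null,
  \<open>p\<close> would lie strictly below \<open>T * M\<close> at almost all levels with
  \<open>M t > 0\<close>, although its integral is at least \<open>T\<close>.\<close>

lemma ex_levels_ge:
  obtains A where "A \<in> sets borel" "emeasure lborel A > 0"
    "\<And>t. t \<in> A \<Longrightarrow> t > 0 \<and> M t > 0 \<and> T * M t \<le> P t"
proof -
  define A where "A = {t. t > 0 \<and> M t > 0 \<and> T * M t \<le> p t}"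
  have A: "A \<in> sets borel" unfolding A_def by measurable
  have "emeasure lborel A > 0"
  proof (rule ccontr)
    assume "\<not> emeasure lborel A > 0"
    then have "A \<in> null_sets lborel" using A by (simp add: null_sets_def)
    then have nA: "AE t in lborel. t \<notin> A" by (rule AE_not_in)
    then have le: "AE t in lborel. p t * indicator {0<..} t \<le> T * M t * indicator {0<..} t"
    proof eventually_elim
      case (elim t)
      then show ?case using p_le[of t] P_0[of t]
        by (cases "M t = 0") (auto simp: A_def indicator_def zero_less_iff_neq_zero)
    qed
    \<comment> \<open>The strict comparison of integrals below requires the smaller one to be
      finite.\<close>
    have fin: "(\<integral>\<^sup>+t. p t * indicator {0<..} t \<partial>lborel) \<noteq> \<infinity>"
      using nn_integral_mono_AE[OF le] T_finite by (auto simp: TM_int top_unique)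
    have "AE t in lborel. T * M t * indicator {0<..} t \<le> p t * indicator {0<..} t"
    proof (rule ccontr)
      assume "\<not> ?thesis"
      then have "(\<integral>\<^sup>+t. p t * indicator {0<..} t \<partial>lborel) < (\<integral>\<^sup>+t. T * M t * indicator {0<..} t \<partial>lborel)"
        by (intro nn_integral_less fin le) measurable
      then show False using p_int by (simp add: TM_int)
    qed
    with nA have "AE t in lborel. t > 0 \<longrightarrow> M t = 0"
      by eventually_elim (auto simp: A_def zero_less_iff_neq_zero)
    then show False using not_AE_M_eq_0 by blast
  qed
  moreover have "t > 0 \<and> M t > 0 \<and> T * M t \<le> P t" if "t \<in> A" for t
    using that order_trans[OF _ p_le, of "T * M t" t] by (simp add: A_def)
  ultimately show ?thesis using that A by blast
qed

end

section \<open>From the sandwich to perimeters of superlevel sets\<close>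

lemma ennreal_le_e2ennreal_iff:
  assumes "x \<ge> 0" "P \<ge> 0"
  shows "ennreal x \<le> e2ennreal P \<longleftrightarrow> ereal x \<le> P" "e2ennreal P \<le> ennreal x \<longleftrightarrow> P \<le> ereal x"
  using assms by (cases P; simp add: top_unique)+

lemma perimeter_nonneg: "perimeter E \<ge> 0"
  unfolding perimeter_def by (rule total_variation_nonneg)

lemma test_fields_nonempty: "test_fields \<noteq> {}"
  using zero_test_field by blast

text \<open>Supplies the locale assumption \<open>P_0\<close>: a null superlevel set has perimeter
  0.\<close>

lemma perimeter_null_set:
  fixes E :: "'a::euclidean_space set"
  assumes "E \<in> null_sets lebesgue"
  shows "perimeter E = 0"
proof -
  have "total_variation (indicator E) = total_variation (\<lambda>x::'a. 0 :: real)"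
  proof (rule total_variation_cong_AE)
    show "(indicator E :: 'a \<Rightarrow> real) \<in> borel_measurable lebesgue" using null_setsD2[OF assms] by simp
    show "AE x in lebesgue. indicator E x = (0::real)"
      using AE_not_in[OF assms] by eventually_elim simp
  qed simp
  also have "\<dots> = 0" by (subst total_variation_def, simp, subst SUP_const) (use test_fields_nonempty in \<open>auto simp: zero_ereal_def\<close>)
  finally show ?thesis by (simp add: perimeter_def)
qed

lemma superlevel_measure_finite:
  fixes u :: "'a::euclidean_space \<Rightarrow> real"
  assumes u: "integrable lebesgue u" and t: "t > 0"
  shows "emeasure lebesgue {x. u x > t} < \<infinity>"
proof -
  have [measurable]: "u \<in> borel_measurable lebesgue" using u by simp
  have "emeasure lebesgue {x. u x > t} \<le> emeasure lebesgue {x \<in> space lebesgue. 1 \<le> ennreal (inverse t) * ennreal (norm (u x))}"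
  proof (rule emeasure_mono)
    show "{x. u x > t} \<subseteq> {x \<in> space lebesgue. 1 \<le> ennreal (inverse t) * ennreal (norm (u x))}"
      using t by (auto simp: field_simps simp flip: ennreal_mult ennreal_1 intro!: ennreal_leI)
  qed measurable
  also have "\<dots> \<le> ennreal (inverse t) * (\<integral>\<^sup>+x. ennreal (norm (u x)) \<partial>lebesgue)"
    using nn_integral_Markov_inequality[where u="\<lambda>x. ennreal (norm (u x))" and M=lebesgue and A=UNIV and c="ennreal (inverse t)"]
    by simp
  also have "\<dots> < \<infinity>"
    using u by (simp add: integrable_iff_bounded ennreal_mult_less_top)
  finally show ?thesis .
qed

text \<open>The three conclusions serve three purposes: one good level per component for the
  equality of the infima, equality at almost all levels for eigenfunctions, and a Borel set of bad
  or neutral levels with positive measure for the converse.\<close>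

lemma level_perimeter:
  fixes u :: "'a::euclidean_space \<Rightarrow> real"
  assumes u: "integrable lebesgue u" "AE x in lebesgue. u x \<ge> 0" "(LINT x|lebesgue. \<bar>u x\<bar>) = 1"
    and TV: "total_variation u = ereal T"
  defines "E \<equiv> \<lambda>t. {x. u x > t}"
  shows "\<exists>t>0. emeasure lebesgue (E t) > 0 \<and> perimeter (E t) \<le> ereal (T * measure lebesgue (E t))"
    and "\<lbrakk>\<And>t. t > 0 \<Longrightarrow> emeasure lebesgue (E t) > 0 \<Longrightarrow> ereal (T * measure lebesgue (E t)) \<le> perimeter (E t)\<rbrakk>
      \<Longrightarrow> AE t in lborel. t > 0 \<longrightarrow> perimeter (E t) = ereal (T * measure lebesgue (E t))"
    and "\<exists>A\<in>sets borel. emeasure lborel A > 0 \<and>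
      (\<forall>t\<in>A. t > 0 \<and> emeasure lebesgue (E t) > 0 \<and> ereal (T * measure lebesgue (E t)) \<le> perimeter (E t))"
proof -
  have mu[measurable]: "u \<in> borel_measurable lebesgue" using u(1) by simp
  have T0: "T \<ge> 0" using TV total_variation_nonneg[of u] by simp
  obtain v' where v'[measurable]: "v' \<in> borel_measurable borel" and uv': "AE x in lborel. u x = v' x"
    using completion_ex_borel_measurable_real[OF mu] by auto
  \<comment> \<open>The Borel representative is made nonnegative everywhere, as the layer cake and
    lower coarea lemmas require.\<close>
  define v where "v = (\<lambda>x. max 0 (v' x))"
  have v[measurable]: "v \<in> borel_measurable borel" and v0: "\<And>x. v x \<ge> 0" unfolding v_def by auto
  have vleb[measurable]: "v \<in> borel_measurable lebesgue"
    using measurable_completion[of v lborel borel] by simp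
  have uv: "AE x in lebesgue. u x = v x"
  proof -
    have "AE x in lebesgue. u x = v' x" using uv' by (simp add: AE_completion_iff)
    then show ?thesis using u(2) by eventually_elim (simp add: v_def)
  qed
  have "integrable lebesgue v" by (rule iffD1[OF integrable_cong_AE[OF mu vleb uv] u(1)])
  then have vint: "integrable lborel v" by (rule iffD1[OF integrable_completion, rotated]) simp
  have TVv: "total_variation v = ereal T"
    by (rule trans[OF total_variation_cong_AE[OF mu vleb uv, symmetric] TV])
  have "(LINT x|lebesgue. \<bar>u x\<bar>) = (LINT x|lebesgue. v x)"
    by (rule integral_cong_AE) (use uv v0 in \<open>auto elim!: eventually_mono\<close>)
  then have v1: "(LINT x|lborel. v x) = 1" using u(3) by (simp add: integral_completion)
  have sets: "E t \<in> sets lebesgue" "{x. v x > t} \<in> sets borel" "{x. v x > t} \<in> sets lebesgue" for t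
  proof -
    have "{x \<in> space lebesgue. u x > t} \<in> sets lebesgue" "{x \<in> space borel. v x > t} \<in> sets borel"
      "{x \<in> space lebesgue. v x > t} \<in> sets lebesgue"
      by measurable
    then show "E t \<in> sets lebesgue" "{x. v x > t} \<in> sets borel" "{x. v x > t} \<in> sets lebesgue"
      by (simp_all add: E_def)
  qed
  have AEt: "AE x in lebesgue. x \<in> E t \<longleftrightarrow> x \<in> {x. v x > t}" for t
    using uv by eventually_elim (simp add: E_def)
  have em: "emeasure lebesgue (E t) = emeasure lborel {x. v x > t}" for t
  proof -
    have "emeasure lebesgue (E t) = emeasure lebesgue {x. v x > t}"
      by (rule emeasure_eq_AE[OF AEt]) (use sets in auto)
    then show ?thesis using sets(2)[of t] by simp
  qed
  have per: "perimeter (E t) = perimeter {x. v x > t}" for t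
    unfolding perimeter_def
  proof (rule total_variation_cong_AE)
    show "AE x in lebesgue. indicator (E t) x = (indicator {x. v x > t} x :: real)"
      using AEt[of t] by eventually_elim (simp add: indicator_def)
  qed (use sets in simp_all)
  obtain q where q: "q \<in> borel_measurable borel" "\<And>t. t > 0 \<Longrightarrow> e2ennreal (perimeter {x. v x > t}) \<le> q t"
    "(\<integral>\<^sup>+t. q t * indicator {0<..} t \<partial>lborel) \<le> ennreal T"
    using coarea_upper[OF vint TVv] by metis
  obtain p where p: "p \<in> borel_measurable borel" "\<And>t. p t \<le> e2ennreal (perimeter {x. v x > t})"
    "ennreal T \<le> (\<integral>\<^sup>+t. p t * indicator {0<..} t \<partial>lborel)"
    using coarea_lower[OF vint v0 TVv] by metis
  interpret level_sandwich p q "\<lambda>t. e2ennreal (perimeter (E t))" "\<lambda>t. emeasure lebesgue (E t)" "ennreal T"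
  proof
    show "(\<lambda>t. emeasure lebesgue (E t)) \<in> borel_measurable borel"
      unfolding em by (rule layer_cake_measure(1)[OF v v0])
    show "(\<integral>\<^sup>+t. emeasure lebesgue (E t) * indicator {0<..} t \<partial>lborel) = 1"
      unfolding em layer_cake_measure(2)[OF v v0]
      using v1 vint v0 by (simp add: nn_integral_eq_integral)
    show "e2ennreal (perimeter (E t)) = 0" if "emeasure lebesgue (E t) = 0" for t
      using perimeter_null_set[of "E t"] that sets by (simp add: null_sets_def zero_ereal_def e2ennreal_ereal)
  qed (use p q in \<open>auto simp: per\<close>)
  \<comment> \<open>At a positive level the superlevel set of an integrable function has finite
    measure, so \<open>measure\<close> carries the same information as
    \<open>emeasure\<close>.\<close>
  have conv: "ennreal T * emeasure lebesgue (E t) = ennreal (T * measure lebesgue (E t))" if "t > 0" for t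
    using superlevel_measure_finite[OF u(1) that] T0
    by (simp add: E_def emeasure_eq_ennreal_measure ennreal_mult)
  note iff = ennreal_le_e2ennreal_iff[OF _ perimeter_nonneg]
  have Tm: "T * measure lebesgue (E t) \<ge> 0" for t using T0 by simp
  show "\<exists>t>0. emeasure lebesgue (E t) > 0 \<and> perimeter (E t) \<le> ereal (T * measure lebesgue (E t))"
    using ex_level_le conv iff(2)[OF Tm] by metis
  show "AE t in lborel. t > 0 \<longrightarrow> perimeter (E t) = ereal (T * measure lebesgue (E t))"
    if ge: "\<And>t. t > 0 \<Longrightarrow> emeasure lebesgue (E t) > 0 \<Longrightarrow> ereal (T * measure lebesgue (E t)) \<le> perimeter (E t)"
  proof -
    have "AE t in lborel. t > 0 \<longrightarrow> e2ennreal (perimeter (E t)) = ennreal T * emeasure lebesgue (E t)"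
      by (rule AE_eq_if_ge) (use ge conv iff(1)[OF Tm] in auto)
    then show ?thesis
    proof eventually_elim
      case (elim t)
      show ?case
      proof
        assume "t > 0"
        then have "e2ennreal (perimeter (E t)) = ennreal (T * measure lebesgue (E t))" using elim conv by simp
        then show "perimeter (E t) = ereal (T * measure lebesgue (E t))"
          using iff[OF Tm[of t], of "E t"] by (simp add: antisym)
      qed
    qed
  qed
  show "\<exists>A\<in>sets borel. emeasure lborel A > 0 \<and>
      (\<forall>t\<in>A. t > 0 \<and> emeasure lebesgue (E t) > 0 \<and> ereal (T * measure lebesgue (E t)) \<le> perimeter (E t))"
    using ex_levels_ge conv iff(1)[OF Tm] by metis
qed

section \<open>Products of sets of levels in the space of tuples\<close>

lemma emeasure_lborel_vec_box:
  fixes A :: "'n::finite \<Rightarrow> real set"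
  assumes A[measurable]: "\<And>i. A i \<in> sets borel"
  shows "{t::real^'n. \<forall>i. t $ i \<in> A i} \<in> sets borel"
    and "emeasure lborel {t::real^'n. \<forall>i. t $ i \<in> A i} = (\<Prod>i\<in>UNIV. emeasure lborel (A i))"
proof -
  \<comment> \<open>Decodes a standard basis vector into its index, translating products over
    \<open>Basis\<close> into products over the index type.\<close>
  define j :: "real^'n \<Rightarrow> 'n" where "j = (\<lambda>b. SOME i. b = axis i 1)"
  have j: "j (axis i 1) = i" for i
    unfolding j_def by (rule some_equality) (auto simp: axis_eq_axis)
  have B: "(Basis :: (real^'n) set) = (\<lambda>i. axis i 1) ` UNIV"
    by (auto simp: Basis_vec_def)
  have inj: "inj (\<lambda>i. axis i 1 :: real^'n)" by (rule injI) (simp add: axis_eq_axis)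
  show S: "{t::real^'n. \<forall>i. t $ i \<in> A i} \<in> sets borel"
    by measurable
  have ind: "indicator {t::real^'n. \<forall>i. t $ i \<in> A i} t = (\<Prod>b\<in>Basis. ennreal (indicator (A (j b)) (t \<bullet> b)))" for t
  proof -
    have "(\<Prod>b\<in>Basis. ennreal (indicator (A (j b)) (t \<bullet> b))) = (\<Prod>i\<in>UNIV. ennreal (indicator (A i) (t $ i)))"
      unfolding B by (subst prod.reindex[OF inj]) (simp add: j inner_axis)
    also have "\<dots> = indicator {t::real^'n. \<forall>i. t $ i \<in> A i} t"
    proof (cases "\<forall>i. t $ i \<in> A i")
      case False
      then show ?thesis by (auto simp: indicator_def intro!: prod_zero)
    qed (simp add: indicator_def)
    finally show ?thesis by simp
  qed
  have "emeasure lborel {t::real^'n. \<forall>i. t $ i \<in> A i} = (\<integral>\<^sup>+t. indicator {t::real^'n. \<forall>i. t $ i \<in> A i} t \<partial>lborel)"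
    using S by simp
  also have "\<dots> = (\<integral>\<^sup>+t. (\<Prod>b\<in>Basis. ennreal (indicator (A (j b)) (t \<bullet> b))) \<partial>(lborel :: (real^'n) measure))"
    unfolding ind ..
  also have "\<dots> = (\<Prod>b\<in>(Basis::(real^'n) set). \<integral>\<^sup>+x. ennreal (indicator (A (j b)) x) \<partial>lborel)"
    by (subst nn_integral_lborel_prod[symmetric]) (auto simp: prod_ennreal)
  also have "\<dots> = (\<Prod>b\<in>(Basis::(real^'n) set). emeasure lborel (A (j b)))"
    by (simp add: ennreal_indicator)
  also have "\<dots> = (\<Prod>i\<in>UNIV. emeasure lborel (A i))"
    unfolding B by (subst prod.reindex[OF inj]) (simp add: j)
  finally show "emeasure lborel {t::real^'n. \<forall>i. t $ i \<in> A i} = (\<Prod>i\<in>UNIV. emeasure lborel (A i))" .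
qed

lemma AE_lebesgue_component:
  assumes "AE s in lborel. Q s"
  shows "AE t in (lebesgue :: (real^'n::finite) measure). Q (t $ i)"
proof -
  obtain N where N: "{s. \<not> Q s} \<subseteq> N" "emeasure lborel N = 0" "N \<in> sets borel"
    using AE_E[OF assms] by auto
  define A where "A = (\<lambda>k. if k = i then N else UNIV)"
  have A: "A k \<in> sets borel" for k using N(3) by (simp add: A_def)
  have "emeasure lborel (A i) = 0" using N(2) by (simp add: A_def)
  \<comment> \<open>The remaining factors are infinite, but in \<open>ennreal\<close> zero times
    infinity is zero: the cylinder over a null set is null.\<close>
  then have "(\<Prod>k\<in>UNIV. emeasure lborel (A k)) = 0" by (intro prod_zero) auto
  then have null: "{t::real^'n. \<forall>k. t $ k \<in> A k} \<in> null_sets lborel"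
    using emeasure_lborel_vec_box[of A, OF A] by (simp add: null_sets_def)
  have "AE t in (lborel :: (real^'n) measure). Q (t $ i)"
    using AE_not_in[OF null] by eventually_elim (use N(1) in \<open>auto simp: A_def split: if_splits\<close>)
  then show ?thesis by (simp add: AE_completion_iff)
qed

text \<open>A box with sides of positive measure has positive measure and so cannot lie inside the
  exceptional null set.\<close>

lemma ex_in_box_AE:
  fixes A :: "'n::finite \<Rightarrow> real set"
  assumes A: "\<And>i. A i \<in> sets borel" "\<And>i. emeasure lborel (A i) > 0"
    and R: "AE t in (lebesgue :: (real^'n) measure). R t"
  shows "\<exists>t. (\<forall>i. t $ i \<in> A i) \<and> R t"
proof (rule ccontr)
  assume neg: "\<not> ?thesis"
  let ?S = "{t::real^'n. \<forall>i. t $ i \<in> A i}"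
  have "AE t in (lborel :: (real^'n) measure). R t" using R by (simp add: AE_completion_iff)
  then have "AE t in lborel. t \<notin> ?S"
    by eventually_elim (use neg in blast)
  then have "?S \<in> null_sets lborel"
    using emeasure_lborel_vec_box(1)[of A, OF A(1)] by (subst AE_iff_null_sets) auto
  then have "(\<Prod>i\<in>UNIV. emeasure lborel (A i)) = 0"
    using emeasure_lborel_vec_box(2)[of A, OF A(1)] by (simp add: null_sets_def)
  then show False using A(2) by (auto simp: zero_less_iff_neq_zero)
qed

section \<open>Clusters and eigenfunctions\<close>

text \<open>Guards against the default value: \<open>measure\<close> of a set of infinite volume
  would be 0, and \<open>ratio\<close> would then be 0 as well.\<close>

lemma subset_ae_bounded_finite:
  fixes E F :: "'a::euclidean_space set"
  assumes "bounded F" "E \<in> sets lebesgue" "subset_ae E F"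
  shows "emeasure lebesgue E < \<infinity>"
proof -
  obtain B where "\<And>x. x \<in> F \<Longrightarrow> norm x \<le> B" using assms(1) by (auto simp: bounded_iff)
  then have B: "F \<subseteq> cball 0 B" by auto
  have "emeasure lebesgue E \<le> emeasure lebesgue ((E - F) \<union> cball 0 B)"
    using B assms(3) by (intro emeasure_mono) (auto simp: subset_ae_def)
  also have "\<dots> \<le> emeasure lebesgue (E - F) + emeasure lebesgue (cball (0::'a) B)"
    by (rule emeasure_subadditive) (use assms(3) in \<open>simp_all add: subset_ae_def null_setsD2\<close>)
  also have "\<dots> < \<infinity>"
    using assms(3) emeasure_bounded_finite[of "cball (0::'a) B"] by (simp add: subset_ae_def null_setsD1)
  finally show ?thesis .
qed

lemma ratio_nonneg: "ratio E \<ge> 0"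
  unfolding ratio_def by (intro divide_nonneg_nonneg real_of_ereal_pos perimeter_nonneg) simp

text \<open>Reconciles the real quotient \<open>ratio\<close> of the cluster definitions with the
  extended real quotient in \<open>cheeger_const\<close>.\<close>

lemma perimeter_eq_ratio:
  assumes "perimeter E < \<infinity>" "emeasure lebesgue E > 0" "emeasure lebesgue E < \<infinity>"
  shows "measure lebesgue E > 0" "perimeter E = ereal (ratio E * measure lebesgue E)"
    "perimeter E / enn2ereal (emeasure lebesgue E) = ereal (ratio E)"
proof -
  have em: "emeasure lebesgue E = ennreal (measure lebesgue E)"
    using assms(3) by (intro emeasure_eq_ennreal_measure) auto
  then show pos: "measure lebesgue E > 0" using assms(2) by auto
  obtain r where r: "perimeter E = ereal r"
    using assms(1) perimeter_nonneg[of E] by (cases "perimeter E") auto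
  show "perimeter E = ereal (ratio E * measure lebesgue E)"
    using pos r by (simp add: ratio_def)
  show "perimeter E / enn2ereal (emeasure lebesgue E) = ereal (ratio E)"
    using pos r by (simp add: ratio_def em)
qed

text \<open>Includes the empty case, where both sets are empty and share one default infimum; the
  comparison thus applies before any cluster is known to exist.\<close>

lemma real_Inf_eq_if_dominated:
  fixes A B :: "real set"
  assumes "B \<subseteq> A" "\<And>a. a \<in> A \<Longrightarrow> \<exists>b\<in>B. b \<le> a" "\<And>a. a \<in> A \<Longrightarrow> 0 \<le> a"
  shows "Inf A = Inf B"
proof (cases "A = {}")
  case False
  then have B: "B \<noteq> {}" using assms(2) by blast
  have bdd: "bdd_below A" "bdd_below B" using assms(1,3) by (auto intro!: bdd_belowI[of _ 0])
  show ?thesis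
  proof (rule antisym)
    show "Inf A \<le> Inf B" by (rule cInf_superset_mono[OF B bdd(1) assms(1)])
    show "Inf B \<le> Inf A" by (rule cInf_mono[OF False bdd(2) assms(2)])
  qed
qed (use assms in auto)

context
  fixes \<Omega> :: "'a::euclidean_space set" and \<Phi> :: "real^'n::finite \<Rightarrow> real"
  assumes bnd: "bounded \<Omega>"
    and nonneg: "\<forall>v. nonneg_vec v \<longrightarrow> \<Phi> v \<ge> 0"
    and mono: "Phi3 \<Phi>"
begin

section \<open>Comparison of clusters with functions\<close>

lemma nonneg_ratio_vec: "nonneg_vec (ratio_vec E)"
  by (simp add: nonneg_vec_def ratio_vec_def ratio_nonneg)

lemma nonneg_tv_vec: "nonneg_vec (tv_vec u)"
  by (simp add: nonneg_vec_def tv_vec_def real_of_ereal_pos total_variation_nonneg)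

lemma clusterD:
  assumes "is_cluster \<Omega> E"
  shows "E i \<in> sets lebesgue" "emeasure lebesgue (E i) > 0" "emeasure lebesgue (E i) < \<infinity>"
    "measure lebesgue (E i) > 0" "perimeter (E i) = ereal (ratio (E i) * measure lebesgue (E i))"
    "perimeter (E i) / enn2ereal (emeasure lebesgue (E i)) = ereal (ratio (E i))"
proof -
  show E: "E i \<in> sets lebesgue" "emeasure lebesgue (E i) > 0"
    using assms unfolding is_cluster_def by blast+
  show fin: "emeasure lebesgue (E i) < \<infinity>"
    using assms by (intro subset_ae_bounded_finite[OF bnd E(1)]) (auto simp: is_cluster_def)
  have "perimeter (E i) < \<infinity>" using assms by (auto simp: is_cluster_def)
  from perimeter_eq_ratio[OF this E(2) fin]
  show "measure lebesgue (E i) > 0" "perimeter (E i) = ereal (ratio (E i) * measure lebesgue (E i))"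
    "perimeter (E i) / enn2ereal (emeasure lebesgue (E i)) = ereal (ratio (E i))" .
qed

lemma cluster_function:
  fixes E :: "'n \<Rightarrow> 'a set"
  assumes E: "is_cluster \<Omega> E"
  defines "u \<equiv> \<lambda>i x. indicator (E i) x / measure lebesgue (E i)"
  shows "one_N_function \<Omega> u" "tv_vec u = ratio_vec E"
proof -
  note D = clusterD[OF E]
  have TV: "total_variation (u i) = ereal (ratio (E i))" for i
  proof -
    have "total_variation (u i) = total_variation (\<lambda>x. inverse (measure lebesgue (E i)) * indicator (E i) x)"
      by (simp add: u_def divide_inverse mult.commute)
    also have "\<dots> = ereal (inverse (measure lebesgue (E i))) * perimeter (E i)"
      unfolding perimeter_def by (rule total_variation_scale) (simp add: D(4))
    also have "\<dots> = ereal (ratio (E i))"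
      unfolding D(5) using D(4)[of i] by simp
    finally show ?thesis .
  qed
  then show "tv_vec u = ratio_vec E" by (simp add: tv_vec_def ratio_vec_def)
  have int: "integrable lebesgue (u i)" for i
    unfolding u_def using D(1,3)[of i] by (intro integrable_divide integrable_real_indicator) auto
  have abs: "(LINT x|lebesgue. \<bar>u i x\<bar>) = 1" for i
  proof -
    have "(LINT x|lebesgue. \<bar>u i x\<bar>) = (LINT x|lebesgue. indicator (E i) x / measure lebesgue (E i))"
      by (rule Bochner_Integration.integral_cong) (auto simp: u_def)
    then show ?thesis using D(1,4)[of i] by simp
  qed
  have supp: "AE x in lebesgue. x \<notin> \<Omega> \<longrightarrow> u i x = 0" for i
  proof -
    have "E i - \<Omega> \<in> null_sets lebesgue" using E by (auto simp: is_cluster_def subset_ae_def)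
    from AE_not_in[OF this] show ?thesis by eventually_elim (auto simp: u_def)
  qed
  have disj: "AE x in lebesgue. u i x * u j x = 0" if "i \<noteq> j" for i j
  proof -
    have "E i \<inter> E j \<in> null_sets lebesgue" using E that by (auto simp: is_cluster_def)
    from AE_not_in[OF this] show ?thesis by eventually_elim (auto simp: u_def indicator_def)
  qed
  show "one_N_function \<Omega> u"
    unfolding one_N_function_def BV0_def using int abs supp disj TV by (auto simp: u_def)
qed

lemma N_functionD:
  fixes u :: "'n \<Rightarrow> 'a \<Rightarrow> real"
  assumes "one_N_function \<Omega> u"
  shows "integrable lebesgue (u i)" "AE x in lebesgue. u i x \<ge> 0" "(LINT x|lebesgue. \<bar>u i x\<bar>) = 1"
    "total_variation (u i) = ereal (tv_vec u $ i)"
proof -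
  show "integrable lebesgue (u i)" "AE x in lebesgue. u i x \<ge> 0" "(LINT x|lebesgue. \<bar>u i x\<bar>) = 1"
    using assms by (auto simp: one_N_function_def BV0_def)
  have "total_variation (u i) < \<infinity>" using assms by (auto simp: one_N_function_def BV0_def)
  then show "total_variation (u i) = ereal (tv_vec u $ i)"
    using total_variation_nonneg[of "u i"] by (cases "total_variation (u i)") (auto simp: tv_vec_def)
qed

text \<open>Positive levels matter here: a point of a superlevel set has \<open>u i x\<close>
  nonzero, which places it in the domain and separates it from the other components up to null
  sets.\<close>

lemma superlevel_cluster:
  fixes u :: "'n \<Rightarrow> 'a \<Rightarrow> real"
  assumes u: "one_N_function \<Omega> u"
    and t: "\<And>i. s i > 0" "\<And>i. emeasure lebesgue {x. u i x > s i} > 0"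
    and P: "\<And>i. perimeter {x. u i x > s i} < \<infinity>"
  shows "is_cluster \<Omega> (\<lambda>i. {x. u i x > s i})"
  unfolding is_cluster_def
proof (intro conjI allI impI)
  fix i
  have [measurable]: "u i \<in> borel_measurable lebesgue" for i using N_functionD(1)[OF u, of i] by simp
  have meas: "{x. u i x > s i} \<in> sets lebesgue" for i
  proof -
    have "{x \<in> space lebesgue. u i x > s i} \<in> sets lebesgue" by measurable
    then show ?thesis by simp
  qed
  show "{x. u i x > s i} \<in> sets lebesgue" by (rule meas)
  show "emeasure lebesgue {x. u i x > s i} > 0" by (rule t)
  show "perimeter {x. u i x > s i} < \<infinity>" by (rule P)
  have null: "A \<in> null_sets lebesgue" if AE: "AE x in lebesgue. x \<notin> A" for A :: "'a set"
  proof -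
    obtain N where N: "{x \<in> space lebesgue. \<not> x \<notin> A} \<subseteq> N" "emeasure lebesgue N = 0" "N \<in> sets lebesgue"
      using AE_E[OF AE] by blast
    then have "N \<in> null_sets lebesgue" "A \<subseteq> N" by (auto simp: null_sets_def simp del: emeasure_completion)
    then show ?thesis by (rule null_sets_completion_subset[rotated])
  qed
  show "subset_ae {x. u i x > s i} \<Omega>"
    unfolding subset_ae_def
  proof (rule null)
    have "AE x in lebesgue. x \<notin> \<Omega> \<longrightarrow> u i x = 0" using u by (auto simp: one_N_function_def BV0_def)
    then show "AE x in lebesgue. x \<notin> {x. u i x > s i} - \<Omega>"
      by eventually_elim (use t(1)[of i] in auto)
  qed
  fix j assume "i \<noteq> j"
  then have "AE x in lebesgue. u i x * u j x = 0" using u by (auto simp: one_N_function_def)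
  then have "AE x in lebesgue. x \<notin> {x. u i x > s i} \<inter> {x. u j x > s j}"
    by eventually_elim (use t(1)[of i] t(1)[of j] in auto)
  then show "{x. u i x > s i} \<inter> {x. u j x > s j} \<in> null_sets lebesgue" by (rule null)
qed

text \<open>One component may be prescribed and the others are filled in by good levels. A strict
  gain at the prescribed level thereby becomes a strict gain for the whole vector.\<close>

lemma ex_cluster_le:
  fixes u :: "'n \<Rightarrow> 'a \<Rightarrow> real"
  assumes u: "one_N_function \<Omega> u"
    and s0: "s0 > 0" "emeasure lebesgue {x. u k x > s0} > 0"
      "perimeter {x. u k x > s0} \<le> ereal (tv_vec u $ k * measure lebesgue {x. u k x > s0})"
  obtains E where "is_cluster \<Omega> E" "vle (ratio_vec E) (tv_vec u)" "E k = {x. u k x > s0}"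
proof -
  have "\<forall>i. \<exists>t>0. emeasure lebesgue {x. u i x > t} > 0
      \<and> perimeter {x. u i x > t} \<le> ereal (tv_vec u $ i * measure lebesgue {x. u i x > t})"
    using level_perimeter(1)[OF N_functionD[OF u]] by blast
  then obtain t where t: "\<And>i. t i > 0" "\<And>i. emeasure lebesgue {x. u i x > t i} > 0"
    "\<And>i. perimeter {x. u i x > t i} \<le> ereal (tv_vec u $ i * measure lebesgue {x. u i x > t i})" by metis
  define s where "s = t(k := s0)"
  define E where "E = (\<lambda>i. {x. u i x > s i})"
  have s: "\<And>i. s i > 0" "\<And>i. emeasure lebesgue (E i) > 0"
    "\<And>i. perimeter (E i) \<le> ereal (tv_vec u $ i * measure lebesgue (E i))"
    using t s0 by (auto simp: s_def E_def)
  have "perimeter (E i) < \<infinity>" for i by (rule order_le_less_trans[OF s(3)]) simp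
  with s(2) have E: "is_cluster \<Omega> E"
    unfolding E_def by (intro superlevel_cluster[OF u s(1)])
  have "ratio (E i) \<le> tv_vec u $ i" for i
    using s(3)[of i] clusterD(4,5)[OF E, of i] by simp
  then have "vle (ratio_vec E) (tv_vec u)" by (simp add: vle_def ratio_vec_def)
  then show ?thesis using that[OF E] by (simp add: E_def s_def)
qed

lemma H_Phi_le:
  fixes E :: "'n \<Rightarrow> 'a set"
  assumes "is_cluster \<Omega> E"
  shows "H_Phi \<Phi> \<Omega> \<le> \<Phi> (ratio_vec E)"
  unfolding H_Phi_def
  by (rule cInf_lower) (use assms nonneg nonneg_ratio_vec in \<open>auto intro!: bdd_belowI[of _ 0]\<close>)

lemma Lambda_Phi_le:
  fixes u :: "'n \<Rightarrow> 'a \<Rightarrow> real"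
  assumes "one_N_function \<Omega> u"
  shows "Lambda_Phi \<Phi> \<Omega> \<le> \<Phi> (tv_vec u)"
  unfolding Lambda_Phi_def
  by (rule cInf_lower) (use assms nonneg nonneg_tv_vec in \<open>auto intro!: bdd_belowI[of _ 0]\<close>)

lemma Lambda_eq_H: "Lambda_Phi \<Phi> \<Omega> = H_Phi \<Phi> \<Omega>"
  unfolding Lambda_Phi_def H_Phi_def
proof (rule real_Inf_eq_if_dominated)
  show "{\<Phi> (ratio_vec E) |E. is_cluster \<Omega> E} \<subseteq> {\<Phi> (tv_vec u) |u. one_N_function \<Omega> u}"
  proof
    fix y assume "y \<in> {\<Phi> (ratio_vec E) |E. is_cluster \<Omega> E}"
    then obtain E :: "'n \<Rightarrow> 'a set" where E: "is_cluster \<Omega> E" and y: "y = \<Phi> (ratio_vec E)" by blast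
    show "y \<in> {\<Phi> (tv_vec u) |u. one_N_function \<Omega> u}"
      using cluster_function[OF E] y by (metis (mono_tags, lifting) mem_Collect_eq)
  qed
  show "0 \<le> a" if "a \<in> {\<Phi> (tv_vec u) |u. one_N_function \<Omega> u}" for a
    using that nonneg nonneg_tv_vec by blast
  show "\<exists>b\<in>{\<Phi> (ratio_vec E) |E. is_cluster \<Omega> E}. b \<le> a" if "a \<in> {\<Phi> (tv_vec u) |u. one_N_function \<Omega> u}" for a
  proof -
    obtain u :: "'n \<Rightarrow> 'a \<Rightarrow> real" where u: "one_N_function \<Omega> u" "a = \<Phi> (tv_vec u)" using \<open>a \<in> _\<close> by blast
    \<comment> \<open>Any index can act as the distinguished one; index types are nonempty.\<close>
    obtain k :: 'n where True by blast
    obtain s0 where "s0 > 0" "emeasure lebesgue {x. u k x > s0} > 0"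
      "perimeter {x. u k x > s0} \<le> ereal (tv_vec u $ k * measure lebesgue {x. u k x > s0})"
      using level_perimeter(1)[OF N_functionD[OF u(1)]] by blast
    then obtain E where E: "is_cluster \<Omega> E" "vle (ratio_vec E) (tv_vec u)"
      using ex_cluster_le[OF u(1)] by metis
    then have "\<Phi> (ratio_vec E) \<le> a"
      using mono nonneg_ratio_vec nonneg_tv_vec u(2) unfolding Phi3_def by blast
    then show ?thesis using E(1) by blast
  qed
qed

text \<open>Up to a null set \<open>E i\<close> is itself a competitor in the complement of the
  other chambers. A better competitor could replace it, which yields a cluster with strictly smaller
  ratio vector and contradicts minimality under strict monotonicity.\<close>

lemma cheeger_cluster_one_adjusted:
  fixes E :: "'n \<Rightarrow> 'a set"
  assumes strict: "Phi3plus \<Phi>" and E: "cheeger_cluster \<Phi> \<Omega> E"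
  shows "one_adjusted \<Omega> E"
  unfolding one_adjusted_def
proof
  fix i
  have cl: "is_cluster \<Omega> E" and min: "\<Phi> (ratio_vec E) = H_Phi \<Phi> \<Omega>"
    using E by (auto simp: cheeger_cluster_def)
  note D = clusterD[OF cl]
  let ?F = "\<Omega> - cluster_compl E i"
  have "E i - ?F \<subseteq> (E i - \<Omega>) \<union> (\<Union>j\<in>UNIV - {i}. E i \<inter> E j)" by (auto simp: cluster_compl_def)
  moreover have "(E i - \<Omega>) \<union> (\<Union>j\<in>UNIV - {i}. E i \<inter> E j) \<in> null_sets lebesgue"
  proof (rule null_sets.Un)
    show "E i - \<Omega> \<in> null_sets lebesgue" using cl by (auto simp: is_cluster_def subset_ae_def)
    show "(\<Union>j\<in>UNIV - {i}. E i \<inter> E j) \<in> null_sets lebesgue"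
      by (rule null_sets_UN') (use cl in \<open>auto simp: is_cluster_def intro: countable_finite\<close>)
  qed
  ultimately have "subset_ae (E i) ?F"
    unfolding subset_ae_def by (rule null_sets_completion_subset)
  then have "cheeger_const ?F \<le> perimeter (E i) / enn2ereal (emeasure lebesgue (E i))"
    unfolding cheeger_const_def by (intro INF_lower) (use D in auto)
  then have le: "cheeger_const ?F \<le> ereal (ratio (E i))" by (simp add: D(6))
  have ge: "ereal (ratio (E i)) \<le> perimeter G / enn2ereal (emeasure lebesgue G)"
    if G: "G \<in> sets lebesgue" "subset_ae G ?F" "emeasure lebesgue G > 0" for G
  proof (rule ccontr)
    assume "\<not> ?thesis"
    then have lt: "perimeter G / enn2ereal (emeasure lebesgue G) < ereal (ratio (E i))" by simp
    have sub: "subset_ae G \<Omega>"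
      using G(2) unfolding subset_ae_def by (rule null_sets_completion_subset[rotated]) auto
    have fin: "emeasure lebesgue G < \<infinity>" by (rule subset_ae_bounded_finite[OF bnd G(1) sub])
    then have em: "emeasure lebesgue G = ennreal (measure lebesgue G)"
      by (intro emeasure_eq_ennreal_measure) auto
    with G(3) have pos: "measure lebesgue G > 0" by auto
    \<comment> \<open>An infinite perimeter over a positive finite volume would make the quotient
      infinite, against \<open>lt\<close>.\<close>
    have P: "perimeter G < \<infinity>"
      using lt pos by (cases "perimeter G") (auto simp: em)
    note R = perimeter_eq_ratio[OF P G(3) fin]
    have ratio_lt: "ratio G < ratio (E i)" using lt R(3) by simp
    define E' where "E' = E(i := G)"
    have GE: "G \<inter> E j \<in> null_sets lebesgue" if "j \<noteq> i" for j
    proof (rule null_sets_completion_subset)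
      show "G \<inter> E j \<subseteq> G - ?F" using that by (auto simp: cluster_compl_def)
      show "G - ?F \<in> null_sets lebesgue" using G(2) by (simp add: subset_ae_def)
    qed
    then have EG: "E j \<inter> G \<in> null_sets lebesgue" if "j \<noteq> i" for j
      using that by (simp add: Int_commute)
    have cl': "is_cluster \<Omega> E'"
      using cl G sub P GE EG unfolding is_cluster_def E'_def by (auto simp del: emeasure_completion)
    have "vlt (ratio_vec E') (ratio_vec E)"
      using ratio_lt by (auto simp: vlt_def vle_def ratio_vec_def E'_def vec_eq_iff intro!: exI[of _ i])
    then have "\<Phi> (ratio_vec E') < \<Phi> (ratio_vec E)"
      using strict nonneg_ratio_vec unfolding Phi3plus_def by blast
    then show False using H_Phi_le[OF cl'] min by linarith
  qed
  have "ereal (ratio (E i)) \<le> cheeger_const ?F"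
    unfolding cheeger_const_def by (rule INF_greatest) (use ge in auto)
  then show "ereal (ratio (E i)) = cheeger_const ?F" using le by (rule antisym)
qed

text \<open>A level with smaller quotient would extend, by \<open>ex_cluster_le\<close>, to a
  cluster beating the minimum. Hence almost every level tuple has ratio vector exactly
  \<open>tv_vec u\<close>, and the equality of the two infima makes its cluster minimal.\<close>

lemma eigen_imp_cheeger_levels:
  fixes u :: "'n \<Rightarrow> 'a \<Rightarrow> real"
  assumes strict: "Phi3plus \<Phi>" and eig: "eigen_N_function \<Phi> \<Omega> u"
  shows "AE t in lebesgue. (\<forall>i. t $ i > 0) \<longrightarrow> (\<forall>i. emeasure lebesgue {x. u i x > t $ i} > 0) \<longrightarrow>
    cheeger_cluster \<Phi> \<Omega> (\<lambda>i. {x. u i x > t $ i})"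
proof -
  have u: "one_N_function \<Omega> u" and min: "\<Phi> (tv_vec u) = H_Phi \<Phi> \<Omega>"
    using eig Lambda_eq_H by (auto simp: eigen_N_function_def)
  have ge: "ereal (tv_vec u $ i * measure lebesgue {x. u i x > s}) \<le> perimeter {x. u i x > s}"
    if s: "s > 0" "emeasure lebesgue {x. u i x > s} > 0" for i s
  proof (rule ccontr)
    assume "\<not> ?thesis"
    then have lt: "perimeter {x. u i x > s} < ereal (tv_vec u $ i * measure lebesgue {x. u i x > s})" by simp
    obtain E where E: "is_cluster \<Omega> E" "vle (ratio_vec E) (tv_vec u)" "E i = {x. u i x > s}"
      using ex_cluster_le[OF u s less_imp_le[OF lt]] by metis
    have "ratio (E i) < tv_vec u $ i"
      using lt clusterD(4,5)[OF E(1), of i] by (simp add: E(3))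
    then have "ratio_vec E $ i \<noteq> tv_vec u $ i" by (simp add: ratio_vec_def)
    then have "vlt (ratio_vec E) (tv_vec u)"
      using E(2) by (auto simp: vlt_def)
    then have "\<Phi> (ratio_vec E) < \<Phi> (tv_vec u)"
      using strict nonneg_ratio_vec nonneg_tv_vec unfolding Phi3plus_def by blast
    then show False using H_Phi_le[OF E(1)] min by linarith
  qed
  \<comment> \<open>The equality is known for almost every level of one component. It is lifted to
    almost every tuple and then intersected over the finitely many indices.\<close>
  have "AE t in (lebesgue :: (real^'n) measure). t $ i > 0 \<longrightarrow>
      perimeter {x. u i x > t $ i} = ereal (tv_vec u $ i * measure lebesgue {x. u i x > t $ i})" for i
    by (rule AE_lebesgue_component[OF level_perimeter(2)[OF N_functionD[OF u] ge]])
  then have "AE t in (lebesgue :: (real^'n) measure). \<forall>i. t $ i > 0 \<longrightarrow>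
      perimeter {x. u i x > t $ i} = ereal (tv_vec u $ i * measure lebesgue {x. u i x > t $ i})"
    by (intro eventually_all_finite) auto
  then show ?thesis
  proof eventually_elim
    case (elim t)
    show ?case
    proof (intro impI)
      assume t: "\<forall>i. t $ i > 0" "\<forall>i. emeasure lebesgue {x. u i x > t $ i} > 0"
      define E where "E = (\<lambda>i. {x. u i x > t $ i})"
      have per: "perimeter (E i) = ereal (tv_vec u $ i * measure lebesgue (E i))" for i
        using elim t by (simp add: E_def)
      have cl: "is_cluster \<Omega> E"
        unfolding E_def by (rule superlevel_cluster[OF u]) (use t per in \<open>auto simp: E_def simp del: emeasure_completion\<close>)
      have "ratio (E i) = tv_vec u $ i" for i
        using per[of i] clusterD(4,5)[OF cl, of i] by simp
      then have "ratio_vec E = tv_vec u" by (simp add: ratio_vec_def vec_eq_iff)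
      then have "cheeger_cluster \<Phi> \<Omega> E" using cl min by (simp add: cheeger_cluster_def)
      then show "cheeger_cluster \<Phi> \<Omega> (\<lambda>i. {x. u i x > t $ i})" by (simp add: E_def)
    qed
  qed
qed

text \<open>For each \<open>i\<close> the levels whose perimeter quotient is at least \<open>TV (u i)\<close> contain a set of positive
  measure, so one admissible \<open>t\<close> has all its components in these sets.\<close>
lemma cheeger_levels_imp_eigen:
  fixes u :: "'n \<Rightarrow> 'a \<Rightarrow> real"
  assumes u: "one_N_function \<Omega> u"
    and lev: "AE t in lebesgue. (\<forall>i. t $ i > 0) \<longrightarrow> (\<forall>i. emeasure lebesgue {x. u i x > t $ i} > 0) \<longrightarrow>
      cheeger_cluster \<Phi> \<Omega> (\<lambda>i. {x. u i x > t $ i})"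
  shows "eigen_N_function \<Phi> \<Omega> u"
proof -
  have "\<forall>i. \<exists>A\<in>sets borel. emeasure lborel A > 0 \<and> (\<forall>t\<in>A. t > 0 \<and> emeasure lebesgue {x. u i x > t} > 0 \<and>
      ereal (tv_vec u $ i * measure lebesgue {x. u i x > t}) \<le> perimeter {x. u i x > t})"
    using level_perimeter(3)[OF N_functionD[OF u]] by blast
  then obtain A where A: "\<And>i. A i \<in> sets borel" "\<And>i. emeasure lborel (A i) > 0"
    "\<And>i t. t \<in> A i \<Longrightarrow> t > 0 \<and> emeasure lebesgue {x. u i x > t} > 0 \<and>
      ereal (tv_vec u $ i * measure lebesgue {x. u i x > t}) \<le> perimeter {x. u i x > t}" by metis
  obtain t :: "real^'n" where t: "\<forall>i. t $ i \<in> A i"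
    and imp: "(\<forall>i. t $ i > 0) \<longrightarrow> (\<forall>i. emeasure lebesgue {x. u i x > t $ i} > 0) \<longrightarrow>
      cheeger_cluster \<Phi> \<Omega> (\<lambda>i. {x. u i x > t $ i})"
    using ex_in_box_AE[of A, OF A(1,2) lev] by (elim exE conjE)
  note tA = A(3)[OF t[rule_format]]
  define E where "E = (\<lambda>i. {x. u i x > t $ i})"
  have E: "cheeger_cluster \<Phi> \<Omega> E"
    unfolding E_def using tA imp by blast
  then have cl: "is_cluster \<Omega> E" and min: "\<Phi> (ratio_vec E) = H_Phi \<Phi> \<Omega>"
    by (auto simp: cheeger_cluster_def)
  have "tv_vec u $ i \<le> ratio (E i)" for i
    using tA[of i] clusterD(4,5)[OF cl, of i] by (simp add: E_def)
  then have "vle (tv_vec u) (ratio_vec E)" by (simp add: vle_def ratio_vec_def)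
  then have "\<Phi> (tv_vec u) \<le> \<Phi> (ratio_vec E)"
    using mono nonneg_ratio_vec nonneg_tv_vec unfolding Phi3_def by blast
  then have "\<Phi> (tv_vec u) = Lambda_Phi \<Phi> \<Omega>"
    using Lambda_Phi_le[OF u] min Lambda_eq_H by linarith
  then show ?thesis using u by (simp add: eigen_N_function_def)
qed

end

theorem mainTheorem10:
  fixes \<Omega> :: "'a::euclidean_space set"
    and \<Phi> :: "real^'n::finite \<Rightarrow> real"
  assumes "open \<Omega>" and "bounded \<Omega>" and "\<Omega> \<noteq> {}"
    and "\<forall>v. nonneg_vec v \<longrightarrow> \<Phi> v \<ge> 0"
    and "Phi3 \<Phi>"
  shows "Lambda_Phi \<Phi> \<Omega> = H_Phi \<Phi> \<Omega>
     \<and> (Phi3plus \<Phi> \<longrightarrow>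
          (\<forall>u :: 'n \<Rightarrow> 'a \<Rightarrow> real. one_N_function \<Omega> u \<longrightarrow>
             (eigen_N_function \<Phi> \<Omega> u \<longleftrightarrow>
               (AE t in lebesgue. (\<forall>i. t $ i > 0) \<longrightarrow>
                  (\<forall>i. emeasure lebesgue {x. u i x > t $ i} > 0) \<longrightarrow>
                  (let E = (\<lambda>i. {x. u i x > t $ i}) in
                     one_adjusted \<Omega> E \<and> cheeger_cluster \<Phi> \<Omega> E))))
        \<and> (\<forall>E :: 'n \<Rightarrow> 'a set. cheeger_cluster \<Phi> \<Omega> E \<longrightarrow>
             eigen_N_function \<Phi> \<Omega> (\<lambda>i x. indicator (E i) x / measure lebesgue (E i))))"
proof (intro conjI impI allI iffI)
  show eq: "Lambda_Phi \<Phi> \<Omega> = H_Phi \<Phi> \<Omega>" by (rule Lambda_eq_H[OF assms(2,4,5)])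
  assume strict: "Phi3plus \<Phi>"
  {
    fix u :: "'n \<Rightarrow> 'a \<Rightarrow> real" assume "eigen_N_function \<Phi> \<Omega> u"
    from eigen_imp_cheeger_levels[OF assms(2,4,5) strict this]
    show "AE t in lebesgue. (\<forall>i. t $ i > 0) \<longrightarrow>
                  (\<forall>i. emeasure lebesgue {x. u i x > t $ i} > 0) \<longrightarrow>
                  (let E = (\<lambda>i. {x. u i x > t $ i}) in
                     one_adjusted \<Omega> E \<and> cheeger_cluster \<Phi> \<Omega> E)"
      by eventually_elim
        (use cheeger_cluster_one_adjusted[OF assms(2,4,5) strict] in \<open>auto simp: Let_def\<close>)
  next
    fix u :: "'n \<Rightarrow> 'a \<Rightarrow> real" assume u: "one_N_function \<Omega> u"
      and "AE t in lebesgue. (\<forall>i. t $ i > 0) \<longrightarrow>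
                  (\<forall>i. emeasure lebesgue {x. u i x > t $ i} > 0) \<longrightarrow>
                  (let E = (\<lambda>i. {x. u i x > t $ i}) in
                     one_adjusted \<Omega> E \<and> cheeger_cluster \<Phi> \<Omega> E)"
    then show "eigen_N_function \<Phi> \<Omega> u"
      by (intro cheeger_levels_imp_eigen[OF assms(2,4,5) u]) (auto elim!: eventually_mono simp: Let_def)
  next
    fix E :: "'n \<Rightarrow> 'a set" assume E: "cheeger_cluster \<Phi> \<Omega> E"
    then have "is_cluster \<Omega> E" by (simp add: cheeger_cluster_def)
    \<comment> \<open>The normalized indicators have the ratio vector of \<open>E\<close> as
      variation vector, so the equality of the infima transfers minimality.\<close>
    from cluster_function[OF assms(2,4,5) this]
    show "eigen_N_function \<Phi> \<Omega> (\<lambda>i x. indicator (E i) x / measure lebesgue (E i))"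
      using E eq by (simp add: eigen_N_function_def cheeger_cluster_def)
  }
qed

end
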